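(* Let $N\ge 1$, let $u$ be the solution of the scaled radiative transfer equation and let $u_{P_N}=\bm{m}^{T}\bm{u}$, where $\bm{u}$ is the solution of the $P_N$ equations (both defined in the context). Assume that for some $q>0$, $$u\in L^2(X;H^q(\mathbb{S})),\qquad \partial_i u\in L^2(X;H^q(\mathbb{S})),\quad i=1,2,3.$$ Then $$\|u-u_{P_N}\|_{L^2(X\times\mathbb{S})}\le C\,N^{-q}\Big(\|u\|_{L^2(X;H^q(\mathbb{S}))}+\sum_{i=1}^{3}\|\partial_i u\|_{L^2(X;H^q(\mathbb{S}))}\Big),$$ where the constant $C>0$ is independent of $N$, $\varepsilon\in(0,1)$ and $u$ (it may depend on $q$, $\sigma_{\mathrm t}$, $\sigma_{\mathrm a}$).
   Context: Let $X=(0,1)^3$, let $\mathbb{S}$ be the unit sphere in $\mathbb{R}^3$, and $0<\varepsilon<1$. Standing assumptions: $\sigma_{\mathrm t},\sigma_{\mathrm a}\in L^\infty(X)$ with $\sigma_{\mathrm t}-\varepsilon^2\sigma_{\mathrm a}>0$ a.e. in $X$; $\sigma_{\mathrm t}>\sigma_{\mathrm a}\ge\sigma_{\mathrm a}^{\min}$ in $X$ for some constant $\sigma_{\mathrm a}^{\min}>0$; $f\in L^2(X\times\mathbb{S})$. The data $\sigma_{\mathrm t},\sigma_{\mathrm a},f$ do not depend on $\varepsilon$. The scaled radiative transfer equation with periodic boundary conditions is $$\bm{\omega}\cdot\nabla u(\mathbf{x},\bm{\omega})+\frac{\sigma_{\mathrm t}}{\varepsilon}u(\mathbf{x},\bm{\omega})=\Big(\frac{\sigma_{\mathrm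 t}}{\varepsilon}-\varepsilon\sigma_{\mathrm a}\Big)\overline{u}(\mathbf{x})+\varepsilon f,\quad (\mathbf{x},\bm{\omega})\in X\times\mathbb{S},$$ $$u(\mathbf{x},\bm{\omega})=u(\mathbf{x}-\mathbf{k}(\mathbf{x}),\bm{\omega}),\quad \mathbf{x}\in\partial X,\ \bm{\omega}\cdot\mathbf{k}(\mathbf{x})<0,$$ where $\mathbf{k}(\mathbf{x})$ is the unit outward normal on $\partial X$ and $\overline{u}=\frac{1}{4\pi}\int_{\mathbb{S}}u\,d\bm{\omega}$. Its unique solution $u$ is taken in the space of functions $v\in L^2(X\times\mathbb{S})$ with $\bm{\omega}\cdot\nabla v\in L^2(X\times\mathbb{S})$ that are $1$-periodic in each spatial component. $P_N$ equations: let $m_\ell^\kappa$ ($\ell\ge0$, $|\kappa|\le\ell$) be the real-valued spherical harmonics, normalized to be orthonormal in $L^2(\mathbb{S})$. Let $\bm{m}$ be the column vector collecting all $m_\ell^\kappa$ with $0\le\ell\le N$, $|\kappa|\le\ell$, ordered by increasing $\ell$; it has $L=(N+1)^2$ entries. Put $\bm{A}^{(i)}=\int_{\mathbb{S}}\omega_i\bm{m}\bm{m}^{T}d\bm{\omega}$, $\bm{R}=\mathrm{diag}(0,1,\dots,1)\in\mathbb{R}^{L\times L}$, $\bm{f}=\int_{\mathbb{S}}\bm{m}f\,d\bm{\omega}$. The function $\bm{u}:X\to\mathbb{R}^L$ is the unique solution of $$\sum_{i=1}^3\bm{A}^{(i)}\partial_i\bm{u}+\varepsilon\sigma_{\mathrm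 a}\bm{u}+\Big(\frac{\sigma_{\mathrm t}}{\varepsilon}-\varepsilon\sigma_{\mathrm a}\Big)\bm{R}\bm{u}=\varepsilon\bm{f}\quad\text{in }X$$ with periodic boundary conditions, in the space of $\bm{u}\in[L^2(X)]^L$ with $\sum_i\bm{A}^{(i)}\partial_i\bm{u}\in[L^2(X)]^L$ that are $1$-periodic in each spatial argument. *)

theory Defs
  imports "HOL-Analysis.Analysis" "HOL-Computational_Algebra.Polynomial"
begin

section \<open>Domain, unit sphere and square-integrable functions\<close>

type_synonym vec3 = "real ^ 3"

definition unit_cube :: "vec3 set" where
  "unit_cube = {x. \<forall>i. 0 < x $ i \<and> x $ i < 1}"

abbreviation cube_measure :: "vec3 measure" where
  "cube_measure \<equiv> restrict_space lborel unit_cube"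

text \<open>
  Surface measure on the unit sphere: the image of
  \<open>sin \<theta> d\<theta> d\<phi>\<close> on \<open>[0, \<pi>] \<times> [0, 2\<pi>]\<close> under spherical coordinates
  (total mass \<open>4\<pi>\<close>).
\<close>

definition spherical_point :: "real \<times> real \<Rightarrow> vec3" where
  "spherical_point = (\<lambda>(\<theta>, \<phi>). vector [sin \<theta> * cos \<phi>, sin \<theta> * sin \<phi>, cos \<theta>])"

definition sphere_measure :: "vec3 measure" where
  "sphere_measure =
     distr (density (restrict_space lborel ({0..pi} \<times> {0..2 * pi})) (\<lambda>(\<theta>, \<phi>). ennreal (sin \<theta>)))
           (restrict_space borel (sphere 0 1)) spherical_point"

abbreviation phase_measure :: "(vec3 \<times> vec3) measure" where
  "phase_measure \<equiv> cube_measure \<Otimes>\<^sub>M sphere_measure"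

text \<open>
  Elements of \<open>L\<^sup>2\<close> and \<open>L\<^sup>\<infinity>\<close> are represented by Borel functions; every class has
  such a representative.
\<close>

definition in_L2 :: "'a measure \<Rightarrow> ('a \<Rightarrow> real) \<Rightarrow> bool" where
  "in_L2 M f \<longleftrightarrow> f \<in> borel_measurable M \<and> integrable M (\<lambda>x. (f x)\<^sup>2)"

definition L2norm :: "'a measure \<Rightarrow> ('a \<Rightarrow> real) \<Rightarrow> real" where
  "L2norm M f = sqrt (\<integral>x. (f x)\<^sup>2 \<partial>M)"

definition in_Linf :: "'a measure \<Rightarrow> ('a \<Rightarrow> real) \<Rightarrow> bool" where
  "in_Linf M f \<longleftrightarrow> f \<in> borel_measurable M \<and> (\<exists>B. AE x in M. \<bar>f x\<bar> \<le> B)"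


section \<open>Real spherical harmonics and the spaces \<open>H\<^sup>q(S)\<close>, \<open>L\<^sup>2(X; H\<^sup>q(S))\<close>\<close>

definition legendre_poly :: "nat \<Rightarrow> real poly" where
  "legendre_poly l = smult (1 / (2 ^ l * fact l)) ((pderiv ^^ l) ([:-1, 0, 1:] ^ l))"

text \<open>
  On the unit sphere \<open>(sin \<theta>)\<^sup>k cos (k\<phi>)\<close> and \<open>(sin \<theta>)\<^sup>k sin (k\<phi>)\<close> are the real and
  imaginary parts of \<open>(\<omega>\<^sub>1 + \<i> \<omega>\<^sub>2)\<^sup>k\<close>, so the function below is
  \<open>c P\<^sub>l\<^sup>k(cos \<theta>) cos (k\<phi>)\<close> or \<open>c P\<^sub>l\<^sup>k(cos \<theta>) sin (k\<phi>)\<close> with \<open>k = \<bar>\<kappa>\<bar>\<close> and the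
  associated Legendre functions taken without the factor \<open>(-1)\<^sup>k\<close>.
\<close>

definition sph_harm :: "nat \<Rightarrow> int \<Rightarrow> vec3 \<Rightarrow> real" where
  "sph_harm l \<kappa> \<omega> =
     (let k = nat \<bar>\<kappa>\<bar>; z = Complex (\<omega> $ 1) (\<omega> $ 2) in
      sqrt ((if k = 0 then 1 else 2) * (2 * real l + 1) / (4 * pi) * (fact (l - k) / fact (l + k)))
      * poly ((pderiv ^^ k) (legendre_poly l)) (\<omega> $ 3)
      * (if \<kappa> \<ge> 0 then Re (z ^ k) else Im (z ^ k)))"

definition sph_coeff :: "(vec3 \<Rightarrow> real) \<Rightarrow> nat \<Rightarrow> int \<Rightarrow> real" where
  "sph_coeff w l \<kappa> = (\<integral>\<omega>. sph_harm l \<kappa> \<omega> * w \<omega> \<partial>sphere_measure)"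

text \<open>
  Sobolev space of real order \<open>q\<close> on the sphere, with the norm of
  \<open>(I - \<Delta>)\<^bsup>q/2\<^esup> w\<close> in \<open>L\<^sup>2\<close>, where \<open>\<Delta>\<close> is the Laplace-Beltrami operator, whose
  eigenvalue on the harmonics of degree \<open>l\<close> is \<open>- l (l + 1)\<close>.
\<close>

definition Hq_term :: "real \<Rightarrow> (vec3 \<Rightarrow> real) \<Rightarrow> nat \<Rightarrow> real" where
  "Hq_term q w l = (1 + real l * (real l + 1)) powr q * (\<Sum>\<kappa>=-int l..int l. (sph_coeff w l \<kappa>)\<^sup>2)"

definition in_Hq :: "real \<Rightarrow> (vec3 \<Rightarrow> real) \<Rightarrow> bool" where
  "in_Hq q w \<longleftrightarrow> in_L2 sphere_measure w \<and> summable (Hq_term q w)"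

definition Hq_norm :: "real \<Rightarrow> (vec3 \<Rightarrow> real) \<Rightarrow> real" where
  "Hq_norm q w = sqrt (\<Sum>l. Hq_term q w l)"

definition in_L2_Hq :: "real \<Rightarrow> (vec3 \<times> vec3 \<Rightarrow> real) \<Rightarrow> bool" where
  "in_L2_Hq q v \<longleftrightarrow>
     v \<in> borel_measurable phase_measure \<and>
     (AE x in cube_measure. in_Hq q (\<lambda>\<omega>. v (x, \<omega>))) \<and>
     in_L2 cube_measure (\<lambda>x. Hq_norm q (\<lambda>\<omega>. v (x, \<omega>)))"

definition L2_Hq_norm :: "real \<Rightarrow> (vec3 \<times> vec3 \<Rightarrow> real) \<Rightarrow> real" where
  "L2_Hq_norm q v = L2norm cube_measure (\<lambda>x. Hq_norm q (\<lambda>\<omega>. v (x, \<omega>)))"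


section \<open>Weak derivatives in the space variable\<close>

primrec Ck :: "nat \<Rightarrow> (vec3 \<Rightarrow> real) \<Rightarrow> bool" where
  "Ck 0 \<phi> \<longleftrightarrow> continuous_on UNIV \<phi>"
| "Ck (Suc n) \<phi> \<longleftrightarrow>
     \<phi> differentiable_on UNIV \<and> (\<forall>i. Ck n (\<lambda>x. frechet_derivative \<phi> (at x) (axis i 1)))"

definition test_function :: "vec3 set \<Rightarrow> (vec3 \<Rightarrow> real) \<Rightarrow> bool" where
  "test_function \<Omega> \<phi> \<longleftrightarrow>
     (\<forall>n. Ck n \<phi>) \<and> (\<exists>K. compact K \<and> K \<subseteq> \<Omega> \<and> (\<forall>x. x \<notin> K \<longrightarrow> \<phi> x = 0))"

text \<open>
  \<open>g\<close> is the weak derivative \<open>b(\<omega>) \<cdot> \<nabla>v\<close> on \<open>\<Omega>\<close>, as an identity between functions of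
  \<open>x\<close> with values in \<open>L\<^sup>2\<close> of the sphere.
\<close>

definition weak_dir_deriv ::
  "vec3 set \<Rightarrow> (vec3 \<Rightarrow> vec3) \<Rightarrow> (vec3 \<times> vec3 \<Rightarrow> real) \<Rightarrow> (vec3 \<times> vec3 \<Rightarrow> real) \<Rightarrow> bool" where
  "weak_dir_deriv \<Omega> b v g \<longleftrightarrow>
     (\<forall>\<phi>. test_function \<Omega> \<phi> \<longrightarrow>
        (AE \<omega> in sphere_measure.
           (LINT x:\<Omega>|lborel. v (x, \<omega>) * frechet_derivative \<phi> (at x) (b \<omega>))
             = - (LINT x:\<Omega>|lborel. g (x, \<omega>) * \<phi> x)))"


section \<open>The scaled radiative transfer equation\<close>

text \<open>
  Periodic functions are defined on all of \<open>R\<^sup>3\<close>. The periodic boundary condition is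
  built into the solution spaces: the weak derivative of the periodic function is
  taken on \<open>R\<^sup>3\<close>, so it is a function only if the traces on opposite faces agree. The
  weak derivative of a periodic function is periodic, up to null sets.
\<close>

definition periodic_L2_phase :: "(vec3 \<times> vec3 \<Rightarrow> real) \<Rightarrow> bool" where
  "periodic_L2_phase v \<longleftrightarrow>
     v \<in> borel_measurable (lborel \<Otimes>\<^sub>M sphere_measure) \<and>
     (\<forall>x. \<forall>\<omega>\<in>sphere 0 1. \<forall>i. v (x + axis i 1, \<omega>) = v (x, \<omega>)) \<and>
     in_L2 phase_measure v"

definition angular_mean :: "(vec3 \<times> vec3 \<Rightarrow> real) \<Rightarrow> vec3 \<Rightarrow> real" where
  "angular_mean v x = 1 / (4 * pi) * (\<integral>\<omega>. v (x, \<omega>) \<partial>sphere_measure)"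

definition rte_solution ::
  "(vec3 \<Rightarrow> real) \<Rightarrow> (vec3 \<Rightarrow> real) \<Rightarrow> (vec3 \<times> vec3 \<Rightarrow> real) \<Rightarrow> real \<Rightarrow> (vec3 \<times> vec3 \<Rightarrow> real) \<Rightarrow> bool" where
  "rte_solution \<sigma>t \<sigma>a f \<epsilon> u \<longleftrightarrow>
     periodic_L2_phase u \<and>
     (\<exists>g. periodic_L2_phase g \<and>
          weak_dir_deriv UNIV (\<lambda>\<omega>. \<omega>) u g \<and>
          (AE (x, \<omega>) in phase_measure.
             g (x, \<omega>) + \<sigma>t x / \<epsilon> * u (x, \<omega>)
               = (\<sigma>t x / \<epsilon> - \<epsilon> * \<sigma>a x) * angular_mean u x + \<epsilon> * f (x, \<omega>)))"


section \<open>The \<open>P\<^sub>N\<close> equations\<close>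

text \<open>
  Vectors of length \<open>(N + 1)\<^sup>2\<close> are indexed by the pairs \<open>(l, \<kappa>)\<close>; their order plays
  no role apart from \<open>(0, 0)\<close> being the first index.
\<close>

type_synonym pn_index = "nat \<times> int"

definition PN_indices :: "nat \<Rightarrow> pn_index set" where
  "PN_indices N = {(l, \<kappa>). l \<le> N \<and> \<bar>\<kappa>\<bar> \<le> int l}"

definition PN_m :: "pn_index \<Rightarrow> vec3 \<Rightarrow> real" where
  "PN_m j \<omega> = sph_harm (fst j) (snd j) \<omega>"

definition PN_A :: "3 \<Rightarrow> pn_index \<Rightarrow> pn_index \<Rightarrow> real" where
  "PN_A i j k = (\<integral>\<omega>. \<omega> $ i * PN_m j \<omega> * PN_m k \<omega> \<partial>sphere_measure)"

definition PN_R :: "pn_index \<Rightarrow> pn_index \<Rightarrow> real" where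
  "PN_R j k = (if j = k \<and> j \<noteq> (0, 0) then 1 else 0)"

definition PN_rhs :: "(vec3 \<times> vec3 \<Rightarrow> real) \<Rightarrow> pn_index \<Rightarrow> vec3 \<Rightarrow> real" where
  "PN_rhs f j x = (\<integral>\<omega>. PN_m j \<omega> * f (x, \<omega>) \<partial>sphere_measure)"

definition periodic_L2_vec :: "nat \<Rightarrow> (vec3 \<Rightarrow> pn_index \<Rightarrow> real) \<Rightarrow> bool" where
  "periodic_L2_vec N U \<longleftrightarrow>
     (\<forall>j\<in>PN_indices N.
        (\<lambda>x. U x j) \<in> borel_measurable lborel \<and>
        (\<forall>x i. U (x + axis i 1) j = U x j) \<and>
        in_L2 cube_measure (\<lambda>x. U x j))"

text \<open>
  \<open>G\<close> is the weak derivative \<open>\<Sum>\<^sub>i A\<^sup>i \<partial>\<^sub>i U\<close> on \<open>R\<^sup>3\<close>; the single derivatives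
  \<open>\<partial>\<^sub>i U\<close> need not be functions.
\<close>

definition weak_PN_transport ::
  "nat \<Rightarrow> (vec3 \<Rightarrow> pn_index \<Rightarrow> real) \<Rightarrow> (vec3 \<Rightarrow> pn_index \<Rightarrow> real) \<Rightarrow> bool" where
  "weak_PN_transport N U G \<longleftrightarrow>
     (\<forall>\<phi>. test_function UNIV \<phi> \<longrightarrow>
        (\<forall>j\<in>PN_indices N.
           (LINT x|lborel. (\<Sum>i\<in>UNIV. (\<Sum>k\<in>PN_indices N. PN_A i j k * U x k)
                              * frechet_derivative \<phi> (at x) (axis i 1)))
             = - (LINT x|lborel. G x j * \<phi> x)))"

definition PN_solution ::
  "(vec3 \<Rightarrow> real) \<Rightarrow> (vec3 \<Rightarrow> real) \<Rightarrow> (vec3 \<times> vec3 \<Rightarrow> real) \<Rightarrow> real \<Rightarrow> nat \<Rightarrow>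
     (vec3 \<Rightarrow> pn_index \<Rightarrow> real) \<Rightarrow> bool" where
  "PN_solution \<sigma>t \<sigma>a f \<epsilon> N U \<longleftrightarrow>
     periodic_L2_vec N U \<and>
     (\<exists>G. periodic_L2_vec N G \<and>
          weak_PN_transport N U G \<and>
          (AE x in cube_measure. \<forall>j\<in>PN_indices N.
             G x j + \<epsilon> * \<sigma>a x * U x j
               + (\<sigma>t x / \<epsilon> - \<epsilon> * \<sigma>a x) * (\<Sum>k\<in>PN_indices N. PN_R j k * U x k)
               = \<epsilon> * PN_rhs f j x))"

definition PN_approx :: "nat \<Rightarrow> (vec3 \<Rightarrow> pn_index \<Rightarrow> real) \<Rightarrow> vec3 \<times> vec3 \<Rightarrow> real" where
  "PN_approx N U = (\<lambda>(x, \<omega>). \<Sum>j\<in>PN_indices N. PN_m j \<omega> * U x j)"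

end

theory Submission
  imports Defs
begin

text \<open>
  Let \<open>\<Pi>\<close> be the projection onto the harmonics of degree at most \<open>N\<close>, \<open>e = \<Pi>u - u\<^sub>P\<^sub>N\<close> and
  \<open>\<eta> = u - \<Pi>u\<close>. Projecting the transport equation and subtracting the \<open>P\<^sub>N\<close> equations gives
  \<open>\<Pi>(\<omega>\<cdot>\<nabla>e) + s e = - \<Pi>(\<omega>\<cdot>\<nabla>\<eta>)\<close>, where \<open>s = \<epsilon> \<sigma>\<^sub>a\<close> on the constants and \<open>s = \<sigma>\<^sub>t / \<epsilon>\<close> on the other
  modes. Tested with \<open>e\<close>, the transport term vanishes by periodicity. As \<open>N \<ge> 1\<close> and \<open>\<omega>\<^sub>i\<close> is a harmonic of degree one,
  the right-hand side has no constant mode, so it is absorbed by the strong damping \<open>\<sigma>\<^sub>t / \<epsilon>\<close> and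
  \<open>\<parallel>e\<parallel> \<le> \<parallel>\<nabla>\<eta>\<parallel> / \<sigma>min\<close> uniformly in \<open>\<epsilon>\<close>. Completeness of the harmonics bounds \<open>\<eta>\<close> and \<open>\<nabla>\<eta>\<close> by \<open>N powr (- q)\<close>.

  Two points need care. The derivatives \<open>\<partial>\<^sub>i u\<close> are given on the open cube only; since \<open>\<omega>\<cdot>\<nabla>u\<close> is a function on the
  whole space, \<open>\<omega>\<^sub>i\<close> times the jump of \<open>u\<close> across the faces \<open>x\<^sub>i \<in> \<int>\<close> is zero, so they are derivatives on the torus.
  For \<open>u\<^sub>P\<^sub>N\<close> only the combination \<open>\<Sum>\<^sub>i A\<^sup>i \<partial>\<^sub>i\<close> is a function, so the energy identity is proved by mollification with
  an even kernel.
\<close>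

section \<open>Smooth functions\<close>

text \<open>The weak derivatives of \<open>u\<close> are identities for almost every direction, and
  the exceptional null set depends on the test function. So the gluing uses only countably many
  cut-offs for each test function. Density of test functions is used only after the angular variable
  has been integrated out, for coefficient functions of \<open>x\<close> alone.

  In the energy identity the error is paired with its own divergence through a kernel in two
  variables. The derivative then falls on the kernel and never on the error, and the pairing
  vanishes exactly for every radius. The radius tends to zero only afterwards, which needs nothing
  about the error beyond square integrability.

  The harmonics are given by explicit formulas. Orthonormality is computed from Rodrigues' formula;
  completeness comes from Stone-Weierstrass, once every polynomial is rewritten on the sphere as a
  finite combination of harmonics.

  Uniformity in \<epsilon> has a simple source: after absorption the error term carries the weight
  \<open>\<epsilon> * \<sigma>min / 2\<close> and the defect the weight
  \<open>\<epsilon> / (2 * \<sigma>min)\<close>, so \<epsilon> cancels and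
  \<open>1 / \<sigma>min\<^sup>2\<close> remains.\<close>

abbreviation pd :: "(vec3 \<Rightarrow> real) \<Rightarrow> 3 \<Rightarrow> vec3 \<Rightarrow> real" where
  "pd \<phi> i x \<equiv> frechet_derivative \<phi> (at x) (axis i 1)"

lemma pd_eq: "(\<phi> has_derivative D) (at x) \<Longrightarrow> pd \<phi> i x = D (axis i 1)"
  by (metis frechet_derivative_at)

lemma has_frechet_derivative:
  "Ck (Suc n) \<phi> \<Longrightarrow> (\<phi> has_derivative frechet_derivative \<phi> (at x)) (at x)"
  by (simp add: differentiable_on_def frechet_derivative_works[symmetric])

text \<open>Smoothness can be shown with any formula for the derivative, so closure properties
  follow by induction without computing \<open>frechet_derivative\<close>.\<close>

lemma Ck_SucI:
  assumes "\<And>x. (\<phi> has_derivative D x) (at x)" and "\<And>i. Ck n (\<lambda>x. D x (axis i 1))"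
  shows "Ck (Suc n) \<phi>"
proof -
  have "\<phi> differentiable_on UNIV"
    using assms(1) by (auto simp: differentiable_on_def differentiable_def)
  moreover have "(\<lambda>x. pd \<phi> i x) = (\<lambda>x. D x (axis i 1))" for i
    using pd_eq[OF assms(1)] by auto
  ultimately show ?thesis using assms(2) by simp
qed

lemma Ck_SucD: "Ck (Suc n) \<phi> \<Longrightarrow> Ck n \<phi>"
proof (induction n arbitrary: \<phi>)
  case 0
  then show ?case by (simp add: differentiable_imp_continuous_on)
next
  case (Suc n)
  then show ?case using Ck.simps(2) by blast
qed

lemma Ck_continuous: "Ck n \<phi> \<Longrightarrow> continuous_on UNIV \<phi>"
  by (induction n) (auto dest: Ck_SucD simp del: Ck.simps(2))

lemma Ck_const: "Ck n (\<lambda>x. c)"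
proof (induction n arbitrary: c)
  case (Suc n)
  show ?case by (rule Ck_SucI[where D="\<lambda>_ _. 0"]) (auto intro: Suc)
qed auto

lemma Ck_linear:
  assumes "bounded_linear L"
  shows "Ck n L"
proof (cases n)
  case 0
  then show ?thesis using assms by (simp add: linear_continuous_on)
next
  case (Suc m)
  then show ?thesis
    using Ck_SucI[of L "\<lambda>_. L" m] bounded_linear_imp_has_derivative[OF assms] Ck_const by blast
qed

lemma Ck_nth: "Ck n (\<lambda>x. x $ i)"
  by (intro Ck_linear bounded_linear_vec_nth)

lemma Ck_add: "Ck n f \<Longrightarrow> Ck n g \<Longrightarrow> Ck n (\<lambda>x. f x + g x)"
proof (induction n arbitrary: f g)
  case 0
  then show ?case by (simp add: continuous_on_add)
next
  case (Suc n)
  show ?case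
    by (rule Ck_SucI[OF has_derivative_add[OF has_frechet_derivative has_frechet_derivative]])
       (use Suc in auto)
qed

lemma Ck_mult: "Ck n f \<Longrightarrow> Ck n g \<Longrightarrow> Ck n (\<lambda>x. f x * g x)"
proof (induction n arbitrary: f g)
  case 0
  then show ?case by (simp add: continuous_on_mult)
next
  case (Suc n)
  show ?case
    by (rule Ck_SucI[OF has_derivative_mult[OF has_frechet_derivative has_frechet_derivative]])
       (use Suc in \<open>auto intro!: Ck_add Suc.IH dest: Ck_SucD simp del: Ck.simps(2)\<close>,
        use Suc in auto)
qed

lemma Ck_diff:
  assumes "Ck n f" "Ck n g" shows "Ck n (\<lambda>x. f x - g x)"
  using Ck_add[OF assms(1) Ck_mult[OF Ck_const[of n "-1"] assms(2)]] by simp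

lemma Ck_sum: "(\<And>i. i \<in> I \<Longrightarrow> Ck n (f i)) \<Longrightarrow> Ck n (\<lambda>x. \<Sum>i\<in>I. f i x)"
  by (induction I rule: infinite_finite_induct) (auto intro: Ck_const Ck_add)

lemma Ck_prod: "(\<And>i. i \<in> I \<Longrightarrow> Ck n (f i)) \<Longrightarrow> Ck n (\<lambda>x. \<Prod>i\<in>I. f i x)"
  by (induction I rule: infinite_finite_induct) (auto intro: Ck_const Ck_mult)

lemma Ck_translate: "Ck n f \<Longrightarrow> Ck n (\<lambda>x. f (x + a))"
proof (induction n arbitrary: f)
  case 0
  then have "continuous_on UNIV (f \<circ> (\<lambda>x. x + a))"
    by (intro continuous_on_compose continuous_intros) (auto intro: continuous_on_subset)
  then show ?case by (simp add: o_def)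
next
  case (Suc n)
  have "((\<lambda>x. f (x + a)) has_derivative frechet_derivative f (at (x + a))) (at x)" for x
  proof -
    have "((\<lambda>x. x + a) has_derivative (\<lambda>h. h)) (at x)"
      by (auto intro!: derivative_eq_intros)
    from has_derivative_compose[OF this has_frechet_derivative[OF Suc.prems]]
    show ?thesis by simp
  qed
  then show ?case
    by (rule Ck_SucI) (use Suc in auto)
qed

lemma pd_translate: "Ck (Suc 0) f \<Longrightarrow> pd (\<lambda>x. f (x + a)) i x = pd f i (x + a)"
proof -
  assume f: "Ck (Suc 0) f"
  have "((\<lambda>x. x + a) has_derivative (\<lambda>h. h)) (at x)"
    by (auto intro!: derivative_eq_intros)
  from has_derivative_compose[OF this has_frechet_derivative[OF f]]
  show ?thesis by (rule pd_eq)
qed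

lemma pd_mult:
  "Ck (Suc 0) f \<Longrightarrow> Ck (Suc 0) g \<Longrightarrow> pd (\<lambda>x. f x * g x) i x = f x * pd g i x + pd f i x * g x"
  by (rule pd_eq[OF has_derivative_mult[OF has_frechet_derivative has_frechet_derivative]])

lemma pd_sum:
  "(\<And>k. k \<in> I \<Longrightarrow> Ck (Suc 0) (f k)) \<Longrightarrow> pd (\<lambda>x. \<Sum>k\<in>I. f k x) i x = (\<Sum>k\<in>I. pd (f k) i x)"
  by (rule pd_eq[OF has_derivative_sum[OF has_frechet_derivative]])

section \<open>Smooth functions built from exp(-1/t)\<close>

text \<open>The powers of \<open>t\<close> in the denominator make the family \<open>flat\<close> closed under differentiation.\<close>

definition flat :: "nat \<Rightarrow> real \<Rightarrow> real" where
  "flat m t = (if t > 0 then exp (- 1 / t) / t ^ m else 0)"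

lemma flat_nonneg: "0 \<le> flat m t"
  by (simp add: flat_def)

lemma flat_pos: "0 < t \<Longrightarrow> 0 < flat m t"
  by (simp add: flat_def)

lemma flat_zero: "t \<le> 0 \<Longrightarrow> flat m t = 0"
  by (simp add: flat_def)

lemma flat_0_le_1: "flat 0 t \<le> 1"
  by (simp add: flat_def)

text \<open>With y = 1/t, a single term of the exponential series bounds y^(m+2) by
  \<open>fact (m + 2) * exp y\<close>. The second power of t is what makes the difference quotient
  at 0 tend to 0 in \<open>flat_deriv\<close>.\<close>

lemma flat_le_square: "flat m t \<le> fact (m + 2) * t\<^sup>2"
proof (cases "t > 0")
  case True
  define y where "y = 1 / t"
  have y: "y > 0" "t = 1 / y" using True by (auto simp: y_def)
  have "y ^ (m + 2) / fact (m + 2) \<le> exp y"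
  proof -
    have "(\<Sum>i\<in>{m+2}. y ^ i / fact i) \<le> (\<Sum>i. y ^ i / fact i)"
      using y by (intro sum_le_suminf) (auto intro: summable_exp_generic simp: divide_inverse summable_exp mult.commute)
    also have "\<dots> = exp y" by (simp add: exp_def divide_inverse mult.commute)
    finally show ?thesis by simp
  qed
  then have "y ^ (m + 2) \<le> fact (m + 2) * exp y"
    by (simp only: pos_divide_le_eq fact_gt_zero mult.commute)
  then have "y ^ (m + 2) / exp y / y\<^sup>2 \<le> fact (m + 2) / y\<^sup>2"
    by (intro divide_right_mono) (simp_all only: pos_divide_le_eq exp_gt_zero zero_le_power2)
  moreover have "y ^ (m + 2) / exp y / y\<^sup>2 = flat m t"
    using y(1) unfolding y(2) flat_def by (simp add: power_add power_divide exp_minus field_simps power2_eq_square)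
  ultimately show ?thesis
    using y by (simp add: power_divide)
next
  case False
  then show ?thesis by (simp add: flat_def)
qed

lemma flat_deriv: "(flat m has_real_derivative flat (m + 2) t - m * flat (m + 1) t) (at t)"
proof -
  consider "t > 0" | "t < 0" | "t = 0" by linarith
  then show ?thesis
  proof cases
    case 1
    have "((\<lambda>t. exp (- 1 / t) / t ^ m) has_real_derivative flat (m + 2) t - m * flat (m + 1) t) (at t)"
    proof -
      have e: "((\<lambda>t. exp (- 1 / t)) has_real_derivative exp (- 1 / t) / t\<^sup>2) (at t)"
        using 1 by (auto intro!: derivative_eq_intros simp: power2_eq_square)
      have p: "((\<lambda>t. t ^ m) has_real_derivative real m * t ^ m / t) (at t)"
        using 1 DERIV_pow[of m t] by (cases m) auto
      \<comment> \<open>The quotient rule is simplified with t^m as an opaque nonzero factor, since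
        its exponent is arbitrary.\<close>
      have alg: "(E / t\<^sup>2 * X - E * (real m * X / t)) / (X * X) = E / (X * t\<^sup>2) - real m * (E / (X * t))"
        if "X \<noteq> 0" for E X
        using that 1 by (simp add: diff_divide_distrib power2_eq_square mult_ac)
      show ?thesis
        using DERIV_divide[OF e p] 1 alg[of "t ^ m" "exp (- 1 / t)"]
        by (simp add: flat_def power_add power2_eq_square mult_ac)
    qed
    moreover have "eventually (\<lambda>s. s > 0) (nhds t)"
      using 1 eventually_nhds_in_open[of "{0<..}" t] by simp
    then have "eventually (\<lambda>s. flat m s = exp (- 1 / s) / s ^ m) (nhds t)"
      by eventually_elim (simp add: flat_def)
    ultimately show ?thesis by (subst DERIV_cong_ev[OF refl _ refl]) auto
  next
    case 2
    have "eventually (\<lambda>s. s < 0) (nhds t)"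
      using 2 eventually_nhds_in_open[of "{..<0}" t] by simp
    then have "eventually (\<lambda>s. flat m s = 0) (nhds t)"
      by eventually_elim (simp add: flat_def)
    then have "(flat m has_real_derivative 0) (at t)"
      by (subst DERIV_cong_ev[OF refl _ refl]) auto
    then show ?thesis using 2 by (simp add: flat_def)
  next
    case 3
    have "((\<lambda>s. flat m s / s) \<longlongrightarrow> 0) (at 0)"
    proof (rule Lim_null_comparison)
      show "\<forall>\<^sub>F s in at 0. norm (flat m s / s) \<le> fact (m + 2) * \<bar>s\<bar>"
      proof (rule eventually_at_filter[THEN iffD2, OF always_eventually], intro allI impI)
        fix s :: real assume "s \<noteq> 0"
        then show "norm (flat m s / s) \<le> fact (m + 2) * \<bar>s\<bar>"
          using flat_le_square[of m s] flat_nonneg[of m s]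
          by (simp add: abs_divide pos_divide_le_eq mult.assoc power2_eq_square)
      qed
      show "((\<lambda>s. fact (m + 2) * \<bar>s\<bar>) \<longlongrightarrow> (0::real)) (at 0)"
        by (auto intro!: tendsto_eq_intros)
    qed
    then show ?thesis using 3 by (simp add: DERIV_def flat_def)
  qed
qed

lemma Ck_flat: "Ck n \<psi> \<Longrightarrow> Ck n (\<lambda>x. flat m (\<psi> x))"
proof (induction n arbitrary: m)
  case 0
  have "continuous_on UNIV (flat m)"
    using flat_deriv by (auto intro: DERIV_continuous simp: continuous_on_eq_continuous_at)
  then have "continuous_on UNIV (flat m \<circ> \<psi>)"
    using 0 by (intro continuous_on_compose) (auto intro: continuous_on_subset)
  then show ?case by (simp add: o_def)
next
  case (Suc n)
  have "Ck n (\<lambda>x. pd \<psi> i x)" for i using Suc.prems by simp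
  moreover have "Ck n \<psi>" using Suc.prems by (rule Ck_SucD)
  ultimately show ?case
    by (intro Ck_SucI[OF DERIV_compose_FDERIV[OF flat_deriv has_frechet_derivative[OF Suc.prems]]]
          Ck_mult Ck_diff Ck_const Suc.IH)
qed

lemma pd_flat:
  assumes "Ck (Suc 0) \<psi>"
  shows "pd (\<lambda>x. flat 0 (\<psi> x)) i x = pd \<psi> i x * flat 2 (\<psi> x)"
  by (subst pd_eq[OF DERIV_compose_FDERIV[OF flat_deriv[of 0] has_frechet_derivative[OF assms]]])
     (simp add: numeral_2_eq_2)

text \<open>The phase \<open>a\<close> is there for the induction: differentiation only adds pi/2 to
  it, so a single family of functions is closed under derivatives.\<close>

lemma Ck_sin: "Ck n \<psi> \<Longrightarrow> Ck n (\<lambda>x. sin (a + \<psi> x))"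
proof (induction n arbitrary: a)
  case 0
  then show ?case by (auto intro!: continuous_intros)
next
  case (Suc n)
  have "((\<lambda>t. sin (a + t)) has_real_derivative sin (a + pi / 2 + t)) (at t)" for t
    by (auto intro!: derivative_eq_intros simp: sin_add cos_add)
  moreover have "Ck n (\<lambda>x. pd \<psi> i x)" for i using Suc.prems by simp
  moreover have "Ck n \<psi>" using Suc.prems by (rule Ck_SucD)
  ultimately show ?case
    using Suc.IH[of "a + pi / 2"] Suc.prems
    by (intro Ck_SucI[OF DERIV_compose_FDERIV[where f="\<lambda>t. sin (a + t)" and g=\<psi>, OF _ has_frechet_derivative]]
        Ck_mult) (assumption | rule refl)+
qed

text \<open>The open sets \<open>Q\<close> and \<open>- K\<close> cover the space. The extension is
  \<phi> on the first and zero on the second, and the two agree on the overlap.\<close>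

lemma Ck_cutout:
  assumes "Ck n \<phi>" "open Q" "closed K" "K \<subseteq> Q" "\<And>x. x \<in> Q - K \<Longrightarrow> \<phi> x = 0"
  shows "Ck n (\<lambda>x. if x \<in> Q then \<phi> x else 0)"
  using assms(1,5)
proof (induction n arbitrary: \<phi>)
  case 0
  have "continuous_on (Q \<union> - K) (\<lambda>x. if x \<in> Q then \<phi> x else 0)"
  proof (rule continuous_on_open_Un)
    have "continuous_on Q \<phi>" using 0(1) by (auto intro: continuous_on_subset)
    then show "continuous_on Q (\<lambda>x. if x \<in> Q then \<phi> x else 0)" by (rule continuous_on_eq) auto
    have "continuous_on (- K) (\<lambda>_. 0::real)" by auto
    then show "continuous_on (- K) (\<lambda>x. if x \<in> Q then \<phi> x else 0)"
      by (rule continuous_on_eq) (use 0(2) in auto)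
  qed (use assms in auto)
  moreover have "Q \<union> - K = UNIV" using assms(4) by auto
  ultimately show ?case by simp
next
  case (Suc n)
  define D where "D x h = (if x \<in> Q then frechet_derivative \<phi> (at x) h else 0)" for x h
  have zero: "((\<lambda>x. if x \<in> Q then \<phi> x else 0) has_derivative (\<lambda>_. 0)) (at x)" if "x \<in> - K" for x
  proof (rule has_derivative_transform_within_open[where f="\<lambda>_. 0" and s="- K"])
    show "((\<lambda>_. 0::real) has_derivative (\<lambda>_. 0)) (at x)" by (rule has_derivative_const)
  qed (use that Suc.prems(2) assms(3) in auto)
  have inner: "((\<lambda>x. if x \<in> Q then \<phi> x else 0) has_derivative frechet_derivative \<phi> (at x)) (at x)"
    if "x \<in> Q" for x
  proof (rule has_derivative_transform_within_open[where f=\<phi> and s=Q])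
    show "(\<phi> has_derivative frechet_derivative \<phi> (at x)) (at x)"
      by (rule has_frechet_derivative[OF Suc.prems(1)])
  qed (use that assms(2) in auto)
  have "((\<lambda>x. if x \<in> Q then \<phi> x else 0) has_derivative D x) (at x)" for x
    using zero[of x] inner[of x] assms(4) by (cases "x \<in> Q") (auto simp: D_def[abs_def])
  moreover have "Ck n (\<lambda>x. D x (axis i 1))" for i
    unfolding D_def
  proof (rule Suc.IH)
    show "Ck n (\<lambda>x. pd \<phi> i x)" using Suc.prems(1) by simp
    show "pd \<phi> i x = 0" if "x \<in> Q - K" for x
    proof -
      \<comment> \<open>On \<open>Q - K\<close> both descriptions of the extension apply, so
        uniqueness of the derivative shows that the partial derivatives again satisfy the vanishing
        hypothesis of the induction.\<close>
      have "frechet_derivative \<phi> (at x) = (\<lambda>_. 0)"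
        using has_derivative_unique[OF inner zero] that by simp
      then show ?thesis by simp
    qed
  qed
  ultimately show ?case by (rule Ck_SucI)
qed

section \<open>Density in \<open>L\<^sup>2\<close>\<close>

lemma in_L2_cong: "(\<And>x. x \<in> space M \<Longrightarrow> f x = g x) \<Longrightarrow> in_L2 M f = in_L2 M g"
  unfolding in_L2_def
  by (intro conj_cong measurable_cong Bochner_Integration.integrable_cong) auto

lemma in_L2_dominated:
  assumes "in_L2 M g" "f \<in> borel_measurable M" "AE x in M. \<bar>f x\<bar> \<le> \<bar>g x\<bar>"
  shows "in_L2 M f"
  unfolding in_L2_def
proof
  have "integrable M (\<lambda>x. (g x)\<^sup>2)" using assms(1) by (simp add: in_L2_def)
  then show "integrable M (\<lambda>x. (f x)\<^sup>2)"
    by (rule Bochner_Integration.integrable_bound) (use assms(2,3) in \<open>auto simp: abs_le_square_iff\<close>)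
qed (use assms in auto)

lemma in_L2_scale: "in_L2 M f \<Longrightarrow> in_L2 M (\<lambda>x. c * f x)"
  by (auto simp: in_L2_def power_mult_distrib)

lemma square_add_le: "(x + y)\<^sup>2 \<le> 2 * x\<^sup>2 + 2 * (y\<^sup>2 :: real)"
  using sum_squares_bound[of x y] by (simp add: power2_eq_square algebra_simps)

lemma in_L2_add:
  assumes "in_L2 M f" "in_L2 M g" shows "in_L2 M (\<lambda>x. f x + g x)"
  unfolding in_L2_def
proof
  have "integrable M (\<lambda>x. 2 * (f x)\<^sup>2 + 2 * (g x)\<^sup>2)" using assms by (simp add: in_L2_def)
  then show "integrable M (\<lambda>x. (f x + g x)\<^sup>2)"
    by (rule Bochner_Integration.integrable_bound) (use assms square_add_le in \<open>auto simp: in_L2_def\<close>)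
qed (use assms in \<open>auto simp: in_L2_def\<close>)

lemma in_L2_diff:
  assumes "in_L2 M f" "in_L2 M g" shows "in_L2 M (\<lambda>x. f x - g x)"
  using in_L2_add[OF assms(1) in_L2_scale[OF assms(2), of "-1"]] by simp

lemma in_L2_zero: "in_L2 M (\<lambda>x. 0)"
  by (simp add: in_L2_def)

lemma in_L2_sum: "(\<And>i. i \<in> I \<Longrightarrow> in_L2 M (f i)) \<Longrightarrow> in_L2 M (\<lambda>x. \<Sum>i\<in>I. f i x)"
  by (induction I rule: infinite_finite_induct) (auto intro: in_L2_add in_L2_zero)

lemma integrable_L2_mult:
  assumes "in_L2 M f" "in_L2 M g" shows "integrable M (\<lambda>x. f x * g x :: real)"
proof (rule Bochner_Integration.integrable_bound)
  show "integrable M (\<lambda>x. (f x)\<^sup>2 + (g x)\<^sup>2)" using assms by (simp add: in_L2_def)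
  have "\<bar>f x * g x\<bar> \<le> (f x)\<^sup>2 + (g x)\<^sup>2" for x
  proof -
    have "2 * (\<bar>f x\<bar> * \<bar>g x\<bar>) \<le> (f x)\<^sup>2 + (g x)\<^sup>2" using sum_squares_bound[of "\<bar>f x\<bar>" "\<bar>g x\<bar>"] by simp
    moreover have "0 \<le> \<bar>f x\<bar> * \<bar>g x\<bar>" by (intro mult_nonneg_nonneg abs_ge_zero)
    ultimately show ?thesis unfolding abs_mult by linarith
  qed
  then show "AE x in M. norm (f x * g x) \<le> norm ((f x)\<^sup>2 + (g x)\<^sup>2)" by simp
qed (use assms in \<open>auto simp: in_L2_def\<close>)

lemma (in finite_measure) in_L2_bounded:
  assumes "f \<in> borel_measurable M" "AE x in M. \<bar>f x\<bar> \<le> B"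
  shows "in_L2 M f"
  by (rule in_L2_dominated[of M "\<lambda>_. B"]) (use assms in \<open>auto simp: in_L2_def\<close>)

lemma (in finite_measure) integrable_L2:
  assumes "in_L2 M f" shows "integrable M f"
  using integrable_L2_mult[OF assms in_L2_bounded[of "\<lambda>_. 1" 1]] by simp

lemma L2_integrable_square: "in_L2 M f \<Longrightarrow> integrable M (\<lambda>x. (f x)\<^sup>2)"
  by (simp add: in_L2_def)

text \<open>This replaces the triangle inequality when distances are kept squared. Its factors 2
  explain the tolerances \<open>e / 4\<close> below.\<close>

lemma integral_square_diff_le:
  assumes "in_L2 M f" "in_L2 M g" "in_L2 M h"
  shows "(\<integral>x. (f x - h x)\<^sup>2 \<partial>M) \<le> 2 * (\<integral>x. (f x - g x)\<^sup>2 \<partial>M) + 2 * (\<integral>x. (g x - h x)\<^sup>2 \<partial>M)"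
proof -
  have i: "integrable M (\<lambda>x. (f x - g x)\<^sup>2)" "integrable M (\<lambda>x. (g x - h x)\<^sup>2)" "integrable M (\<lambda>x. (f x - h x)\<^sup>2)"
    using assms by (auto intro: in_L2_diff L2_integrable_square)
  have "(\<integral>x. (f x - h x)\<^sup>2 \<partial>M) \<le> (\<integral>x. 2 * (f x - g x)\<^sup>2 + 2 * (g x - h x)\<^sup>2 \<partial>M)"
    using i square_add_le[of "f x - g x" "g x - h x" for x] by (intro integral_mono) auto
  then show ?thesis using i by simp
qed

definition L2_closure :: "'a measure \<Rightarrow> ('a \<Rightarrow> real) set \<Rightarrow> ('a \<Rightarrow> real) \<Rightarrow> bool" where
  "L2_closure M V f \<longleftrightarrow> in_L2 M f \<and> (\<forall>e>0. \<exists>g\<in>V. (\<integral>x. (f x - g x)\<^sup>2 \<partial>M) < e)"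

lemma L2_closure_cong:
  "L2_closure M V f \<Longrightarrow> (\<And>x. x \<in> space M \<Longrightarrow> f x = g x) \<Longrightarrow> L2_closure M V g"
  unfolding L2_closure_def
  by (metis (mono_tags, lifting) in_L2_cong Bochner_Integration.integral_cong)

lemma L2_closure_limit:
  assumes V: "\<And>g. g \<in> V \<Longrightarrow> in_L2 M g" and f: "in_L2 M f"
    and F: "\<And>n. L2_closure M V (F n)" "(\<lambda>n. \<integral>x. (f x - F n x)\<^sup>2 \<partial>M) \<longlonglongrightarrow> 0"
  shows "L2_closure M V f"
  unfolding L2_closure_def
proof (intro conjI f allI impI)
  fix e :: real assume e: "e > 0"
  obtain n where n: "(\<integral>x. (f x - F n x)\<^sup>2 \<partial>M) < e / 4"
    using order_tendstoD(2)[OF F(2), of "e / 4"] e by (auto simp: eventually_sequentially)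
  obtain g where g: "g \<in> V" "(\<integral>x. (F n x - g x)\<^sup>2 \<partial>M) < e / 4"
    using F(1)[of n] e by (auto simp: L2_closure_def dest!: spec[of _ "e / 4"])
  have "(\<integral>x. (f x - g x)\<^sup>2 \<partial>M) < e"
    using integral_square_diff_le[OF f _ V[OF g(1)], of "F n"] F(1)[of n] n g(2)
    by (auto simp: L2_closure_def)
  then show "\<exists>g\<in>V. (\<integral>x. (f x - g x)\<^sup>2 \<partial>M) < e" using g(1) by blast
qed

context
  fixes M :: "'a measure" and V :: "('a \<Rightarrow> real) set"
  assumes V_L2: "\<And>g. g \<in> V \<Longrightarrow> in_L2 M g"
    and V_add: "\<And>f g. f \<in> V \<Longrightarrow> g \<in> V \<Longrightarrow> (\<lambda>x. f x + g x) \<in> V"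
    and V_scale: "\<And>f c. f \<in> V \<Longrightarrow> (\<lambda>x. c * f x) \<in> V"
begin

lemma L2_closure_add:
  assumes f: "L2_closure M V f" and g: "L2_closure M V g"
  shows "L2_closure M V (\<lambda>x. f x + g x)"
  unfolding L2_closure_def
proof (intro conjI allI impI)
  show "in_L2 M (\<lambda>x. f x + g x)" using assms by (auto simp: L2_closure_def intro: in_L2_add)
  fix e :: real assume e: "e > 0"
  obtain f' where f': "f' \<in> V" "(\<integral>x. (f x - f' x)\<^sup>2 \<partial>M) < e / 4"
    using f e by (auto simp: L2_closure_def dest!: spec[of _ "e / 4"])
  obtain g' where g': "g' \<in> V" "(\<integral>x. (g x - g' x)\<^sup>2 \<partial>M) < e / 4"
    using g e by (auto simp: L2_closure_def dest!: spec[of _ "e / 4"])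
  have "(\<integral>x. ((f x + g x) - (f' x + g' x))\<^sup>2 \<partial>M)
      \<le> 2 * (\<integral>x. ((f x + g x) - (f' x + g x))\<^sup>2 \<partial>M) + 2 * (\<integral>x. ((f' x + g x) - (f' x + g' x))\<^sup>2 \<partial>M)"
    using f g f' g' by (intro integral_square_diff_le) (auto simp: L2_closure_def intro: in_L2_add V_L2)
  also have "\<dots> < e" using f' g' by simp
  finally show "\<exists>h\<in>V. (\<integral>x. (f x + g x - h x)\<^sup>2 \<partial>M) < e" using V_add[OF f'(1) g'(1)] by (rule bexI)
qed

lemma L2_closure_scale:
  assumes f: "L2_closure M V f"
  shows "L2_closure M V (\<lambda>x. c * f x)"
  unfolding L2_closure_def
proof (intro conjI allI impI)
  show "in_L2 M (\<lambda>x. c * f x)" using assms by (auto simp: L2_closure_def intro: in_L2_scale)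
  fix e :: real assume e: "e > 0"
  \<comment> \<open>Adding 1 to the square of \<open>c\<close> keeps the divisor positive when
    \<open>c\<close> is zero.\<close>
  obtain f' where f': "f' \<in> V" "(\<integral>x. (f x - f' x)\<^sup>2 \<partial>M) < e / (c\<^sup>2 + 1)"
  proof -
    have "e / (c\<^sup>2 + 1) > 0" using e by (intro divide_pos_pos add_nonneg_pos) auto
    then show ?thesis using f that unfolding L2_closure_def by blast
  qed
  have "(\<integral>x. (c * f x - c * f' x)\<^sup>2 \<partial>M) = c\<^sup>2 * (\<integral>x. (f x - f' x)\<^sup>2 \<partial>M)"
    by (subst Bochner_Integration.integral_mult_right_zero[symmetric])
       (simp add: power2_eq_square algebra_simps)
  also have "\<dots> \<le> (c\<^sup>2 + 1) * (\<integral>x. (f x - f' x)\<^sup>2 \<partial>M)"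
    by (intro mult_right_mono Bochner_Integration.integral_nonneg) auto
  also have "\<dots> < e"
    using f'(2) by (simp add: pos_less_divide_eq add_nonneg_pos mult.commute)
  finally show "\<exists>h\<in>V. (\<integral>x. (c * f x - h x)\<^sup>2 \<partial>M) < e" using V_scale[OF f'(1)] by (rule bexI)
qed

lemma L2_closure_sum:
  assumes "finite I" "I \<noteq> {}" "\<And>i. i \<in> I \<Longrightarrow> L2_closure M V (f i)"
  shows "L2_closure M V (\<lambda>x. \<Sum>i\<in>I. f i x)"
  using assms by (induction I rule: finite_ne_induct) (auto intro: L2_closure_add)

text \<open>A Dynkin class argument gives indicators of all measurable sets, and simple functions do the rest.\<close>

lemma L2_closure_UNIV:
  assumes fin: "finite_measure M"
    and E: "sets M = sigma_sets (space M) E" "Int_stable E" "E \<subseteq> Pow (space M)"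
    and ind: "\<And>A. A \<in> E \<Longrightarrow> L2_closure M V (indicator A)" "L2_closure M V (indicator (space M))"
    and f: "in_L2 M f"
  shows "L2_closure M V f"
proof -
  interpret finite_measure M by fact
  have zero: "L2_closure M V (\<lambda>_. 0)" using L2_closure_scale[OF ind(2), of 0] by simp
  have sets: "L2_closure M V (indicator A)" if "A \<in> sets M" for A
    using E(2,3) that[unfolded E(1)]
  proof (induction A rule: sigma_sets_induct_disjoint)
    case (basic A)
    then show ?case by (rule ind)
  next
    case empty
    show ?case using zero by (rule L2_closure_cong) auto
  next
    case (compl A)
    show ?case
      using L2_closure_add[OF ind(2) L2_closure_scale[OF compl(2), of "-1"]]
      by (rule L2_closure_cong) (auto simp: indicator_def)
  next
    case (union A)
    have Am: "A i \<in> sets M" for i using union(2) E(1) by auto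
    then have [measurable]: "(\<Union>i. A i) \<in> sets M" by auto
    show ?case
    proof (rule L2_closure_limit[OF V_L2])
      show "in_L2 M (indicator (\<Union>i. A i))"
        by (rule in_L2_bounded[of _ 1]) (auto simp: indicator_def)
      show "L2_closure M V (\<lambda>x. \<Sum>i\<in>{..n}. indicator (A i) x)" for n
        using union(3) by (intro L2_closure_sum) auto
      show "(\<lambda>n. \<integral>x. (indicat_real (\<Union>i. A i) x - (\<Sum>i\<in>{..n}. indicat_real (A i) x))\<^sup>2 \<partial>M) \<longlonglongrightarrow> 0"
      proof -
        have eq: "(\<Sum>i\<in>{..n}. indicator (A i) x) = (indicator (\<Union>i\<le>n. A i) x :: real)" for n x
          using union(1) by (subst indicator_UN_disjoint) (auto intro: disjoint_family_on_mono)
        have "(\<lambda>n. \<integral>x. (indicat_real (\<Union>i. A i) x - (\<Sum>i\<in>{..n}. indicat_real (A i) x))\<^sup>2 \<partial>M)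
            \<longlonglongrightarrow> (\<integral>x. (0::real) \<partial>M)"
        proof (rule integral_dominated_convergence[where w="\<lambda>_. 1 :: real"])
          show "AE x in M. (\<lambda>n. (indicat_real (\<Union>i. A i) x - (\<Sum>i\<in>{..n}. indicat_real (A i) x))\<^sup>2) \<longlonglongrightarrow> (0::real)"
          proof (rule AE_I2)
            fix x
            have "\<forall>\<^sub>F n in sequentially. (indicat_real (\<Union>i. A i) x - (\<Sum>i\<in>{..n}. indicat_real (A i) x))\<^sup>2 = (0::real)"
            proof (cases "x \<in> (\<Union>i. A i)")
              case True
              then obtain i where "x \<in> A i" by auto
              then have "\<forall>n\<ge>i. x \<in> (\<Union>i\<le>n. A i)" by auto
              then show ?thesis unfolding eq eventually_sequentially using True by (intro exI[of _ i]) auto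
            next
              case False
              then show ?thesis unfolding eq by (intro always_eventually) (auto simp: indicator_def)
            qed
            then show "(\<lambda>n. (indicat_real (\<Union>i. A i) x - (\<Sum>i\<in>{..n}. indicat_real (A i) x))\<^sup>2) \<longlonglongrightarrow> (0::real)"
              by (rule tendsto_eventually)
          qed
          show "AE x in M. norm ((indicat_real (\<Union>i. A i) x - (\<Sum>i\<in>{..n}. indicat_real (A i) x))\<^sup>2 :: real) \<le> 1" for n
            unfolding eq by (auto simp: indicator_def)
        qed (use Am in auto)
        then show ?thesis by simp
      qed
    qed
  qed
  have simple: "L2_closure M V s" if s: "simple_function M s" for s
  proof (cases "space M = {}")
    case True
    then show ?thesis using L2_closure_cong[OF zero, of s] by auto
  next
    case False
    have "L2_closure M V (\<lambda>x. \<Sum>y\<in>s ` space M. y * indicator (s -` {y} \<inter> space M) x)"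
      using s False by (intro L2_closure_sum L2_closure_scale sets) (auto dest: simple_functionD)
    then show ?thesis
    proof (rule L2_closure_cong)
      fix x assume x: "x \<in> space M"
      have "(\<Sum>y\<in>s ` space M. y * indicator (s -` {y} \<inter> space M) x) = (\<Sum>y\<in>s ` space M. if y = s x then y else 0)"
        using x by (intro sum.cong) (auto simp: indicator_def)
      also have "\<dots> = s x" using x simple_functionD(1)[OF s] by (simp add: sum.delta)
      finally show "(\<Sum>y\<in>s ` space M. y * indicator (s -` {y} \<inter> space M) x) = s x" .
    qed
  qed
  have fm: "f \<in> borel_measurable M" using f by (simp add: in_L2_def)
  obtain F where F: "\<And>i. simple_function M (F i)" "\<And>x. x \<in> space M \<Longrightarrow> (\<lambda>i. F i x) \<longlonglongrightarrow> f x"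
      "\<And>i x. x \<in> space M \<Longrightarrow> dist (F i x) 0 \<le> 2 * dist (f x) 0"
    using borel_measurable_implies_sequence_metric[OF fm, of 0] by blast
  show ?thesis
  proof (rule L2_closure_limit[OF V_L2 f])
    show "L2_closure M V (F n)" for n by (rule simple[OF F(1)])
    have [measurable]: "F n \<in> borel_measurable M" for n using F(1) by (rule borel_measurable_simple_function)
    have "(\<lambda>n. \<integral>x. (f x - F n x)\<^sup>2 \<partial>M) \<longlonglongrightarrow> (\<integral>x. 0 \<partial>M)"
    \<comment> \<open>The simple functions are bounded by 2|f|, so the error is at most 3|f| and its
      square at most 9 times the square of f.\<close>
    proof (rule integral_dominated_convergence[where w="\<lambda>x. 9 * (f x)\<^sup>2"])
      show "AE x in M. (\<lambda>n. (f x - F n x)\<^sup>2) \<longlonglongrightarrow> 0"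
        using F(2) by (auto intro!: AE_I2 tendsto_eq_intros)
      show "AE x in M. norm ((f x - F n x)\<^sup>2) \<le> 9 * (f x)\<^sup>2" for n
      proof (rule AE_I2)
        fix x assume "x \<in> space M"
        then have "\<bar>F n x\<bar> \<le> 2 * \<bar>f x\<bar>" using F(3)[of x n] by simp
        then have "\<bar>f x - F n x\<bar> \<le> \<bar>3 * f x\<bar>" by linarith
        then have "(f x - F n x)\<^sup>2 \<le> (3 * f x)\<^sup>2" by (simp only: abs_le_square_iff)
        then show "norm ((f x - F n x)\<^sup>2) \<le> 9 * (f x)\<^sup>2" by (simp add: power_mult_distrib)
      qed
    qed (use f in \<open>auto simp: in_L2_def\<close>)
    then show "(\<lambda>n. \<integral>x. (f x - F n x)\<^sup>2 \<partial>M) \<longlonglongrightarrow> 0" by simp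
  qed
qed

end

section \<open>Box bumps and density of test functions in the cube\<close>

lemma flat_0_tendsto_1: "s > 0 \<Longrightarrow> (\<lambda>n. flat 0 (real n * s - 1)) \<longlonglongrightarrow> 1"
proof -
  assume s: "s > 0"
  have lim: "filterlim (\<lambda>n. real n * s - 1) at_top sequentially"
    using filterlim_tendsto_add_at_top[OF tendsto_const[of "- 1"]
        filterlim_at_top_mult_tendsto_pos[OF tendsto_const s filterlim_real_sequentially]] by simp
  then have "(\<lambda>n. exp (- 1 / (real n * s - 1))) \<longlonglongrightarrow> exp 0"
    by (intro tendsto_exp tendsto_divide_0[OF tendsto_const] filterlim_at_top_imp_at_infinity)
  moreover have "\<forall>\<^sub>F n in sequentially. exp (- 1 / (real n * s - 1)) = flat 0 (real n * s - 1)"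
    using filterlim_at_top_dense[THEN iffD1, OF lim, rule_format, of 0]
    by eventually_elim (simp add: flat_def)
  ultimately show ?thesis by (simp add: tendsto_cong)
qed

text \<open>For a nonempty box, (x - a)(b - x) is positive exactly between a and b. Subtracting 1
  after scaling by n keeps the support a positive distance inside the open box, and as n grows the
  product tends to the indicator.\<close>

definition box_bump :: "vec3 \<Rightarrow> vec3 \<Rightarrow> nat \<Rightarrow> vec3 \<Rightarrow> real" where
  "box_bump a b n x = (\<Prod>i\<in>UNIV. flat 0 (real n * ((x $ i - a $ i) * (b $ i - x $ i)) - 1))"

lemma Ck_box_bump: "Ck m (box_bump a b n)"
  unfolding box_bump_def[abs_def]
  by (intro Ck_prod Ck_flat Ck_diff Ck_mult Ck_const Ck_nth)

lemma box_bump_bounds: "0 \<le> box_bump a b n x" "box_bump a b n x \<le> 1"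
  unfolding box_bump_def by (auto intro!: prod_nonneg prod_le_1 flat_nonneg flat_0_le_1)

lemma mem_box_vec3: "(x \<in> box a b) \<longleftrightarrow> (\<forall>i. a $ i < x $ i \<and> x $ i < (b :: vec3) $ i)"
  by (simp add: mem_box_cart)

lemma box_ne_empty_vec3: "box a (b :: vec3) \<noteq> {} \<longleftrightarrow> (\<forall>i. a $ i < b $ i)"
  by (simp add: interval_ne_empty_cart)

lemma box_Int_vec3:
  "box a b \<inter> box c d = box (\<chi> i. max (a $ i) (c $ i)) (\<chi> i. min (b $ i) (d $ i :: real) :: vec3)"
  by (auto simp: mem_box_vec3)

lemma between_if_mult_pos:
  assumes "0 < (x - a) * (b - x)" "a < (b::real)" shows "a < x \<and> x < b"
  using assms by (auto simp: zero_less_mult_iff)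

lemma box_bump_tendsto:
  assumes "box a b \<noteq> {}"
  shows "(\<lambda>n. box_bump a b n x) \<longlonglongrightarrow> indicator (box a b) x"
proof (cases "x \<in> box a b")
  case True
  have "(\<lambda>n. box_bump a b n x) \<longlonglongrightarrow> (\<Prod>i\<in>(UNIV::3 set). 1)"
    unfolding box_bump_def using True
    by (intro tendsto_prod flat_0_tendsto_1) (auto simp: mem_box_vec3)
  then show ?thesis using True by simp
next
  case False
  then obtain i where "(x $ i - a $ i) * (b $ i - x $ i) \<le> 0"
    using assms between_if_mult_pos unfolding mem_box_vec3 box_ne_empty_vec3 by (meson not_le)
  then have "real n * ((x $ i - a $ i) * (b $ i - x $ i)) - 1 \<le> 0" for n
    using mult_nonneg_nonpos[of "real n"] by (smt (verit) of_nat_0_le_iff)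
  then have "box_bump a b n x = 0" for n
    unfolding box_bump_def by (intro prod_zero finite bexI[of _ i] flat_zero UNIV_I)
  then show ?thesis using False by simp
qed

lemma test_function_box_bump:
  assumes "box a b \<noteq> {}"
  shows "test_function (box a b) (box_bump a b n)"
  unfolding test_function_def
proof (intro conjI allI Ck_box_bump exI[of _ "cbox a b \<inter> (\<Inter>i. {x. 1 \<le> real n * ((x $ i - a $ i) * (b $ i - x $ i))})"] impI)
  \<comment> \<open>The set where every argument of \<open>flat\<close> is nonnegative. The closed
    box supplies boundedness, and the inequalities keep the set away from the boundary.\<close>
  let ?K = "cbox a b \<inter> (\<Inter>i. {x. 1 \<le> real n * ((x $ i - a $ i) * (b $ i - x $ i))})"
  show "compact ?K"
    by (intro compact_Int_closed closed_INT ballI closed_Collect_le continuous_intros compact_cbox)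
  have *: "a $ i < x $ i \<and> x $ i < b $ i" if "1 \<le> real n * ((x $ i - a $ i) * (b $ i - x $ i))" for i x
  proof (rule between_if_mult_pos)
    show "0 < (x $ i - a $ i) * (b $ i - x $ i)"
      using that by (metis less_le_trans not_less of_nat_0_le_iff mult_nonneg_nonpos zero_less_one)
    show "a $ i < b $ i" using assms by (simp add: box_ne_empty_vec3)
  qed
  then show "?K \<subseteq> box a b" by (auto simp: mem_box_vec3)
  fix x assume x: "x \<notin> ?K"
  have "\<exists>i. real n * ((x $ i - a $ i) * (b $ i - x $ i)) < 1"
  proof (rule ccontr)
    assume "\<not> ?thesis"
    then have 1: "1 \<le> real n * ((x $ i - a $ i) * (b $ i - x $ i))" for i by (auto simp: not_less)
    then have "x \<in> cbox a b" using *[OF 1] by (auto simp: mem_box_cart less_imp_le)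
    then show False using x 1 by auto
  qed
  then obtain i where "real n * ((x $ i - a $ i) * (b $ i - x $ i)) - 1 \<le> 0" by (auto intro: less_imp_le)
  then show "box_bump a b n x = 0"
    unfolding box_bump_def by (intro prod_zero finite bexI[of _ i] flat_zero UNIV_I)
qed

lemma test_function_mono: "test_function A \<phi> \<Longrightarrow> A \<subseteq> B \<Longrightarrow> test_function B \<phi>"
  unfolding test_function_def by blast

lemma test_function_Ck: "test_function A \<phi> \<Longrightarrow> Ck n \<phi>"
  by (simp add: test_function_def)

lemma test_function_add:
  assumes "test_function A \<phi>" "test_function A \<psi>" shows "test_function A (\<lambda>x. \<phi> x + \<psi> x)"
proof -
  obtain K L where "compact K" "K \<subseteq> A" "\<forall>x. x \<notin> K \<longrightarrow> \<phi> x = 0" "compact L" "L \<subseteq> A" "\<forall>x. x \<notin> L \<longrightarrow> \<psi> x = 0"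
    using assms unfolding test_function_def by blast
  then have "compact (K \<union> L)" "K \<union> L \<subseteq> A" "\<forall>x. x \<notin> K \<union> L \<longrightarrow> \<phi> x + \<psi> x = 0" by auto
  then show ?thesis using assms unfolding test_function_def by (blast intro: Ck_add)
qed

lemma test_function_mult:
  assumes "test_function A \<phi>" "\<And>n. Ck n \<psi>" shows "test_function A (\<lambda>x. \<psi> x * \<phi> x)"
  using assms unfolding test_function_def by (metis Ck_mult mult_zero_right)

lemma test_function_bounded:
  assumes "test_function A \<phi>" obtains B where "\<And>x. \<bar>\<phi> x\<bar> \<le> B"
proof -
  obtain K where K: "compact K" "\<forall>x. x \<notin> K \<longrightarrow> \<phi> x = 0" using assms unfolding test_function_def by blast
  have "compact (\<phi> ` K)"
    using K(1) Ck_continuous[OF test_function_Ck[OF assms, of 0]]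
    by (intro compact_continuous_image) (auto intro: continuous_on_subset)
  then obtain B where "\<And>x. x \<in> K \<Longrightarrow> \<bar>\<phi> x\<bar> \<le> B" using compact_imp_bounded bounded_iff by (metis imageI real_norm_def)
  then have "\<bar>\<phi> x\<bar> \<le> max B 0" for x using K(2) by (cases "x \<in> K") (auto simp: le_max_iff_disj)
  then show ?thesis using that by blast
qed

lemma Ck_measurable[measurable (raw)]: "Ck n \<phi> \<Longrightarrow> \<phi> \<in> borel_measurable borel"
  by (intro borel_measurable_continuous_onI Ck_continuous)

text \<open>Formulated for a general finite measure because it serves twice: for the cube with test
  functions and for the sphere with continuous functions.\<close>

lemma L2_closure_box_indicator:
  assumes fin: "finite_measure M" and M: "\<And>n. box_bump a b n \<in> borel_measurable M" "(indicator (box a b) :: _ \<Rightarrow> real) \<in> borel_measurable M"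
    and V: "\<And>g. g \<in> V \<Longrightarrow> in_L2 M g" "\<And>n. box_bump a b n \<in> V" and ne: "box a b \<noteq> {}"
  shows "L2_closure M V (indicator (box a b))"
proof -
  interpret finite_measure M by fact
  have [measurable]: "box_bump a b n \<in> borel_measurable M" "(indicator (box a b) :: _ \<Rightarrow> real) \<in> borel_measurable M" for n
    using M by (auto simp only:)
  show ?thesis
  proof (rule L2_closure_limit[where F="box_bump a b"])
    show "in_L2 M (indicator (box a b))" by (rule in_L2_bounded[of _ 1]) (auto simp: indicator_def)
    show "L2_closure M V (box_bump a b n)" for n
      unfolding L2_closure_def by (intro conjI V allI impI bexI[OF _ V(2)[of n]]) simp_all
    have "(\<lambda>n. \<integral>x. (indicator (box a b) x - box_bump a b n x)\<^sup>2 \<partial>M) \<longlonglongrightarrow> (\<integral>x. 0 \<partial>M)"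
    proof (rule integral_dominated_convergence[where w="\<lambda>_. 1"])
      show "AE x in M. (\<lambda>n. (indicator (box a b) x - box_bump a b n x)\<^sup>2) \<longlonglongrightarrow> 0"
        using box_bump_tendsto[OF ne] by (auto intro!: AE_I2 tendsto_eq_intros)
      show "AE x in M. norm ((indicator (box a b) x - box_bump a b n x)\<^sup>2) \<le> 1" for n
      proof (rule AE_I2)
        fix x
        show "norm ((indicator (box a b) x - box_bump a b n x)\<^sup>2) \<le> 1"
          using box_bump_bounds[of a b n x] by (simp add: abs_square_le_1 indicator_def abs_le_iff)
      qed
    qed auto
    then show "(\<lambda>n. \<integral>x. (indicator (box a b) x - box_bump a b n x)\<^sup>2 \<partial>M) \<longlonglongrightarrow> 0" by simp
  qed (fact V)
qed

lemma sets_restrict_boxes: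
  assumes "\<Omega> \<in> sets borel"
  shows "sets (restrict_space borel \<Omega>) = sigma_sets \<Omega> ((\<inter>) \<Omega> ` range (\<lambda>(a, b). box a (b :: vec3)))"
proof -
  have "sets borel = sigma_sets UNIV (range (\<lambda>(a, b). box a (b :: vec3)))"
    by (subst borel_eq_box) simp
  then show ?thesis using assms by (simp add: sets_restrict_space sigma_sets_Int)
qed

lemma Int_stable_boxes: "Int_stable ((\<inter>) \<Omega> ` range (\<lambda>(a, b). box a (b :: vec3)))"
proof (rule Int_stableI)
  let ?E = "(\<inter>) \<Omega> ` range (\<lambda>(a, b). box a (b :: vec3))"
  fix A B assume "A \<in> ?E" "B \<in> ?E"
  then obtain a b c d :: vec3 where "A = \<Omega> \<inter> box a b" "B = \<Omega> \<inter> box c d" by auto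
  then have "A \<inter> B = \<Omega> \<inter> (box a b \<inter> box c d)" by auto
  then show "A \<inter> B \<in> ?E" unfolding box_Int_vec3 by (rule image_eqI) auto
qed

lemma unit_cube_eq_box: "unit_cube = box 0 1"
  by (auto simp: unit_cube_def mem_box_vec3)

lemma finite_measure_cube: "finite_measure cube_measure"
  unfolding unit_cube_eq_box by (intro finite_measureI) (simp add: emeasure_restrict_space emeasure_lborel_box_eq)

lemma sets_cube_measure: "sets cube_measure = sets (restrict_space borel unit_cube)"
  by (intro sets_restrict_space_cong) simp

lemma space_cube_measure [simp]: "space cube_measure = unit_cube"
  by (simp add: space_restrict_space)

lemma unit_cube_borel [measurable, simp]: "unit_cube \<in> sets borel"
  unfolding unit_cube_eq_box by simp

lemma borel_measurable_cube: "f \<in> borel_measurable borel \<Longrightarrow> f \<in> borel_measurable cube_measure"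
  by (simp add: measurable_restrict_space1)

lemma test_function_in_L2: "test_function A \<phi> \<Longrightarrow> in_L2 cube_measure \<phi>"
proof -
  assume \<phi>: "test_function A \<phi>"
  obtain B where "\<And>x. \<bar>\<phi> x\<bar> \<le> B" using test_function_bounded[OF \<phi>] by blast
  then show ?thesis
    by (intro finite_measure.in_L2_bounded[OF finite_measure_cube, of _ B] borel_measurable_cube
        Ck_measurable[OF test_function_Ck[OF \<phi>, of 0]]) auto
qed

theorem L2_closure_test_functions:
  assumes "in_L2 cube_measure f"
  shows "L2_closure cube_measure {\<phi>. test_function unit_cube \<phi>} f"
proof (rule L2_closure_UNIV[where E="(\<inter>) unit_cube ` range (\<lambda>(a, b). box a (b :: vec3))"])
  let ?V = "{\<phi>. test_function unit_cube \<phi>}"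
  show V: "in_L2 cube_measure g" if "g \<in> ?V" for g using that test_function_in_L2 by blast
  show "(\<lambda>x. c * f x) \<in> ?V" if "f \<in> ?V" for f c using that by (auto intro!: test_function_mult Ck_const)
  show "finite_measure cube_measure" by (rule finite_measure_cube)
  have ind: "L2_closure cube_measure ?V (indicator (box a b))" if "box a b \<subseteq> unit_cube" for a b
  proof (cases "box a b = {}")
    case True
    have "test_function unit_cube (\<lambda>_. 0)"
      unfolding test_function_def by (intro conjI allI Ck_const exI[of _ "{}"]) auto
    then show ?thesis unfolding True L2_closure_def
      by (intro conjI allI impI bexI[of _ "\<lambda>_. 0"]) (auto simp: in_L2_def)
  next
    case False
    show ?thesis
      using test_function_mono[OF test_function_box_bump[OF False] that]
      by (intro L2_closure_box_indicator finite_measure_cube V False borel_measurable_cube) (auto intro: Ck_measurable[OF Ck_box_bump])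
  qed
  show "L2_closure cube_measure ?V (indicator A)" if A: "A \<in> (\<inter>) unit_cube ` range (\<lambda>(a, b). box a (b :: vec3))" for A
  proof -
    \<comment> \<open>The cube is itself a box and boxes are closed under intersection, so the trace
      of a box on the cube is again a box inside it.\<close>
    obtain a b :: vec3 where "A = box 0 1 \<inter> box a b" using A unit_cube_eq_box by auto
    then obtain c d where "A = box c d" unfolding box_Int_vec3 by (rule that)
    moreover have "A \<subseteq> unit_cube" using A by auto
    ultimately show ?thesis using ind[of c d] by simp
  qed
  show "L2_closure cube_measure ?V (indicator (space cube_measure))"
    using ind[of 0 1] unfolding space_cube_measure unit_cube_eq_box[symmetric] by simp
  show "sets cube_measure = sigma_sets (space cube_measure) ((\<inter>) unit_cube ` range (\<lambda>(a, b). box a (b :: vec3)))"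
    by (simp only: sets_cube_measure space_cube_measure sets_restrict_boxes[OF unit_cube_borel])
  show "Int_stable ((\<inter>) unit_cube ` range (\<lambda>(a, b). box a (b :: vec3)))" by (rule Int_stable_boxes)
  show "(\<lambda>x. f x + g x) \<in> ?V" if "f \<in> ?V" "g \<in> ?V" for f g
    using that by (simp add: test_function_add)
  show "(\<inter>) unit_cube ` range (\<lambda>(a, b). box a (b :: vec3)) \<subseteq> Pow (space cube_measure)" by auto
qed (fact assms)

section \<open>The surface measure of the sphere\<close>

lemma spherical_point_alt:
  "spherical_point p = (sin (fst p) * cos (snd p)) *\<^sub>R axis 1 1 + (sin (fst p) * sin (snd p)) *\<^sub>R axis 2 1
     + cos (fst p) *\<^sub>R axis 3 1"
  by (simp add: spherical_point_def vec_eq_iff forall_3 axis_def split: prod.split)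

lemma spherical_point_nth:
  "spherical_point (\<theta>, \<phi>) $ 1 = sin \<theta> * cos \<phi>" "spherical_point (\<theta>, \<phi>) $ 2 = sin \<theta> * sin \<phi>"
  "spherical_point (\<theta>, \<phi>) $ 3 = cos \<theta>"
  by (simp_all add: spherical_point_def)

lemma spherical_point_measurable [measurable]: "spherical_point \<in> borel_measurable borel"
  unfolding spherical_point_alt[abs_def]
  by (intro borel_measurable_continuous_onI continuous_intros)

lemma norm_vec3: "(norm (x :: vec3))\<^sup>2 = (x $ 1)\<^sup>2 + (x $ 2)\<^sup>2 + (x $ 3)\<^sup>2"
  unfolding power2_norm_eq_inner by (simp add: inner_vec_def sum_3 power2_eq_square)

lemma spherical_point_sphere: "spherical_point p \<in> sphere 0 1"
proof -
  have "(norm (spherical_point p))\<^sup>2 = 1"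
  proof (cases p)
    case (Pair \<theta> \<phi>)
    have "(sin \<theta> * cos \<phi>)\<^sup>2 + (sin \<theta> * sin \<phi>)\<^sup>2 + (cos \<theta>)\<^sup>2 = (sin \<theta>)\<^sup>2 * ((sin \<phi>)\<^sup>2 + (cos \<phi>)\<^sup>2) + (cos \<theta>)\<^sup>2"
      unfolding power_mult_distrib distrib_left by simp
    also have "\<dots> = 1" by simp
    finally show ?thesis unfolding norm_vec3 by (simp only: spherical_point_nth Pair)
  qed
  then have "norm (spherical_point p) = 1" by (rule power2_eq_imp_eq[of _ 1, simplified]) simp
  then show ?thesis by simp
qed

abbreviation angle_measure :: "(real \<times> real) measure" where
  "angle_measure \<equiv> density (restrict_space lborel ({0..pi} \<times> {0..2 * pi})) (\<lambda>(\<theta>, \<phi>). ennreal (sin \<theta>))"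

lemma angles_borel: "{0..pi} \<times> {0..2 * pi} \<in> sets (borel :: (real \<times> real) measure)"
  by (intro borel_closed closed_Times) auto

lemma measurable_restrict_borel:
  "f \<in> borel_measurable borel \<Longrightarrow> f \<in> measurable (restrict_space lborel A) borel"
  by (simp add: measurable_restrict_space1)

lemma spherical_point_measurable' [measurable]:
  "spherical_point \<in> measurable angle_measure (restrict_space borel (sphere 0 1))"
  by (rule measurable_restrict_space2)
     (use spherical_point_sphere measurable_restrict_borel[OF spherical_point_measurable] in auto)

lemma sets_sphere_measure [measurable_cong, simp]: "sets sphere_measure = sets (restrict_space borel (sphere 0 1))"
  by (simp add: sphere_measure_def)

lemma space_sphere_measure [simp]: "space sphere_measure = sphere 0 1"
  by (simp add: sphere_measure_def space_restrict_space)

lemma borel_measurable_sphere: "f \<in> borel_measurable borel \<Longrightarrow> f \<in> borel_measurable sphere_measure"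
  by (simp add: measurable_cong_sets[OF sets_sphere_measure refl] measurable_restrict_space1)

lemma sin_weight_measurable: "(\<lambda>(\<theta>, \<phi>). ennreal (sin \<theta>)) \<in> borel_measurable (borel :: (real \<times> real) measure)"
proof -
  have "(\<lambda>p::real \<times> real. sin (fst p)) \<in> borel_measurable borel"
    by (intro borel_measurable_continuous_onI continuous_intros)
  then show ?thesis by (simp add: case_prod_beta')
qed

text \<open>The density sin \<theta> is at most 1 on a bounded rectangle, so finiteness needs no
  computation of the total mass.\<close>

lemma finite_measure_sphere: "finite_measure sphere_measure"
proof (rule finite_measureI)
  have "emeasure sphere_measure (space sphere_measure) = emeasure angle_measure (space angle_measure)"
  proof -
    have "sphere 0 1 \<in> sets (restrict_space borel (sphere 0 (1::real) :: vec3 set))"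
      by (metis sets.top space_restrict_space2 closed_sphere borel_closed)
    moreover have "spherical_point -` sphere 0 1 \<inter> space angle_measure = space angle_measure"
      using spherical_point_sphere by auto
    ultimately show ?thesis
      using emeasure_distr[OF spherical_point_measurable', of "sphere 0 1"]
      by (simp only: space_sphere_measure) (simp only: sphere_measure_def)
  qed
  also have "\<dots> = (\<integral>\<^sup>+p. (case p of (\<theta>, \<phi>) \<Rightarrow> ennreal (sin \<theta>)) \<partial>restrict_space lborel ({0..pi} \<times> {0..2 * pi}))"
    by (subst emeasure_density) (auto intro!: measurable_restrict_borel sin_weight_measurable nn_integral_cong)
  also have "\<dots> \<le> (\<integral>\<^sup>+p. 1 \<partial>restrict_space lborel ({0..pi} \<times> {0..2 * pi}))"
    by (intro nn_integral_mono) (auto simp: ennreal_le_1)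
  also have "\<dots> = emeasure lborel ({0..pi} \<times> {0..2 * pi})"
    by (simp add: emeasure_restrict_space space_restrict_space angles_borel)
  also have "\<dots> < \<infinity>"
  proof -
    have "{0..pi} \<times> {0..2 * pi} = cbox (0, 0) (pi, 2 * pi)" by (auto simp: cbox_Pair_eq)
    then show ?thesis by (simp only: emeasure_lborel_cbox_finite)
  qed
  finally show "emeasure sphere_measure (space sphere_measure) \<noteq> \<infinity>" by simp
qed

interpretation sphere: finite_measure sphere_measure by (rule finite_measure_sphere)

lemma integral_sphere:
  assumes [measurable]: "f \<in> borel_measurable sphere_measure"
  shows "(\<integral>\<omega>. f \<omega> \<partial>sphere_measure) =
    (\<integral>p. indicator ({0..pi} \<times> {0..2 * pi}) p * (sin (fst p) * f (spherical_point p)) \<partial>lborel)"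
proof -
  have f: "f \<in> borel_measurable (restrict_space borel (sphere 0 1))"
    using assms by (simp add: measurable_cong_sets[OF sets_sphere_measure refl])
  have "(\<integral>\<omega>. f \<omega> \<partial>sphere_measure) = (\<integral>p. f (spherical_point p) \<partial>angle_measure)"
    unfolding sphere_measure_def by (rule integral_distr[OF _ f]) simp
  also have "angle_measure = density (restrict_space lborel ({0..pi} \<times> {0..2 * pi})) (\<lambda>p. ennreal (sin (fst p)))"
    by (simp add: case_prod_beta')
  also have "(\<integral>p. f (spherical_point p) \<partial>density (restrict_space lborel ({0..pi} \<times> {0..2 * pi})) (\<lambda>p. ennreal (sin (fst p))))
    = (\<integral>p. sin (fst p) *\<^sub>R f (spherical_point p) \<partial>restrict_space lborel ({0..pi} \<times> {0..2 * pi}))"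
  proof (rule integral_density)
    show "(\<lambda>p. f (spherical_point p)) \<in> borel_measurable (restrict_space lborel ({0..pi} \<times> {0..2 * pi}))"
      using measurable_compose[OF spherical_point_measurable' f] by simp
    show "(\<lambda>p. sin (fst p)) \<in> borel_measurable (restrict_space lborel ({0..pi} \<times> {0..2 * pi}))"
      by (intro measurable_restrict_borel borel_measurable_continuous_onI continuous_intros)
    show "AE p in restrict_space lborel ({0..pi} \<times> {0..2 * pi}). 0 \<le> sin (fst p)"
      by (auto simp: space_restrict_space intro!: AE_I2 sin_ge_zero)
  qed
  also have "\<dots> = (\<integral>p. indicator ({0..pi} \<times> {0..2 * pi}) p *\<^sub>R (sin (fst p) *\<^sub>R f (spherical_point p)) \<partial>lborel)"
    by (rule integral_restrict_space) (simp add: angles_borel)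
  finally show ?thesis by simp
qed

lemma integral_lborel_product:
  fixes f g :: "real \<Rightarrow> real"
  assumes f: "integrable lborel f" and g: "integrable lborel g"
  shows "(\<integral>p. f (fst p) * g (snd p) \<partial>lborel) = (\<integral>x. f x \<partial>lborel) * (\<integral>x. g x \<partial>lborel)"
proof -
  have int: "integrable (lborel \<Otimes>\<^sub>M lborel) (\<lambda>p. f (fst p) * g (snd p))"
  proof (rule lborel_pair.Fubini_integrable)
    show "integrable lborel (\<lambda>x. \<integral>y. norm (f (fst (x, y)) * g (snd (x, y))) \<partial>lborel)"
      using f by (simp add: abs_mult)
    show "(\<lambda>p. f (fst p) * g (snd p)) \<in> borel_measurable (lborel \<Otimes>\<^sub>M lborel)"
      using f g by measurable
  qed (use g in auto)
  have "(\<integral>p. f (fst p) * g (snd p) \<partial>lborel) = (\<integral>p. f (fst p) * g (snd p) \<partial>(lborel \<Otimes>\<^sub>M lborel))"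
    by (simp add: lborel_prod)
  also have "\<dots> = (\<integral>x. \<integral>y. f (fst (x, y)) * g (snd (x, y)) \<partial>lborel \<partial>lborel)"
    by (rule lborel_pair.integral_fst'[symmetric, OF int])
  finally show ?thesis by simp
qed

text \<open>In spherical coordinates each component is a product of sines and cosines, which have
  countably many zeros. The gluing argument divides by this component.\<close>

lemma AE_sphere_nth_neq_0: "AE \<omega> in sphere_measure. \<omega> $ i \<noteq> 0"
proof -
  have count: "countable {\<phi>. sin \<phi> = (0::real)}" "countable {\<phi>. cos \<phi> = (0::real)}"
  proof -
    have "{\<phi>. sin \<phi> = (0::real)} \<subseteq> range (\<lambda>n::int. of_int n * pi)" by (auto simp: sin_zero_iff_int2)
    then show "countable {\<phi>. sin \<phi> = (0::real)}" by (rule countable_subset) auto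
    have "{\<phi>. cos \<phi> = (0::real)} \<subseteq> (\<lambda>n. of_int n * (pi / 2)) ` {n::int. odd n}"
      by (auto simp: cos_zero_iff_int)
    then show "countable {\<phi>. cos \<phi> = (0::real)}" by (rule countable_subset) auto
  qed
  have ae: "AE x in lborel. sin (x::real) \<noteq> 0" "AE x in lborel. cos (x::real) \<noteq> 0"
    using count[THEN countable_imp_null_set_lborel] by (auto dest!: AE_not_in)
  have "AE p in lborel \<Otimes>\<^sub>M lborel. spherical_point p $ i \<noteq> 0"
  proof (rule lborel_pair.AE_pair_measure)
    show "{p \<in> space (lborel \<Otimes>\<^sub>M lborel). spherical_point p $ i \<noteq> 0} \<in> sets (lborel \<Otimes>\<^sub>M lborel)"
      unfolding lborel_prod by measurable
    show "AE x in lborel. AE y in lborel. spherical_point (x, y) $ i \<noteq> 0"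
      using ae(1) ae(2)
    proof eventually_elim
      case (elim x)
      show ?case
        using ae(1) ae(2)
      proof eventually_elim
        case (elim y)
        then show ?case using \<open>sin x \<noteq> 0\<close> \<open>cos x \<noteq> 0\<close> exhaust_3[of i] by (auto simp: spherical_point_nth)
      qed
    qed
  qed
  then have "AE p in lborel. spherical_point p $ i \<noteq> 0" unfolding lborel_prod .
  then have "AE p in angle_measure. spherical_point p $ i \<noteq> 0"
    by (subst AE_density) (auto simp: AE_restrict_space_iff angles_borel intro!: measurable_restrict_borel sin_weight_measurable)
  moreover have "{\<omega> \<in> space (restrict_space borel (sphere 0 1)). \<omega> $ i \<noteq> 0} \<in> sets (restrict_space borel (sphere (0 :: vec3) 1))"
  proof -
    have "{\<omega> \<in> space (restrict_space borel (sphere 0 1)). \<omega> $ i \<noteq> 0} = sphere (0 :: vec3) 1 \<inter> {\<omega>. \<omega> $ i \<noteq> 0}"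
      by (auto simp: space_restrict_space)
    moreover have "{\<omega> :: vec3. \<omega> $ i \<noteq> 0} \<in> sets borel"
      by (intro borel_open open_Collect_neq continuous_intros)
    ultimately show ?thesis by (auto simp: sets_restrict_space)
  qed
  ultimately show ?thesis
    unfolding sphere_measure_def by (subst AE_distr_iff) simp_all
qed

section \<open>Legendre polynomials\<close>

text \<open>The integral of \<open>p\<close> over [-1, 1] in the variable cos \<theta>. Keeping the
  weight sin \<theta> fits the surface measure directly and avoids a change of variables.\<close>

definition cos_integral :: "real poly \<Rightarrow> real" where
  "cos_integral p = (\<integral>\<theta>. sin \<theta> * poly p (cos \<theta>) * indicator {0..pi} \<theta> \<partial>lborel)"

lemma integrable_on_interval:
  "continuous_on UNIV f \<Longrightarrow> integrable lborel (\<lambda>\<theta>. f \<theta> * indicator {a..b::real} \<theta> :: real)"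
  using borel_integrable_atLeastAtMost[of a b f]
  by (auto simp: continuous_on_eq_continuous_at mult.commute intro: continuous_on_subset)

lemma cos_integral_add: "cos_integral (p + q) = cos_integral p + cos_integral q"
proof -
  have "integrable lborel (\<lambda>\<theta>. sin \<theta> * poly p (cos \<theta>) * indicator {0..pi} \<theta>)" for p
    by (intro integrable_on_interval continuous_intros)
  then show ?thesis
    unfolding cos_integral_def by (subst Bochner_Integration.integral_add[symmetric]) (auto simp: algebra_simps)
qed

lemma cos_integral_smult: "cos_integral (smult c p) = c * cos_integral p"
  unfolding cos_integral_def
  by (subst Bochner_Integration.integral_mult_right_zero[symmetric]) (simp add: mult_ac)

lemma cos_integral_uminus: "cos_integral (- p) = - cos_integral p"
  using cos_integral_smult[of "-1" p] by simp

lemma cos_integral_diff: "cos_integral (p - q) = cos_integral p - cos_integral q"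
  using cos_integral_add[of p "- q"] by (simp add: cos_integral_uminus)

lemma cos_integral_pderiv: "cos_integral (pderiv p) = poly p 1 - poly p (-1)"
proof -
  have "(\<integral>\<theta>. (sin \<theta> * poly (pderiv p) (cos \<theta>)) * indicator {0..pi} \<theta> \<partial>lborel)
      = - poly p (cos pi) - (- poly p (cos 0))"
    by (rule integral_FTC_Icc_real)
       (auto intro!: derivative_eq_intros DERIV_chain2[OF poly_DERIV] continuous_intros simp: mult.commute)
  then show ?thesis by (simp add: cos_integral_def)
qed

lemma cos_integral_by_parts:
  assumes "poly p 1 * poly q 1 = 0" "poly p (-1) * poly q (-1) = 0"
  shows "cos_integral (p * pderiv q) = - cos_integral (pderiv p * q)"
proof -
  have "cos_integral (p * pderiv q + pderiv p * q) = 0"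
    using cos_integral_pderiv[of "p * q"] assms by (simp add: pderiv_mult mult_ac)
  then show ?thesis by (simp add: cos_integral_add)
qed

lemma cos_integral_by_parts_iterated:
  assumes "\<And>j. j < n \<Longrightarrow> poly ((pderiv ^^ j) q) 1 = 0 \<and> poly ((pderiv ^^ j) q) (-1) = 0"
  shows "cos_integral (p * (pderiv ^^ n) q) = (-1) ^ n * cos_integral ((pderiv ^^ n) p * q)"
  using assms
proof (induction n arbitrary: p)
  case (Suc n)
  have "cos_integral (p * (pderiv ^^ Suc n) q) = - cos_integral (pderiv p * (pderiv ^^ n) q)"
    using Suc.prems[of n] by (simp add: cos_integral_by_parts)
  also have "\<dots> = (-1) ^ Suc n * cos_integral ((pderiv ^^ n) (pderiv p) * q)"
    using Suc.prems by (subst Suc.IH) auto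
  finally show ?case by (simp add: funpow_swap1)
qed simp

text \<open>Each differentiation costs at most one factor \<open>w\<close>. The cofactor
  \<open>r\<close> makes the result applicable to associated Legendre functions as well.\<close>

lemma dvd_higher_pderiv_power:
  fixes w :: "real poly"
  shows "j \<le> n \<Longrightarrow> w ^ (n - j) dvd (pderiv ^^ j) (w ^ n * r)"
proof (induction j)
  case (Suc j)
  obtain s where s: "(pderiv ^^ j) (w ^ n * r) = w ^ Suc (n - Suc j) * s"
    using Suc by (metis Suc_diff_Suc Suc_leD Suc_le_lessD dvdE)
  show ?case
    unfolding funpow.simps o_def s pderiv_mult pderiv_power_Suc
    by (intro dvd_add) (auto intro!: dvd_smult intro: dvd_mult dvd_mult2)
qed simp

abbreviation quad :: "real poly" where "quad \<equiv> [:-1, 0, 1:]"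

lemma higher_pderiv_quad_vanish:
  assumes "j < n" "x = 1 \<or> x = -1"
  shows "poly ((pderiv ^^ j) (quad ^ n * r)) x = 0"
proof -
  obtain m where m: "n - j = Suc m" using assms(1) by (metis Suc_diff_Suc)
  obtain s where "(pderiv ^^ j) (quad ^ n * r) = quad ^ (n - j) * s"
    using dvd_higher_pderiv_power[of j n quad r] assms(1) by auto
  then show ?thesis using assms(2) m by auto
qed

lemma higher_pderiv_degree_le:
  assumes "degree p \<le> n" shows "(pderiv ^^ n) (p :: real poly) = [:fact n * coeff p n:]"
proof (rule poly_eqI)
  fix i
  show "coeff ((pderiv ^^ n) p) i = coeff [:fact n * coeff p n:] i"
  proof (cases i)
    case 0
    then show ?thesis by (simp add: coeff_higher_pderiv pochhammer_fact)
  next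
    case (Suc k)
    then have "coeff p (i + n) = 0" using assms by (intro coeff_eq_0) auto
    then show ?thesis using Suc by (simp add: coeff_higher_pderiv)
  qed
qed

text \<open>Rodrigues' formula and l integrations by parts: boundary terms vanish because powers of
  \<open>quad\<close> remain, and of a polynomial of degree at most l only the top coefficient
  survives l derivatives. Orthogonality and normalisation are both read off from this one
  formula.\<close>

lemma cos_integral_legendre:
  assumes "degree p \<le> l"
  shows "cos_integral (p * legendre_poly l) = coeff p l * (cos_integral ((- quad) ^ l) / 2 ^ l)"
proof -
  have "cos_integral (p * (pderiv ^^ l) (quad ^ l)) = (-1) ^ l * cos_integral ((pderiv ^^ l) p * quad ^ l)"
    using higher_pderiv_quad_vanish[of _ l _ 1] by (intro cos_integral_by_parts_iterated) auto
  also have "(pderiv ^^ l) p * quad ^ l = smult (fact l * coeff p l) (quad ^ l)"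
    by (simp add: higher_pderiv_degree_le[OF assms])
  also have "(-1) ^ l * cos_integral (smult (fact l * coeff p l) (quad ^ l))
      = fact l * coeff p l * cos_integral (smult ((-1) ^ l) (quad ^ l))"
    by (simp add: cos_integral_smult)
  also have "smult ((-1) ^ l) (quad ^ l) = (- quad) ^ l"
    by (metis smult_1_left smult_minus_left smult_power)
  finally show ?thesis
    by (simp add: legendre_poly_def cos_integral_smult)
qed

text \<open>Let B(l) be the integral of (1 - x^2)^l. One integration by parts against x gives (2l +
  3) B(l + 1) = (2l + 2) B(l).\<close>

lemma cos_integral_quad_power: "cos_integral ((- quad) ^ l) = 2 ^ (2 * l + 1) * (fact l)\<^sup>2 / fact (2 * l + 1)"
proof (induction l)
  case 0
  have "cos_integral (pderiv [:0, 1:]) = 2" by (subst cos_integral_pderiv) simp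
  then show ?case by (simp add: pderiv_pCons one_pCons)
next
  case (Suc l)
  let ?B = "\<lambda>l. cos_integral ((- quad) ^ l)"
  define r :: "real poly" where "r = [:0, 1:]"
  have r: "pderiv r = 1" by (simp add: r_def pderiv_pCons)
  have q: "- quad = 1 - r * r" by (simp add: r_def one_pCons)
  have dq: "pderiv (- quad) = smult (-2) r" by (simp add: r_def pderiv_pCons pderiv_minus)
  have "cos_integral (r * pderiv ((- quad) ^ Suc l)) = - ?B (Suc l)"
    by (subst cos_integral_by_parts) (auto simp: r)
  moreover have "r * pderiv ((- quad) ^ Suc l) = smult (- 2 * (real l + 1)) (r * r * (- quad) ^ l)"
    unfolding pderiv_power_Suc dq by (simp add: algebra_simps flip: smult_minus_left)
  moreover have "r * r * (- quad) ^ l = (- quad) ^ l - (- quad) ^ Suc l"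
    unfolding power_Suc q by (simp add: algebra_simps)
  ultimately have "2 * (real l + 1) * (?B l - ?B (Suc l)) = ?B (Suc l)"
    by (simp only: cos_integral_smult cos_integral_diff)
  then have "?B (Suc l) * (2 * real l + 3) = (2 * real l + 2) * ?B l" by (simp add: algebra_simps)
  then have "?B (Suc l) = (2 * real l + 2) * ?B l / (2 * real l + 3)"
    by (subst eq_divide_eq) (simp add: add_nonneg_eq_0_iff)
  also have "\<dots> = 2 ^ (2 * Suc l + 1) * (fact (Suc l))\<^sup>2 / fact (2 * Suc l + 1)"
  proof -
    have f: "fact (2 * Suc l + 1) = (2 * real l + 3) * (2 * real l + 2) * (fact (2 * l + 1))"
      by (simp add: algebra_simps)
    have g: "(fact (Suc l) :: real) = (real l + 1) * fact l" by (simp add: algebra_simps)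
    \<comment> \<open>The factorials and the power are generalised to arbitrary reals, so that the
      step of the recursion becomes plain field algebra.\<close>
    have "F > 0 \<Longrightarrow> (2 * real l + 2) * (P * G\<^sup>2 / F) / (2 * real l + 3)
      = (4 * P) * ((real l + 1) * G)\<^sup>2 / ((2 * real l + 3) * (2 * real l + 2) * F)" for P F G :: real
      by (simp add: divide_simps power2_eq_square) (simp add: algebra_simps)
    from this[of "fact (2 * l + 1)" "2 ^ (2 * l + 1)" "fact l"] show ?thesis
      unfolding Suc.IH f g by simp
  qed
  finally show ?case .
qed

lemma degree_quad_power: "degree (quad ^ n) = 2 * n"
  by (simp add: degree_power_eq)

lemma lead_coeff_quad_power: "coeff (quad ^ n) (2 * n) = 1"
  using lead_coeff_power[of quad n] by (simp add: degree_quad_power)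

lemma degree_legendre: "degree (legendre_poly l) = l"
  by (simp add: legendre_poly_def degree_higher_pderiv degree_quad_power)

lemma pochhammer_Suc_fact: "pochhammer (real (Suc m)) n = fact (m + n) / fact m"
  using pochhammer_product'[of "1::real" m n] by (simp add: pochhammer_fact[symmetric])

lemma coeff_legendre: "coeff (legendre_poly l) l = fact (2 * l) / (2 ^ l * (fact l)\<^sup>2)"
proof -
  have "coeff ((pderiv ^^ l) (quad ^ l)) l = pochhammer (real (Suc l)) l"
    unfolding coeff_higher_pderiv using lead_coeff_quad_power[of l] by (simp add: mult_2)
  also have "\<dots> = fact (2 * l) / fact l"
    unfolding pochhammer_Suc_fact mult_2 ..
  finally show ?thesis by (simp add: legendre_poly_def power2_eq_square)
qed

text \<open>Only the polynomial part of the associated Legendre function: the factor (sin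
  \<theta>)^k is carried by the powers of \<omega>_1 + i \<omega>_2.\<close>

definition assoc_leg :: "nat \<Rightarrow> nat \<Rightarrow> real poly" where
  "assoc_leg l k = (pderiv ^^ k) (legendre_poly l)"

lemma degree_assoc_leg: "degree (assoc_leg l k) = l - k"
  by (simp add: assoc_leg_def degree_higher_pderiv degree_legendre)

lemma coeff_assoc_leg:
  assumes "k \<le> l"
  shows "coeff (assoc_leg l k) (l - k) = fact l / fact (l - k) * coeff (legendre_poly l) l"
proof -
  have "pochhammer (real (Suc (l - k))) k = fact l / fact (l - k)"
    unfolding pochhammer_Suc_fact using assms by simp
  then show ?thesis using assms by (simp add: assoc_leg_def coeff_higher_pderiv)
qed

text \<open>The k derivatives of \<open>assoc_leg l' k\<close> are moved onto the other factor,
  which becomes a polynomial \<open>S\<close> of degree at most l. Tested against the Legendre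
  polynomial of degree l', it gives zero for l < l' and its top coefficient for l = l'. The sign
  (-1)^k from the integrations by parts is absorbed by passing from \<open>- quad\<close> to
  \<open>quad\<close>.\<close>

lemma cos_integral_assoc_leg_le:
  assumes "l \<le> l'" "k \<le> l"
  shows "cos_integral ((- quad) ^ k * assoc_leg l k * assoc_leg l' k) =
    (if l = l' then 2 / (2 * real l + 1) * (fact (l + k) / fact (l - k)) else 0)"
proof -
  let ?W = "(- quad) ^ k * assoc_leg l k" and ?V = "quad ^ k * assoc_leg l k"
  have W: "?W = smult ((-1) ^ k) ?V"
    by (metis mult_smult_left smult_1_left smult_minus_left smult_power)
  define S where "S = (pderiv ^^ k) ?V"
  have "degree ?V \<le> l + k"
    using degree_mult_le[of "quad ^ k" "assoc_leg l k"] assms(2)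
    by (simp add: degree_quad_power degree_assoc_leg)
  then have S: "degree S \<le> l" by (simp add: S_def degree_higher_pderiv)
  have cV: "coeff ?V (l + k) = fact l / fact (l - k) * coeff (legendre_poly l) l"
  proof -
    have "coeff ?V (2 * k + (l - k)) = coeff (quad ^ k) (2 * k) * coeff (assoc_leg l k) (l - k)"
      using coeff_mult_degree_sum[of "quad ^ k" "assoc_leg l k"] by (simp only: degree_quad_power degree_assoc_leg)
    moreover have "2 * k + (l - k) = l + k" using assms(2) by simp
    ultimately show ?thesis by (simp add: lead_coeff_quad_power coeff_assoc_leg[OF assms(2)])
  qed
  have cS: "coeff S l = fact (l + k) / fact (l - k) * coeff (legendre_poly l) l"
  proof -
    have "pochhammer (real (Suc l)) k = fact (l + k) / fact l"
      by (rule pochhammer_Suc_fact)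
    then show ?thesis unfolding S_def coeff_higher_pderiv cV by simp
  qed
  have "cos_integral (legendre_poly l' * S) = (-1) ^ k * cos_integral (assoc_leg l' k * ?V)"
    unfolding S_def assoc_leg_def[of l']
    using higher_pderiv_quad_vanish[of _ k] by (intro cos_integral_by_parts_iterated) auto
  then have "cos_integral (?W * assoc_leg l' k) = cos_integral (S * legendre_poly l')"
  proof -
    have "?W * assoc_leg l' k = smult ((-1) ^ k) (assoc_leg l' k * ?V)"
      unfolding W by (simp add: mult.commute)
    then show ?thesis
      using \<open>cos_integral (legendre_poly l' * S) = _\<close>
      by (simp only: cos_integral_smult mult.commute[of S])
  qed
  also have "\<dots> = coeff S l' * (cos_integral ((- quad) ^ l') / 2 ^ l')"
    using S assms(1) by (intro cos_integral_legendre) auto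
  also have "\<dots> = (if l = l' then 2 / (2 * real l + 1) * (fact (l + k) / fact (l - k)) else 0)"
  proof (cases "l = l'")
    case True
    have fac: "fact (2 * l + 1) = (2 * real l + 1) * fact (2 * l)" by simp
    have pw: "(2::real) ^ (2 * l + 1) = 2 ^ l * 2 ^ l * 2" by (simp only: mult_2 power_add power_one_right)
    have "F \<noteq> 0 \<Longrightarrow> Q \<noteq> 0 \<Longrightarrow> P \<noteq> 0 \<Longrightarrow> n \<noteq> 0 \<Longrightarrow> A * (F / (P * Q)) * (P * P * 2 * Q / (n * F) / P) = 2 / n * A"
      for F Q P A n :: real by simp
    from this[of "fact (2 * l)" "(fact l)\<^sup>2" "2 ^ l" "2 * real l + 1" "fact (l + k) / fact (l - k)"]
    have "coeff S l * (cos_integral ((- quad) ^ l) / 2 ^ l) = 2 / (2 * real l + 1) * (fact (l + k) / fact (l - k))"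
      unfolding cS coeff_legendre cos_integral_quad_power pw fac
      by (simp add: add_nonneg_eq_0_iff)
    then show ?thesis using True by simp
  next
    case False
    then have "coeff S l' = 0" using S assms(1) by (intro coeff_eq_0) auto
    then show ?thesis using False by simp
  qed
  finally show ?thesis .
qed

lemma cos_integral_assoc_leg:
  assumes "k \<le> l" "k \<le> l'"
  shows "cos_integral ((- quad) ^ k * assoc_leg l k * assoc_leg l' k) =
    (if l = l' then 2 / (2 * real l + 1) * (fact (l + k) / fact (l - k)) else 0)"
  using cos_integral_assoc_leg_le[of l l' k] cos_integral_assoc_leg_le[of l' l k] assms
  by (cases "l \<le> l'") (auto simp: mult_ac)

section \<open>Spherical harmonics: orthonormality\<close>

text \<open>For negative orders \<open>sph_harm\<close> takes the imaginary part of the power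
  |\<kappa>|, that is sin(|\<kappa>| \<phi>); written with \<kappa> itself this produces the minus
  sign.\<close>

definition trig :: "int \<Rightarrow> real \<Rightarrow> real" where
  "trig \<kappa> \<phi> = (if \<kappa> \<ge> 0 then cos (real_of_int \<kappa> * \<phi>) else - sin (real_of_int \<kappa> * \<phi>))"

lemma integral_cos_multiple:
  "(\<integral>\<phi>. cos (real_of_int j * \<phi>) * indicator {0..2 * pi} \<phi> \<partial>lborel) = (if j = 0 then 2 * pi else 0)"
proof (cases "j = 0")
  case False
  have "(\<integral>\<phi>. cos (real_of_int j * \<phi>) * indicator {0..2 * pi} \<phi> \<partial>lborel)
      = sin (real_of_int j * (2 * pi)) / real_of_int j - sin (real_of_int j * 0) / real_of_int j"
    by (rule integral_FTC_Icc_real) (use False in \<open>auto intro!: derivative_eq_intros continuous_intros\<close>)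
  also have "sin (real_of_int j * (2 * pi)) = 0" by (metis sin_int_2pin mult.commute)
  finally show ?thesis using False by simp
qed simp

lemma integral_sin_multiple:
  "(\<integral>\<phi>. sin (real_of_int j * \<phi>) * indicator {0..2 * pi} \<phi> \<partial>lborel) = 0"
proof (cases "j = 0")
  case False
  have "(\<integral>\<phi>. sin (real_of_int j * \<phi>) * indicator {0..2 * pi} \<phi> \<partial>lborel)
      = - cos (real_of_int j * (2 * pi)) / real_of_int j - (- cos (real_of_int j * 0) / real_of_int j)"
    by (rule integral_FTC_Icc_real) (use False in \<open>auto intro!: derivative_eq_intros continuous_intros\<close>)
  also have "cos (real_of_int j * (2 * pi)) = 1" by (metis cos_int_2pin mult.commute)
  finally show ?thesis by simp
qed simp

lemma integral_trig_mult:
  "(\<integral>\<phi>. trig \<kappa> \<phi> * trig \<kappa>' \<phi> * indicator {0..2 * pi} \<phi> \<partial>lborel) =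
     (if \<kappa> = \<kappa>' then if \<kappa> = 0 then 2 * pi else pi else 0)"
proof -
  let ?I = "indicator {0..2 * pi} :: real \<Rightarrow> real"
  have int: "integrable lborel (\<lambda>\<phi>. cos (real_of_int j * \<phi>) * ?I \<phi>)" "integrable lborel (\<lambda>\<phi>. sin (real_of_int j * \<phi>) * ?I \<phi>)" for j
    by (intro integrable_on_interval continuous_intros)+
  have cc: "(\<integral>\<phi>. cos (real_of_int m * \<phi>) * cos (real_of_int n * \<phi>) * ?I \<phi> \<partial>lborel)
      = ((if m - n = 0 then 2 * pi else 0) + (if m + n = 0 then 2 * pi else 0)) / 2" for m n
  proof -
    have "cos (real_of_int m * \<phi>) * cos (real_of_int n * \<phi>) * ?I \<phi>
        = (1/2) * (cos (real_of_int (m - n) * \<phi>) * ?I \<phi> + cos (real_of_int (m + n) * \<phi>) * ?I \<phi>)" for \<phi>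
      by (simp add: cos_times_cos algebra_simps)
    then show ?thesis
      by (simp only: integral_mult_right_zero Bochner_Integration.integral_add[OF int(1) int(1)] integral_cos_multiple, simp?)
  qed
  have ss: "(\<integral>\<phi>. sin (real_of_int m * \<phi>) * sin (real_of_int n * \<phi>) * ?I \<phi> \<partial>lborel)
      = ((if m - n = 0 then 2 * pi else 0) - (if m + n = 0 then 2 * pi else 0)) / 2" for m n
  proof -
    have "sin (real_of_int m * \<phi>) * sin (real_of_int n * \<phi>) * ?I \<phi>
        = (1/2) * (cos (real_of_int (m - n) * \<phi>) * ?I \<phi> - cos (real_of_int (m + n) * \<phi>) * ?I \<phi>)" for \<phi>
      by (simp add: sin_times_sin left_diff_distrib distrib_right)
    then show ?thesis
      by (simp only: integral_mult_right_zero Bochner_Integration.integral_diff[OF int(1) int(1)] integral_cos_multiple, simp?)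
  qed
  have sc: "(\<integral>\<phi>. sin (real_of_int m * \<phi>) * cos (real_of_int n * \<phi>) * ?I \<phi> \<partial>lborel) = 0" for m n
  proof -
    have "sin (real_of_int m * \<phi>) * cos (real_of_int n * \<phi>) * ?I \<phi>
        = (1/2) * (sin (real_of_int (m + n) * \<phi>) * ?I \<phi> + sin (real_of_int (m - n) * \<phi>) * ?I \<phi>)" for \<phi>
      by (simp add: sin_times_cos left_diff_distrib distrib_right)
    then show ?thesis
      by (simp only: integral_mult_right_zero Bochner_Integration.integral_add[OF int(2) int(2)] integral_sin_multiple, simp?)
  qed
  consider "\<kappa> \<ge> 0" "\<kappa>' \<ge> 0" | "\<kappa> \<ge> 0" "\<kappa>' < 0" | "\<kappa> < 0" "\<kappa>' \<ge> 0" | "\<kappa> < 0" "\<kappa>' < 0" by linarith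
  then show ?thesis
  proof cases
    case 1
    then show ?thesis unfolding trig_def by (simp only: if_True cc) auto
  next
    case 2
    have "(\<integral>\<phi>. trig \<kappa> \<phi> * trig \<kappa>' \<phi> * ?I \<phi> \<partial>lborel)
        = (\<integral>\<phi>. - (sin (real_of_int \<kappa>' * \<phi>) * cos (real_of_int \<kappa> * \<phi>) * ?I \<phi>) \<partial>lborel)"
      using 2 by (simp add: trig_def mult_ac)
    then show ?thesis using 2 by (simp only: integral_minus sc) auto
  next
    case 3
    have "(\<integral>\<phi>. trig \<kappa> \<phi> * trig \<kappa>' \<phi> * ?I \<phi> \<partial>lborel)
        = (\<integral>\<phi>. - (sin (real_of_int \<kappa> * \<phi>) * cos (real_of_int \<kappa>' * \<phi>) * ?I \<phi>) \<partial>lborel)"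
      using 3 by (simp add: trig_def mult_ac)
    then show ?thesis using 3 by (simp only: integral_minus sc) auto
  next
    case 4
    then have "(\<integral>\<phi>. trig \<kappa> \<phi> * trig \<kappa>' \<phi> * ?I \<phi> \<partial>lborel)
        = (\<integral>\<phi>. sin (real_of_int \<kappa> * \<phi>) * sin (real_of_int \<kappa>' * \<phi>) * ?I \<phi> \<partial>lborel)"
      by (simp add: trig_def)
    then show ?thesis using 4 by (simp only: ss) auto
  qed
qed

definition sph_norm :: "nat \<Rightarrow> nat \<Rightarrow> real" where
  "sph_norm l k = sqrt ((if k = 0 then 1 else 2) * (2 * real l + 1) / (4 * pi) * (fact (l - k) / fact (l + k)))"

lemma sph_harm_eq:
  "sph_harm l \<kappa> \<omega> = sph_norm l (nat \<bar>\<kappa>\<bar>) * poly (assoc_leg l (nat \<bar>\<kappa>\<bar>)) (\<omega> $ 3) *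
     (if \<kappa> \<ge> 0 then Re (Complex (\<omega> $ 1) (\<omega> $ 2) ^ nat \<bar>\<kappa>\<bar>) else Im (Complex (\<omega> $ 1) (\<omega> $ 2) ^ nat \<bar>\<kappa>\<bar>))"
  by (simp add: sph_harm_def sph_norm_def assoc_leg_def Let_def)

lemma sph_harm_spherical:
  "sph_harm l \<kappa> (spherical_point (\<theta>, \<phi>)) =
     sph_norm l (nat \<bar>\<kappa>\<bar>) * poly (assoc_leg l (nat \<bar>\<kappa>\<bar>)) (cos \<theta>) * (sin \<theta> ^ nat \<bar>\<kappa>\<bar> * trig \<kappa> \<phi>)"
proof -
  have "Complex (sin \<theta> * cos \<phi>) (sin \<theta> * sin \<phi>) = rcis (sin \<theta>) \<phi>"
    by (simp add: rcis_def cis.ctr complex_eq_iff)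
  then have "Complex (sin \<theta> * cos \<phi>) (sin \<theta> * sin \<phi>) ^ n = rcis (sin \<theta> ^ n) (real n * \<phi>)" for n
    by (simp add: DeMoivre2)
  then show ?thesis
    by (cases "\<kappa> \<ge> 0") (simp_all add: sph_harm_eq spherical_point_nth trig_def)
qed

lemma continuous_sph_harm: "continuous_on UNIV (sph_harm l \<kappa>)"
proof -
  have "continuous_on UNIV (\<lambda>\<omega>::vec3. Re (Complex (\<omega> $ 1) (\<omega> $ 2) ^ k))"
    "continuous_on UNIV (\<lambda>\<omega>::vec3. Im (Complex (\<omega> $ 1) (\<omega> $ 2) ^ k))" for k
    by (intro continuous_intros)+
  then show ?thesis
    unfolding sph_harm_eq[abs_def] by (cases "\<kappa> \<ge> 0") (auto intro!: continuous_intros)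
qed

lemma sphere_in_L2_continuous:
  assumes "continuous_on UNIV f" shows "in_L2 sphere_measure f"
proof -
  have "compact (f ` sphere 0 1)"
    using assms by (intro compact_continuous_image) (auto intro: continuous_on_subset)
  then obtain B where "\<And>x. x \<in> sphere 0 1 \<Longrightarrow> \<bar>f x\<bar> \<le> B"
    using compact_imp_bounded bounded_iff by (metis imageI real_norm_def)
  then show ?thesis
    by (intro sphere.in_L2_bounded[of _ B] borel_measurable_sphere borel_measurable_continuous_onI assms) auto
qed

lemma integral_sphere_product:
  assumes "continuous_on UNIV f" "continuous_on UNIV a" "continuous_on UNIV b"
    and "\<And>\<theta> \<phi>. f (spherical_point (\<theta>, \<phi>)) = a \<theta> * b \<phi>"
  shows "(\<integral>\<omega>. f \<omega> \<partial>sphere_measure) =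
    (\<integral>\<theta>. sin \<theta> * a \<theta> * indicator {0..pi} \<theta> \<partial>lborel) * (\<integral>\<phi>. b \<phi> * indicator {0..2 * pi} \<phi> \<partial>lborel)"
proof -
  have "(\<integral>\<omega>. f \<omega> \<partial>sphere_measure) =
    (\<integral>p. indicator ({0..pi} \<times> {0..2 * pi}) p * (sin (fst p) * f (spherical_point p)) \<partial>lborel)"
    by (intro integral_sphere borel_measurable_sphere borel_measurable_continuous_onI assms)
  also have "\<dots> = (\<integral>p. (sin (fst p) * a (fst p) * indicator {0..pi} (fst p)) * (b (snd p) * indicator {0..2 * pi} (snd p)) \<partial>lborel)"
    using assms(4) by (intro Bochner_Integration.integral_cong) (auto simp: indicator_times)
  also have "\<dots> = (\<integral>\<theta>. sin \<theta> * a \<theta> * indicator {0..pi} \<theta> \<partial>lborel) * (\<integral>\<phi>. b \<phi> * indicator {0..2 * pi} \<phi> \<partial>lborel)"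
    by (intro integral_lborel_product integrable_on_interval continuous_intros assms)
  finally show ?thesis .
qed

lemma continuous_trig: "continuous_on UNIV (trig \<kappa>)"
  unfolding trig_def[abs_def] by (cases "\<kappa> \<ge> 0") (auto intro!: continuous_intros)

theorem sph_harm_orthonormal:
  assumes "\<bar>\<kappa>\<bar> \<le> int l" "\<bar>\<kappa>'\<bar> \<le> int l'"
  shows "(\<integral>\<omega>. sph_harm l \<kappa> \<omega> * sph_harm l' \<kappa>' \<omega> \<partial>sphere_measure) = (if l = l' \<and> \<kappa> = \<kappa>' then 1 else 0)"
proof -
  define k k' where "k = nat \<bar>\<kappa>\<bar>" and "k' = nat \<bar>\<kappa>'\<bar>"
  have kl: "k \<le> l" "k' \<le> l'" using assms by (auto simp: k_def k'_def)
  let ?a = "\<lambda>\<theta>. sph_norm l k * sph_norm l' k' * (sin \<theta> ^ k * sin \<theta> ^ k' * (poly (assoc_leg l k) (cos \<theta>) * poly (assoc_leg l' k') (cos \<theta>)))"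
  have eq: "(\<integral>\<omega>. sph_harm l \<kappa> \<omega> * sph_harm l' \<kappa>' \<omega> \<partial>sphere_measure) =
     (\<integral>\<theta>. sin \<theta> * ?a \<theta> * indicator {0..pi} \<theta> \<partial>lborel) * (\<integral>\<phi>. trig \<kappa> \<phi> * trig \<kappa>' \<phi> * indicator {0..2 * pi} \<phi> \<partial>lborel)"
    by (rule integral_sphere_product)
      (auto intro!: continuous_intros continuous_sph_harm continuous_trig simp: sph_harm_spherical k_def k'_def mult_ac)
  show ?thesis
  proof (cases "\<kappa> = \<kappa>'")
    case False
    then show ?thesis unfolding eq integral_trig_mult by simp
  next
    case True
    then have k': "k' = k" by (simp add: k_def k'_def)
    \<comment> \<open>For equal orders the sine powers combine to (1 - cos^2)^k, so the whole polar
      integrand is sin \<theta> times a polynomial in cos \<theta>.\<close>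
    have "sin \<theta> * ?a \<theta> * indicator {0..pi} \<theta> = sph_norm l k * sph_norm l' k *
        (sin \<theta> * poly ((- quad) ^ k * assoc_leg l k * assoc_leg l' k) (cos \<theta>) * indicator {0..pi} \<theta>)" for \<theta> :: real
    proof -
      have "poly (- quad) (cos \<theta>) = (sin \<theta>)\<^sup>2"
        using sin_cos_squared_add[of \<theta>] by (simp add: power2_eq_square)
      then show ?thesis unfolding k' poly_mult poly_power by (simp add: power2_eq_square power_mult_distrib mult_ac)
    qed
    then have "(\<integral>\<theta>. sin \<theta> * ?a \<theta> * indicator {0..pi} \<theta> \<partial>lborel)
        = sph_norm l k * sph_norm l' k * cos_integral ((- quad) ^ k * assoc_leg l k * assoc_leg l' k)"
      by (simp only: integral_mult_right_zero cos_integral_def)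
    also have "\<dots> = sph_norm l k * sph_norm l' k * (if l = l' then 2 / (2 * real l + 1) * (fact (l + k) / fact (l - k)) else 0)"
      using kl by (subst cos_integral_assoc_leg) (auto simp: k')
    finally have th: "(\<integral>\<theta>. sin \<theta> * ?a \<theta> * indicator {0..pi} \<theta> \<partial>lborel) = \<dots>" .
    show ?thesis
    proof (cases "l = l'")
      case False
      then show ?thesis unfolding eq th by simp
    next
      case l: True
      define c :: real where "c = (if k = 0 then 1 else 2)"
      have k0: "k = 0 \<longleftrightarrow> \<kappa> = 0" by (simp add: k_def)
      have "sph_norm l k * sph_norm l k = c * (2 * real l + 1) / (4 * pi) * (fact (l - k) / fact (l + k))"
        unfolding sph_norm_def c_def by (subst real_sqrt_mult_self) simp
      moreover have "(2 * real l + 1) \<noteq> 0" by linarith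
      ultimately have "sph_norm l k * sph_norm l k * (2 / (2 * real l + 1) * (fact (l + k) / fact (l - k))) = c / (2 * pi)"
        by (simp add: divide_simps) (simp add: mult_ac)
      then show ?thesis
        unfolding eq th integral_trig_mult using True l k0 by (simp add: c_def)
    qed
  qed
qed

text \<open>An intermediate class between polynomials and harmonics. The rule \<open>cong\<close>
  asks for agreement on the sphere only, so that |\<omega>_1 + i \<omega>_2|^2 may be replaced by 1
  - \<omega>_3^2; this makes the class closed under products.\<close>

inductive polar :: "(vec3 \<Rightarrow> real) \<Rightarrow> bool" where
  re: "polar (\<lambda>\<omega>. poly p (\<omega> $ 3) * Re (Complex (\<omega> $ 1) (\<omega> $ 2) ^ k))"
| im: "polar (\<lambda>\<omega>. poly p (\<omega> $ 3) * Im (Complex (\<omega> $ 1) (\<omega> $ 2) ^ k))"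
| add: "polar f \<Longrightarrow> polar g \<Longrightarrow> polar (\<lambda>\<omega>. f \<omega> + g \<omega>)"
| cong: "polar f \<Longrightarrow> (\<And>\<omega>. \<omega> \<in> sphere 0 1 \<Longrightarrow> g \<omega> = f \<omega>) \<Longrightarrow> polar g"

lemma polar_poly_mult: "polar f \<Longrightarrow> polar (\<lambda>\<omega>. poly q (\<omega> $ 3) * f \<omega>)"
proof (induction rule: polar.induct)
  case (re p k)
  have "polar (\<lambda>\<omega>. poly (q * p) (\<omega> $ 3) * Re (Complex (\<omega> $ 1) (\<omega> $ 2) ^ k))" by (rule polar.re)
  then show ?case by (simp add: mult.assoc)
next
  case (im p k)
  have "polar (\<lambda>\<omega>. poly (q * p) (\<omega> $ 3) * Im (Complex (\<omega> $ 1) (\<omega> $ 2) ^ k))" by (rule polar.im)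
  then show ?case by (simp add: mult.assoc)
next
  case (add f g)
  then show ?case by (auto simp: distrib_left intro: polar.add)
next
  case (cong f g)
  then show ?case by (auto intro: polar.cong)
qed

lemma polar_scale: "polar f \<Longrightarrow> polar (\<lambda>\<omega>. c * f \<omega>)"
  using polar_poly_mult[of f "[:c:]"] by simp

text \<open>With z = \<omega>_1 + i \<omega>_2, common factors of z^j and the conjugate of z^k pair
  up to powers of 1 - \<omega>_3^2. A single power of z or of its conjugate remains.\<close>

lemma polar_cross:
  "polar (\<lambda>\<omega>. Re (Complex (\<omega> $ 1) (\<omega> $ 2) ^ j * cnj (Complex (\<omega> $ 1) (\<omega> $ 2) ^ k)))"
  "polar (\<lambda>\<omega>. Im (Complex (\<omega> $ 1) (\<omega> $ 2) ^ j * cnj (Complex (\<omega> $ 1) (\<omega> $ 2) ^ k)))"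
proof -
  have abs: "Complex (\<omega> $ 1) (\<omega> $ 2) ^ n * cnj (Complex (\<omega> $ 1) (\<omega> $ 2) ^ n) = of_real (poly ((- quad) ^ n) (\<omega> $ 3))"
    if "\<omega> \<in> sphere 0 1" for \<omega> :: vec3 and n
  proof -
    have "(\<omega> $ 1)\<^sup>2 + (\<omega> $ 2)\<^sup>2 + (\<omega> $ 3)\<^sup>2 = 1" using norm_vec3[of \<omega>] that by simp
    then have "(\<omega> $ 1)\<^sup>2 + (\<omega> $ 2)\<^sup>2 = poly (- quad) (\<omega> $ 3)" by (simp add: power2_eq_square)
    then have "Complex (\<omega> $ 1) (\<omega> $ 2) * cnj (Complex (\<omega> $ 1) (\<omega> $ 2)) = of_real (poly (- quad) (\<omega> $ 3))"
      by (simp only: complex_mult_cnj complex.sel)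
    then show ?thesis by (simp only: complex_cnj_power power_mult_distrib[symmetric] poly_power of_real_power)
  qed
  have less: "Complex (\<omega> $ 1) (\<omega> $ 2) ^ j * cnj (Complex (\<omega> $ 1) (\<omega> $ 2) ^ k)
      = of_real (poly ((- quad) ^ k) (\<omega> $ 3)) * Complex (\<omega> $ 1) (\<omega> $ 2) ^ (j - k)"
    if "\<omega> \<in> sphere 0 1" "k \<le> j" for \<omega> :: vec3 and j k
  proof -
    have "Complex (\<omega> $ 1) (\<omega> $ 2) ^ j = Complex (\<omega> $ 1) (\<omega> $ 2) ^ k * Complex (\<omega> $ 1) (\<omega> $ 2) ^ (j - k)"
      using that(2) by (simp flip: power_add)
    then show ?thesis using abs[OF that(1), of k] by (simp add: mult_ac)
  qed
  have *: "polar (\<lambda>\<omega>. Re (Complex (\<omega> $ 1) (\<omega> $ 2) ^ j * cnj (Complex (\<omega> $ 1) (\<omega> $ 2) ^ k)))"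
    "polar (\<lambda>\<omega>. Im (Complex (\<omega> $ 1) (\<omega> $ 2) ^ j * cnj (Complex (\<omega> $ 1) (\<omega> $ 2) ^ k)))" if "k \<le> j" for j k
  proof -
    show "polar (\<lambda>\<omega>. Re (Complex (\<omega> $ 1) (\<omega> $ 2) ^ j * cnj (Complex (\<omega> $ 1) (\<omega> $ 2) ^ k)))"
    proof (rule polar.cong[OF polar.re[of "(- quad) ^ k" "j - k"]])
      fix \<omega> :: vec3 assume \<omega>: "\<omega> \<in> sphere 0 1"
      show "Re (Complex (\<omega> $ 1) (\<omega> $ 2) ^ j * cnj (Complex (\<omega> $ 1) (\<omega> $ 2) ^ k)) =
         poly ((- quad) ^ k) (\<omega> $ 3) * Re (Complex (\<omega> $ 1) (\<omega> $ 2) ^ (j - k))"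
        unfolding less[OF \<omega> that] by simp
    qed
    show "polar (\<lambda>\<omega>. Im (Complex (\<omega> $ 1) (\<omega> $ 2) ^ j * cnj (Complex (\<omega> $ 1) (\<omega> $ 2) ^ k)))"
    proof (rule polar.cong[OF polar.im[of "(- quad) ^ k" "j - k"]])
      fix \<omega> :: vec3 assume \<omega>: "\<omega> \<in> sphere 0 1"
      show "Im (Complex (\<omega> $ 1) (\<omega> $ 2) ^ j * cnj (Complex (\<omega> $ 1) (\<omega> $ 2) ^ k)) =
         poly ((- quad) ^ k) (\<omega> $ 3) * Im (Complex (\<omega> $ 1) (\<omega> $ 2) ^ (j - k))"
        unfolding less[OF \<omega> that] by simp
    qed
  qed
  have swap: "Re (x * cnj y) = Re (y * cnj x)" "Im (x * cnj y) = -1 * Im (y * cnj x)" for x y :: complex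
    by (simp_all add: mult.commute)
  show "polar (\<lambda>\<omega>. Re (Complex (\<omega> $ 1) (\<omega> $ 2) ^ j * cnj (Complex (\<omega> $ 1) (\<omega> $ 2) ^ k)))"
  proof (cases "k \<le> j")
    case False
    then show ?thesis by (subst swap) (rule *, simp)
  qed (rule *)
  show "polar (\<lambda>\<omega>. Im (Complex (\<omega> $ 1) (\<omega> $ 2) ^ j * cnj (Complex (\<omega> $ 1) (\<omega> $ 2) ^ k)))"
  proof (cases "k \<le> j")
    case False
    then show ?thesis by (subst swap) (rule polar_scale[OF *(2)], simp)
  qed (rule *)
qed

text \<open>Products of real and imaginary parts of a and b are half sums or half differences of the
  parts of ab and of a times the conjugate of b.\<close>

lemma polar_mult_basic:
  defines "z \<equiv> \<lambda>\<omega>::vec3. Complex (\<omega> $ 1) (\<omega> $ 2)"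
  shows "polar (\<lambda>\<omega>. Re (z \<omega> ^ j) * Re (z \<omega> ^ k))" "polar (\<lambda>\<omega>. Re (z \<omega> ^ j) * Im (z \<omega> ^ k))"
    "polar (\<lambda>\<omega>. Im (z \<omega> ^ j) * Im (z \<omega> ^ k))"
proof -
  have one: "polar (\<lambda>\<omega>. Re (z \<omega> ^ k))" "polar (\<lambda>\<omega>. Im (z \<omega> ^ k))" for k
    using polar.re[of 1 k] polar.im[of 1 k] by (simp_all add: z_def)
  have cr: "polar (\<lambda>\<omega>. Re (z \<omega> ^ j * cnj (z \<omega> ^ k)))" "polar (\<lambda>\<omega>. Im (z \<omega> ^ j * cnj (z \<omega> ^ k)))" for j k
    unfolding z_def by (rule polar_cross)+
  have "polar (\<lambda>\<omega>. 1/2 * (Re (z \<omega> ^ (j + k)) + Re (z \<omega> ^ j * cnj (z \<omega> ^ k))))"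
    by (intro polar_scale polar.add one cr)
  then show "polar (\<lambda>\<omega>. Re (z \<omega> ^ j) * Re (z \<omega> ^ k))"
    by (rule polar.cong) (simp add: power_add del: complex_cnj_power)
  have "polar (\<lambda>\<omega>. 1/2 * (Im (z \<omega> ^ (j + k)) + Im (z \<omega> ^ k * cnj (z \<omega> ^ j))))"
    by (intro polar_scale polar.add one cr)
  then show "polar (\<lambda>\<omega>. Re (z \<omega> ^ j) * Im (z \<omega> ^ k))"
    by (rule polar.cong) (simp add: power_add del: complex_cnj_power)
  have "polar (\<lambda>\<omega>. 1/2 * (Re (z \<omega> ^ j * cnj (z \<omega> ^ k)) + (-1) * Re (z \<omega> ^ (j + k))))"
    by (intro polar_scale polar.add one cr)
  then show "polar (\<lambda>\<omega>. Im (z \<omega> ^ j) * Im (z \<omega> ^ k))"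
    by (rule polar.cong) (simp add: power_add del: complex_cnj_power)
qed

lemma polar_mult:
  assumes "polar f" "polar g" shows "polar (\<lambda>\<omega>. f \<omega> * g \<omega>)"
  using assms(1)
proof (induction rule: polar.induct)
  case (re p j)
  show ?case
    using assms(2)
  proof (induction rule: polar.induct)
    case (re q k)
    show ?case
      using polar_poly_mult[OF polar_mult_basic(1)[of j k], of "p * q"] by (simp add: mult_ac)
  next
    case (im q k)
    show ?case
      using polar_poly_mult[OF polar_mult_basic(2)[of j k], of "p * q"] by (simp add: mult_ac)
  next
    case (add f g)
    then show ?case by (auto simp: distrib_left intro: polar.add)
  next
    case (cong f g)
    then show ?case by (auto intro: polar.cong)
  qed
next
  case (im p j)
  show ?case
    using assms(2)
  proof (induction rule: polar.induct)
    case (re q k)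
    show ?case
      using polar_poly_mult[OF polar_mult_basic(2)[of k j], of "p * q"] by (simp add: mult_ac)
  next
    case (im q k)
    show ?case
      using polar_poly_mult[OF polar_mult_basic(3)[of j k], of "p * q"] by (simp add: mult_ac)
  next
    case (add f g)
    then show ?case by (auto simp: distrib_left intro: polar.add)
  next
    case (cong f g)
    then show ?case by (auto intro: polar.cong)
  qed
next
  case (add f g)
  then show ?case by (auto simp: distrib_right intro: polar.add)
next
  case (cong f g)
  then show ?case by (auto intro: polar.cong)
qed

lemma polar_real_polynomial_function: "real_polynomial_function f \<Longrightarrow> polar f"
proof (induction rule: real_polynomial_function.induct)
  case (linear f)
  interpret bounded_linear f by fact
  \<comment> \<open>The coordinates are the real part of z, the imaginary part of z, and a
    polynomial in \<omega>_3 times z^0.\<close>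
  have "polar (\<lambda>\<omega>. \<omega> $ i)" for i
    using polar.re[of 1 1] polar.im[of 1 1] polar.re[of "[:0, 1:]" 0] exhaust_3[of i] by auto
  then have "polar (\<lambda>\<omega>. f (axis 1 1) * \<omega> $ 1 + f (axis 2 1) * \<omega> $ 2 + f (axis 3 1) * \<omega> $ 3)"
    by (intro polar.add polar_scale)
  then show ?case
  proof (rule polar.cong)
    fix \<omega> :: vec3
    have "\<omega> = (\<omega> $ 1) *\<^sub>R axis 1 1 + (\<omega> $ 2) *\<^sub>R axis 2 1 + (\<omega> $ 3) *\<^sub>R axis 3 1"
      by (simp add: vec_eq_iff forall_3 axis_def)
    then have "f \<omega> = f ((\<omega> $ 1) *\<^sub>R axis 1 1 + (\<omega> $ 2) *\<^sub>R axis 2 1 + (\<omega> $ 3) *\<^sub>R axis 3 1)" by simp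
    then show "f \<omega> = f (axis 1 1) * \<omega> $ 1 + f (axis 2 1) * \<omega> $ 2 + f (axis 3 1) * \<omega> $ 3"
      by (simp add: add scale mult.commute)
  qed
next
  case (const c)
  show ?case using polar.re[of "[:c:]" 0] by simp
qed (auto intro: polar.add polar_mult)

section \<open>Spherical harmonics: completeness and projection error\<close>

lemma finite_PN_indices [simp]: "finite (PN_indices N)"
proof -
  have "PN_indices N \<subseteq> {..N} \<times> {- int N..int N}" by (auto simp: PN_indices_def)
  then show ?thesis by (rule finite_subset) auto
qed

lemma PN_indices_mono: "m \<le> n \<Longrightarrow> PN_indices m \<subseteq> PN_indices n"
  by (auto simp: PN_indices_def)

lemma sum_PN_indices: "(\<Sum>j\<in>PN_indices N. f j) = (\<Sum>l\<le>N. \<Sum>\<kappa>=-int l..int l. f (l, \<kappa>))"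
proof -
  have "PN_indices N = (SIGMA l:{..N}. {-int l..int l})" by (auto simp: PN_indices_def)
  then show ?thesis by (simp add: sum.Sigma)
qed

lemma continuous_PN_m: "continuous_on UNIV (PN_m j)"
  unfolding PN_m_def[abs_def] by (rule continuous_sph_harm)

lemma PN_m_in_L2: "in_L2 sphere_measure (PN_m j)"
  by (intro sphere_in_L2_continuous continuous_PN_m)

lemma PN_m_orthonormal:
  assumes "j \<in> PN_indices N" "k \<in> PN_indices N"
  shows "(\<integral>\<omega>. PN_m j \<omega> * PN_m k \<omega> \<partial>sphere_measure) = (if j = k then 1 else 0)"
  using assms sph_harm_orthonormal[of "snd j" "fst j" "snd k" "fst k"]
  by (auto simp: PN_m_def PN_indices_def prod_eq_iff)

definition PN_span :: "(vec3 \<Rightarrow> real) set" where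
  "PN_span = {w. \<exists>n c. w = (\<lambda>\<omega>. \<Sum>j\<in>PN_indices n. c j * PN_m j \<omega>)}"

lemma PN_spanI: "(\<lambda>\<omega>. \<Sum>j\<in>PN_indices n. c j * PN_m j \<omega>) \<in> PN_span"
  unfolding PN_span_def by blast

lemma PN_span_mono:
  assumes "n \<le> m"
  shows "(\<Sum>j\<in>PN_indices n. c j * PN_m j \<omega>) = (\<Sum>j\<in>PN_indices m. (if j \<in> PN_indices n then c j else 0) * PN_m j \<omega>)"
  using PN_indices_mono[OF assms] by (intro sum.mono_neutral_cong_left) auto

lemma PN_span_add:
  assumes "f \<in> PN_span" "g \<in> PN_span" shows "(\<lambda>x. f x + g x) \<in> PN_span"
proof -
  obtain n c m d where f: "f = (\<lambda>\<omega>. \<Sum>j\<in>PN_indices n. c j * PN_m j \<omega>)"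
    and g: "g = (\<lambda>\<omega>. \<Sum>j\<in>PN_indices m. d j * PN_m j \<omega>)"
    using assms by (auto simp: PN_span_def)
  let ?N = "max n m"
  have "(\<lambda>x. f x + g x) = (\<lambda>\<omega>. \<Sum>j\<in>PN_indices ?N.
      ((if j \<in> PN_indices n then c j else 0) + (if j \<in> PN_indices m then d j else 0)) * PN_m j \<omega>)"
    unfolding f g by (simp only: PN_span_mono[of n ?N] PN_span_mono[of m ?N] max.cobounded1 max.cobounded2 distrib_right sum.distrib)
  then show ?thesis by (simp only: PN_spanI)
qed

lemma PN_span_scale:
  assumes "f \<in> PN_span" shows "(\<lambda>x. a * f x) \<in> PN_span"
proof -
  obtain n c where "f = (\<lambda>\<omega>. \<Sum>j\<in>PN_indices n. c j * PN_m j \<omega>)"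
    using assms by (auto simp: PN_span_def)
  then have "(\<lambda>x. a * f x) = (\<lambda>\<omega>. \<Sum>j\<in>PN_indices n. (a * c j) * PN_m j \<omega>)"
    by (simp add: sum_distrib_left mult.assoc)
  then show ?thesis by (simp only: PN_spanI)
qed

lemma sph_harm_in_span:
  assumes "\<bar>\<kappa>\<bar> \<le> int l" shows "sph_harm l \<kappa> \<in> PN_span"
proof -
  have "(l, \<kappa>) \<in> PN_indices l" using assms by (simp add: PN_indices_def)
  then have "sph_harm l \<kappa> = (\<lambda>\<omega>. \<Sum>j\<in>PN_indices l. (if j = (l, \<kappa>) then 1 else 0) * PN_m j \<omega>)"
    by (intro ext, subst sum.mono_neutral_right[of _ "{(l, \<kappa>)}"]) (auto simp: PN_m_def)
  then show ?thesis by (simp only: PN_spanI)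
qed

lemma sph_norm_pos: "0 < sph_norm l k"
  by (auto simp: sph_norm_def intro!: divide_pos_pos mult_pos_pos add_nonneg_pos)

text \<open>The leading term is removed with \<open>sph_harm (k + d) \<kappa>\<close>, whose Legendre factor has degree exactly \<open>d\<close>.\<close>

lemma polar_basic_in_span:
  fixes \<kappa> :: int
  defines "k \<equiv> nat \<bar>\<kappa>\<bar>"
  shows "(\<And>i. i \<ge> d \<Longrightarrow> coeff p i = 0) \<Longrightarrow>
    (\<lambda>\<omega>. poly p (\<omega> $ 3) * (if \<kappa> \<ge> 0 then Re (Complex (\<omega> $ 1) (\<omega> $ 2) ^ k) else Im (Complex (\<omega> $ 1) (\<omega> $ 2) ^ k))) \<in> PN_span"
proof (induction d arbitrary: p)
  case 0
  then have "p = 0" by (intro poly_eqI) auto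
  then show ?case using PN_span_scale[OF sph_harm_in_span[of 0 0], of 0] by simp
next
  case (Suc d)
  let ?z = "\<lambda>\<omega>::vec3. if \<kappa> \<ge> 0 then Re (Complex (\<omega> $ 1) (\<omega> $ 2) ^ k) else Im (Complex (\<omega> $ 1) (\<omega> $ 2) ^ k)"
  define q where "q = assoc_leg (k + d) k"
  have deg: "degree q = d" by (simp add: q_def degree_assoc_leg)
  have qd: "coeff q d \<noteq> 0"
    using coeff_assoc_leg[of k "k + d"] coeff_legendre[of "k + d"] by (simp add: q_def)
  define c where "c = coeff p d / coeff q d"
  have "(\<lambda>\<omega>. poly (p - smult c q) (\<omega> $ 3) * ?z \<omega>) \<in> PN_span"
  proof (rule Suc.IH)
    fix i assume "d \<le> i"
    then consider "i = d" | "Suc d \<le> i" by linarith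
    then show "coeff (p - smult c q) i = 0"
      using Suc.prems[of i] qd coeff_eq_0[of q i] deg by cases (auto simp: c_def)
  qed
  moreover have "(\<lambda>\<omega>. c / sph_norm (k + d) k * sph_harm (k + d) \<kappa> \<omega>) \<in> PN_span"
    by (intro PN_span_scale sph_harm_in_span) (auto simp: k_def)
  ultimately have "(\<lambda>\<omega>. poly (p - smult c q) (\<omega> $ 3) * ?z \<omega> + c / sph_norm (k + d) k * sph_harm (k + d) \<kappa> \<omega>) \<in> PN_span"
    by (rule PN_span_add)
  moreover have "c / sph_norm (k + d) k * sph_harm (k + d) \<kappa> \<omega> = poly (smult c q) (\<omega> $ 3) * ?z \<omega>" for \<omega>
    using sph_norm_pos[of "k + d" k] by (simp add: sph_harm_eq q_def k_def)
  ultimately show ?case by (simp add: algebra_simps)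
qed

lemma polar_in_span: "polar f \<Longrightarrow> \<exists>v\<in>PN_span. \<forall>\<omega>\<in>sphere 0 1. f \<omega> = v \<omega>"
proof (induction rule: polar.induct)
  case (re p k)
  show ?case using polar_basic_in_span[of "Suc (degree p)" p "int k"] by (auto intro!: bexI simp: coeff_eq_0)
next
  case (im p k)
  show ?case
  proof (cases "k = 0")
    \<comment> \<open>For \<open>k = 0\<close> the index \<open>- int k\<close> is 0 and would
      select the real part; here the imaginary part of z^0 is zero anyway.\<close>
    case True
    then show ?thesis using PN_span_scale[OF sph_harm_in_span[of 0 0], of 0] by (auto intro!: bexI)
  next
    case False
    then show ?thesis using polar_basic_in_span[of "Suc (degree p)" p "- int k"] by (auto intro!: bexI simp: coeff_eq_0)
  qed
next
  case (add f g)
  then show ?case by (metis (no_types, lifting) PN_span_add)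
next
  case (cong f g)
  then show ?case by metis
qed

lemma PN_span_continuous: "v \<in> PN_span \<Longrightarrow> continuous_on UNIV v"
  by (auto simp: PN_span_def intro!: continuous_intros continuous_PN_m)

lemma PN_span_L2: "v \<in> PN_span \<Longrightarrow> in_L2 sphere_measure v"
  by (intro sphere_in_L2_continuous PN_span_continuous)

text \<open>Stone-Weierstrass on the compact sphere gives a uniformly close polynomial, which agrees
  on the sphere with an element of the span.\<close>

lemma continuous_in_closure:
  assumes g: "continuous_on UNIV g" shows "L2_closure sphere_measure PN_span g"
  unfolding L2_closure_def
proof (intro conjI allI impI)
  show gL: "in_L2 sphere_measure g" by (intro sphere_in_L2_continuous g)
  fix e :: real assume e: "e > 0"
  define m where "m = measure sphere_measure (space sphere_measure)"
  \<comment> \<open>The bound \<open>d \<le> 1\<close> allows the square of d to be replaced by d,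
    and \<open>m + 1\<close> keeps the divisor positive.\<close>
  define d where "d = min 1 (e / (m + 1))"
  have m: "m \<ge> 0" by (simp add: m_def)
  have d: "d > 0" "d \<le> 1" "d \<le> e / (m + 1)" using e m by (auto simp: d_def)
  obtain f where f: "real_polynomial_function f" "\<And>x. x \<in> sphere 0 1 \<Longrightarrow> \<bar>g x - f x\<bar> < d"
    using Stone_Weierstrass_real_polynomial_function[OF compact_sphere continuous_on_subset[OF g subset_UNIV] d(1), of 0 1] by metis
  obtain v where v: "v \<in> PN_span" "\<And>\<omega>. \<omega> \<in> sphere 0 1 \<Longrightarrow> f \<omega> = v \<omega>"
    using polar_in_span[OF polar_real_polynomial_function[OF f(1)]] by blast
  have "(\<integral>x. (g x - v x)\<^sup>2 \<partial>sphere_measure) \<le> (\<integral>x. d \<partial>sphere_measure)"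
  proof (rule integral_mono)
    show "integrable sphere_measure (\<lambda>x. (g x - v x)\<^sup>2)"
      by (intro L2_integrable_square in_L2_diff gL PN_span_L2 v)
    fix x assume x: "x \<in> space sphere_measure"
    have "\<bar>g x - v x\<bar> < d" using f(2)[of x] v(2)[of x] x by simp
    then have "(g x - v x)\<^sup>2 \<le> d * d"
      unfolding power2_eq_square abs_mult_self_eq[of "g x - v x", symmetric] by (intro mult_mono) auto
    also have "\<dots> \<le> d * 1" using d by (intro mult_left_mono) auto
    finally show "(g x - v x)\<^sup>2 \<le> d" by simp
  qed simp
  also have "\<dots> = m * d" by (simp add: m_def)
  also have "\<dots> \<le> m * (e / (m + 1))" using d m by (intro mult_left_mono) auto
  also have "\<dots> < e" using e m by (simp add: field_simps)
  finally show "\<exists>v\<in>PN_span. (\<integral>x. (g x - v x)\<^sup>2 \<partial>sphere_measure) < e" using v(1) by (rule bexI)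
qed

lemma L2_closure_trans:
  assumes V: "\<And>g. g \<in> V \<Longrightarrow> in_L2 M g" and W: "\<And>g. g \<in> W \<Longrightarrow> L2_closure M V g" and f: "L2_closure M W f"
  shows "L2_closure M V f"
proof -
  have "\<forall>n. \<exists>g\<in>W. (\<integral>x. (f x - g x)\<^sup>2 \<partial>M) < 1 / real (Suc n)"
    using f by (auto simp: L2_closure_def)
  then obtain F where F: "\<And>n. F n \<in> W" "\<And>n. (\<integral>x. (f x - F n x)\<^sup>2 \<partial>M) < 1 / real (Suc n)" by metis
  show ?thesis
  proof (rule L2_closure_limit[OF V])
    show "in_L2 M f" using f by (simp add: L2_closure_def)
    show "L2_closure M V (F n)" for n by (rule W[OF F(1)])
    show "(\<lambda>n. \<integral>x. (f x - F n x)\<^sup>2 \<partial>M) \<longlonglongrightarrow> 0"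
      by (rule tendsto_sandwich[OF _ _ tendsto_const LIMSEQ_inverse_real_of_nat])
         (auto intro!: always_eventually less_imp_le[OF F(2)[unfolded divide_inverse mult_1_left]] simp del: of_nat_Suc)
  qed
qed

lemma sphere_borel [simp]: "sphere (0 :: vec3) 1 \<in> sets borel"
  by (intro borel_closed closed_sphere)

theorem PN_span_dense:
  assumes "in_L2 sphere_measure f" shows "L2_closure sphere_measure PN_span f"
proof (rule L2_closure_trans[OF PN_span_L2 continuous_in_closure])
  let ?V = "{g :: vec3 \<Rightarrow> real. continuous_on UNIV g}"
  show "continuous_on UNIV g" if "g \<in> ?V" for g using that by simp
  have V: "in_L2 sphere_measure g" if "g \<in> ?V" for g using that by (simp add: sphere_in_L2_continuous)
  have zero: "L2_closure sphere_measure ?V (indicator {})"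
    unfolding L2_closure_def by (intro conjI allI impI bexI[of _ "\<lambda>_. 0"]) (auto simp: in_L2_def)
  have ind: "L2_closure sphere_measure ?V (indicator (box a b))" for a b
  proof (cases "box a b = {}")
    case True
    then show ?thesis using zero by simp
  next
    case False
    show ?thesis
      by (intro L2_closure_box_indicator finite_measure_sphere V False borel_measurable_sphere)
         (auto intro: Ck_measurable[OF Ck_box_bump] Ck_continuous[OF Ck_box_bump])
  qed
  show "L2_closure sphere_measure ?V f"
  proof (rule L2_closure_UNIV[where E="(\<inter>) (sphere 0 1) ` range (\<lambda>(a, b). box a (b :: vec3))"])
    show "L2_closure sphere_measure ?V (indicator A)" if A: "A \<in> (\<inter>) (sphere 0 1) ` range (\<lambda>(a, b). box a (b :: vec3))" for A
    proof -
      obtain a b :: vec3 where "A = sphere 0 1 \<inter> box a b" using A by auto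
      then show ?thesis
        by (intro L2_closure_cong[OF ind[of a b]]) (auto simp: indicator_def)
    qed
    have "L2_closure sphere_measure ?V (\<lambda>_. 1)"
      unfolding L2_closure_def
      by (intro conjI allI impI bexI[of _ "\<lambda>_. 1"] sphere_in_L2_continuous) auto
    then show "L2_closure sphere_measure ?V (indicator (space sphere_measure))"
      by (rule L2_closure_cong) auto
    show "finite_measure sphere_measure" by (rule finite_measure_sphere)
    show "Int_stable ((\<inter>) (sphere 0 1) ` range (\<lambda>(a, b). box a (b :: vec3)))" by (rule Int_stable_boxes)
    show "sets sphere_measure = sigma_sets (space sphere_measure) ((\<inter>) (sphere 0 1) ` range (\<lambda>(a, b). box a (b :: vec3)))"
      by (simp only: sets_sphere_measure space_sphere_measure sets_restrict_boxes[OF sphere_borel])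
    show "(\<inter>) (sphere 0 1) ` range (\<lambda>(a, b). box a (b :: vec3)) \<subseteq> Pow (space sphere_measure)" by auto
  qed (use assms V in \<open>auto intro!: continuous_intros\<close>)
qed

section \<open>Projection onto the harmonics, Bessel, Parseval and the projection error\<close>

definition PN_coeff :: "pn_index \<Rightarrow> (vec3 \<Rightarrow> real) \<Rightarrow> real" where
  "PN_coeff j w = (\<integral>\<omega>. PN_m j \<omega> * w \<omega> \<partial>sphere_measure)"

definition PN_proj :: "nat \<Rightarrow> (vec3 \<Rightarrow> real) \<Rightarrow> vec3 \<Rightarrow> real" where
  "PN_proj N w \<omega> = (\<Sum>j\<in>PN_indices N. PN_coeff j w * PN_m j \<omega>)"

text \<open>Pythagoras for arbitrary coefficients \<open>c\<close>, used in three ways: with the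
  coefficients of \<open>w\<close> it gives the projection error, with those of a close element of
  the span it gives Parseval, and with the solution of the reduced equations it splits the total
  error.\<close>

lemma integral_square_PN_combination:
  assumes w: "in_L2 sphere_measure w"
  shows "(\<integral>\<omega>. (w \<omega> - (\<Sum>j\<in>PN_indices N. c j * PN_m j \<omega>))\<^sup>2 \<partial>sphere_measure) =
    (\<integral>\<omega>. (w \<omega>)\<^sup>2 \<partial>sphere_measure) - (\<Sum>j\<in>PN_indices N. (PN_coeff j w)\<^sup>2)
      + (\<Sum>j\<in>PN_indices N. (c j - PN_coeff j w)\<^sup>2)"
proof -
  let ?I = "PN_indices N"
  have i1: "integrable sphere_measure (\<lambda>\<omega>. PN_m j \<omega> * w \<omega>)" for j
    by (intro integrable_L2_mult PN_m_in_L2 w)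
  have i2: "integrable sphere_measure (\<lambda>\<omega>. PN_m j \<omega> * PN_m k \<omega>)" for j k
    by (intro integrable_L2_mult PN_m_in_L2)
  have "(w \<omega> - (\<Sum>j\<in>?I. c j * PN_m j \<omega>))\<^sup>2 = (w \<omega>)\<^sup>2 - 2 * (\<Sum>j\<in>?I. c j * (PN_m j \<omega> * w \<omega>))
      + (\<Sum>j\<in>?I. \<Sum>k\<in>?I. (c j * c k) * (PN_m j \<omega> * PN_m k \<omega>))" for \<omega>
  proof -
    have "(\<Sum>j\<in>?I. c j * PN_m j \<omega>)\<^sup>2 = (\<Sum>j\<in>?I. \<Sum>k\<in>?I. (c j * c k) * (PN_m j \<omega> * PN_m k \<omega>))"
      unfolding power2_eq_square sum_product by (intro sum.cong refl) (simp add: mult_ac)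
    moreover have "w \<omega> * (\<Sum>j\<in>?I. c j * PN_m j \<omega>) = (\<Sum>j\<in>?I. c j * (PN_m j \<omega> * w \<omega>))"
      unfolding sum_distrib_left by (intro sum.cong refl) (simp add: mult_ac)
    ultimately show ?thesis by (simp add: power2_diff)
  qed
  then have "(\<integral>\<omega>. (w \<omega> - (\<Sum>j\<in>?I. c j * PN_m j \<omega>))\<^sup>2 \<partial>sphere_measure) =
     (\<integral>\<omega>. (w \<omega>)\<^sup>2 \<partial>sphere_measure) - 2 * (\<Sum>j\<in>?I. c j * PN_coeff j w)
      + (\<Sum>j\<in>?I. \<Sum>k\<in>?I. (c j * c k) * (\<integral>\<omega>. PN_m j \<omega> * PN_m k \<omega> \<partial>sphere_measure))"
    using i1 i2 L2_integrable_square[OF w] by (simp add: PN_coeff_def)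
  also have "(\<Sum>j\<in>?I. \<Sum>k\<in>?I. (c j * c k) * (\<integral>\<omega>. PN_m j \<omega> * PN_m k \<omega> \<partial>sphere_measure))
      = (\<Sum>j\<in>?I. \<Sum>k\<in>?I. if j = k then c j * c j else 0)"
    by (intro sum.cong refl) (simp add: PN_m_orthonormal)
  also have "\<dots> = (\<Sum>j\<in>?I. c j * c j)" by (simp add: sum.delta)
  also have "(\<integral>\<omega>. (w \<omega>)\<^sup>2 \<partial>sphere_measure) - 2 * (\<Sum>j\<in>?I. c j * PN_coeff j w) + (\<Sum>j\<in>?I. c j * c j)
     = (\<integral>\<omega>. (w \<omega>)\<^sup>2 \<partial>sphere_measure) - (\<Sum>j\<in>?I. (PN_coeff j w)\<^sup>2) + (\<Sum>j\<in>?I. (c j - PN_coeff j w)\<^sup>2)"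
  proof -
    have "(\<Sum>j\<in>?I. (c j - PN_coeff j w)\<^sup>2) = (\<Sum>j\<in>?I. c j * c j + (PN_coeff j w)\<^sup>2 - 2 * (c j * PN_coeff j w))"
      by (intro sum.cong refl) (simp add: power2_diff power2_eq_square[of "c _"])
    then show ?thesis by (simp add: sum.distrib sum_subtractf sum_distrib_left)
  qed
  finally show ?thesis .
qed

lemma integral_square_PN_proj:
  assumes "in_L2 sphere_measure w"
  shows "(\<integral>\<omega>. (w \<omega> - PN_proj N w \<omega>)\<^sup>2 \<partial>sphere_measure) =
    (\<integral>\<omega>. (w \<omega>)\<^sup>2 \<partial>sphere_measure) - (\<Sum>j\<in>PN_indices N. (PN_coeff j w)\<^sup>2)"
  using integral_square_PN_combination[OF assms, where N=N and c="\<lambda>j. PN_coeff j w"] by (simp add: PN_proj_def)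

lemma PN_bessel:
  assumes "in_L2 sphere_measure w"
  shows "(\<Sum>j\<in>PN_indices N. (PN_coeff j w)\<^sup>2) \<le> (\<integral>\<omega>. (w \<omega>)\<^sup>2 \<partial>sphere_measure)"
  using integral_square_PN_proj[OF assms, of N]
    Bochner_Integration.integral_nonneg[of sphere_measure "\<lambda>\<omega>. (w \<omega> - PN_proj N w \<omega>)\<^sup>2"] by simp

lemma PN_parseval:
  assumes w: "in_L2 sphere_measure w" and e: "e > 0"
  shows "\<exists>n. (\<integral>\<omega>. (w \<omega>)\<^sup>2 \<partial>sphere_measure) < (\<Sum>j\<in>PN_indices n. (PN_coeff j w)\<^sup>2) + e"
proof -
  obtain v where "v \<in> PN_span" and v: "(\<integral>\<omega>. (w \<omega> - v \<omega>)\<^sup>2 \<partial>sphere_measure) < e"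
    using PN_span_dense[OF w] e by (auto simp: L2_closure_def)
  then obtain n c where "v = (\<lambda>\<omega>. \<Sum>j\<in>PN_indices n. c j * PN_m j \<omega>)" by (auto simp: PN_span_def)
  then have "(\<integral>\<omega>. (w \<omega>)\<^sup>2 \<partial>sphere_measure) - (\<Sum>j\<in>PN_indices n. (PN_coeff j w)\<^sup>2)
      + (\<Sum>j\<in>PN_indices n. (c j - PN_coeff j w)\<^sup>2) < e"
    using v integral_square_PN_combination[OF w, where N=n and c=c] by simp
  moreover have "(\<Sum>j\<in>PN_indices n. (c j - PN_coeff j w)\<^sup>2) \<ge> 0" by (intro sum_nonneg) auto
  ultimately show ?thesis by (intro exI[of _ n]) linarith
qed

lemma PN_coeff_sph_coeff: "PN_coeff (l, \<kappa>) w = sph_coeff w l \<kappa>"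
  by (simp add: PN_coeff_def sph_coeff_def PN_m_def)

lemma Hq_term_nonneg: "0 \<le> Hq_term q w l"
  by (simp add: Hq_term_def sum_nonneg)

lemma Hq_norm_square: "summable (Hq_term q w) \<Longrightarrow> (Hq_norm q w)\<^sup>2 = (\<Sum>l. Hq_term q w l)"
  by (simp add: Hq_norm_def suminf_nonneg Hq_term_nonneg)

text \<open>For degrees l > N the Sobolev weight 1 + l(l + 1) is at least N^2, so each omitted mode
  is at most \<open>real N powr (- 2 * q)\<close> times its Sobolev term. Parseval reduces the error
  to finite tails up to an arbitrary e.\<close>

theorem PN_proj_error:
  assumes w: "in_Hq q w" and q: "q > 0" and N: "N \<ge> 1"
  shows "(\<integral>\<omega>. (w \<omega> - PN_proj N w \<omega>)\<^sup>2 \<partial>sphere_measure) \<le> real N powr (- 2 * q) * (Hq_norm q w)\<^sup>2"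
proof -
  have wL: "in_L2 sphere_measure w" and sm: "summable (Hq_term q w)" using w by (auto simp: in_Hq_def)
  define s where "s l = (\<Sum>\<kappa>=-int l..int l. (sph_coeff w l \<kappa>)\<^sup>2)" for l
  have s0: "s l \<ge> 0" for l by (simp add: s_def sum_nonneg)
  have partial: "(\<Sum>j\<in>PN_indices n. (PN_coeff j w)\<^sup>2) = (\<Sum>l\<le>n. s l)" for n
    by (simp add: sum_PN_indices s_def PN_coeff_sph_coeff)
  have mode: "s l \<le> real N powr (- 2 * q) * Hq_term q w l" if "N < l" for l
  proof -
    have "(real N)\<^sup>2 \<le> real l * (real l + 1)"
      unfolding power2_eq_square using that by (intro mult_mono) auto
    then have "((real N)\<^sup>2) powr q \<le> (1 + real l * (real l + 1)) powr q"
      using q by (intro powr_mono2) auto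
    moreover have "((real N)\<^sup>2) powr q = real N powr (2 * q)"
      using N by (simp add: powr_powr flip: powr_numeral)
    ultimately have "real N powr (2 * q) * s l \<le> Hq_term q w l"
      using s0[of l] by (simp add: Hq_term_def flip: s_def) (intro mult_right_mono, auto)
    then have "real N powr (- 2 * q) * (real N powr (2 * q) * s l) \<le> real N powr (- 2 * q) * Hq_term q w l"
      by (intro mult_left_mono) auto
    moreover have "real N powr (- 2 * q) * real N powr (2 * q) = 1"
      using N by (simp flip: powr_add)
    ultimately show ?thesis by (simp flip: mult.assoc)
  qed
  have tail: "(\<Sum>l\<le>n. s l) - (\<Sum>l\<le>N. s l) \<le> real N powr (- 2 * q) * (Hq_norm q w)\<^sup>2" for n
  proof -
    have "(\<Sum>l\<le>n. s l) \<le> (\<Sum>l\<le>N. s l) + (\<Sum>l\<in>{N<..n}. s l)"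
    proof -
      have "(\<Sum>l\<le>n. s l) \<le> (\<Sum>l\<in>{..N} \<union> {N<..n}. s l)" by (intro sum_mono2) (auto simp: s0)
      also have "\<dots> = (\<Sum>l\<le>N. s l) + (\<Sum>l\<in>{N<..n}. s l)" by (rule sum.union_disjoint) auto
      finally show ?thesis .
    qed
    also have "(\<Sum>l\<in>{N<..n}. s l) \<le> (\<Sum>l\<in>{N<..n}. real N powr (- 2 * q) * Hq_term q w l)"
      by (intro sum_mono mode) auto
    also have "\<dots> = real N powr (- 2 * q) * (\<Sum>l\<in>{N<..n}. Hq_term q w l)" by (simp add: sum_distrib_left)
    also have "\<dots> \<le> real N powr (- 2 * q) * (\<Sum>l. Hq_term q w l)"
      by (intro mult_left_mono sum_le_suminf sm) (auto simp: Hq_term_nonneg)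
    finally show ?thesis by (simp add: Hq_norm_square[OF sm])
  qed
  have "(\<integral>\<omega>. (w \<omega> - PN_proj N w \<omega>)\<^sup>2 \<partial>sphere_measure) \<le> real N powr (- 2 * q) * (Hq_norm q w)\<^sup>2 + e" if e: "e > 0" for e
  proof -
    obtain n where "(\<integral>\<omega>. (w \<omega>)\<^sup>2 \<partial>sphere_measure) < (\<Sum>j\<in>PN_indices n. (PN_coeff j w)\<^sup>2) + e"
      using PN_parseval[OF wL e] by blast
    then show ?thesis using tail[of n] unfolding integral_square_PN_proj[OF wL] partial by linarith
  qed
  then show ?thesis by (rule field_le_epsilon)
qed

lemma integral_square_le_Hq_norm:
  assumes w: "in_Hq q w" and q: "q > 0"
  shows "(\<integral>\<omega>. (w \<omega>)\<^sup>2 \<partial>sphere_measure) \<le> (Hq_norm q w)\<^sup>2"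
proof -
  have wL: "in_L2 sphere_measure w" and sm: "summable (Hq_term q w)" using w by (auto simp: in_Hq_def)
  have partial: "(\<Sum>j\<in>PN_indices n. (PN_coeff j w)\<^sup>2) \<le> (Hq_norm q w)\<^sup>2" for n
  proof -
    have "(\<Sum>j\<in>PN_indices n. (PN_coeff j w)\<^sup>2) = (\<Sum>l\<le>n. 1 * (\<Sum>\<kappa>=-int l..int l. (sph_coeff w l \<kappa>)\<^sup>2))"
      by (simp add: sum_PN_indices PN_coeff_sph_coeff)
    also have "\<dots> \<le> (\<Sum>l\<le>n. Hq_term q w l)"
      unfolding Hq_term_def using q by (intro sum_mono mult_right_mono ge_one_powr_ge_zero sum_nonneg) auto
    also have "\<dots> \<le> (\<Sum>l. Hq_term q w l)" by (intro sum_le_suminf sm) (auto simp: Hq_term_nonneg)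
    finally show ?thesis by (simp add: Hq_norm_square[OF sm])
  qed
  have "(\<integral>\<omega>. (w \<omega>)\<^sup>2 \<partial>sphere_measure) \<le> (Hq_norm q w)\<^sup>2 + e" if "e > 0" for e
    using PN_parseval[OF wL that] partial by (smt (verit))
  then show ?thesis by (rule field_le_epsilon)
qed

section \<open>Integrals of periodic functions\<close>

definition shift_vec :: "int ^ 3 \<Rightarrow> vec3" where
  "shift_vec k = (\<chi> i. real_of_int (k $ i))"

definition shifts :: "nat \<Rightarrow> (int ^ 3) set" where
  "shifts M = {k. \<forall>i. \<bar>k $ i\<bar> \<le> int M}"

lemma shift_vec_nth [simp]: "shift_vec k $ i = real_of_int (k $ i)"
  by (simp add: shift_vec_def)

lemma shift_vec_uminus: "shift_vec (- k) = - shift_vec k"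
  by (simp add: vec_eq_iff)

lemma finite_shifts [simp]: "finite (shifts M)"
proof (rule finite_subset)
  show "shifts M \<subseteq> (\<lambda>f. \<chi> i. f i) ` (UNIV \<rightarrow>\<^sub>E {- int M..int M})"
  proof
    fix k assume "k \<in> shifts M"
    then have "($) k \<in> UNIV \<rightarrow>\<^sub>E {- int M..int M}" by (auto simp: shifts_def abs_le_iff minus_le_iff)
    then show "k \<in> (\<lambda>f. \<chi> i. f i) ` (UNIV \<rightarrow>\<^sub>E {- int M..int M})" by (intro image_eqI[of _ _ "($) k"]) auto
  qed
qed (intro finite_imageI finite_PiE, auto)

lemma uminus_shifts: "bij_betw uminus (shifts M) (shifts M)"
  by (rule bij_betw_byWitness[where f'=uminus]) (auto simp: shifts_def)

lemma periodic_shift: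
  assumes per: "\<And>x i. F (x + axis i 1) = F x"
  shows "F (x + shift_vec k) = F x"
proof -
  have n: "F (x + real n *\<^sub>R axis i 1) = F x" for n i x
  proof (induction n)
    case (Suc n)
    have "x + real (Suc n) *\<^sub>R axis i 1 = (x + real n *\<^sub>R axis i 1) + axis i 1" by (simp add: algebra_simps)
    then show ?case using per[of "x + real n *\<^sub>R axis i 1" i] Suc by (simp only:)
  qed simp
  have z: "F (x + real_of_int m *\<^sub>R axis i 1) = F x" for m i x
  proof (cases "m \<ge> 0")
    case True
    then show ?thesis using n[of x "nat m" i] by simp
  next
    case False
    then show ?thesis using n[of "x + real_of_int m *\<^sub>R axis i 1" "nat (- m)" i] by simp
  qed
  have "shift_vec k = real_of_int (k $ 1) *\<^sub>R axis 1 1 + real_of_int (k $ 2) *\<^sub>R axis 2 1 + real_of_int (k $ 3) *\<^sub>R axis 3 1"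
    by (simp add: vec_eq_iff forall_3 axis_def)
  then show ?thesis by (simp add: z add.assoc[symmetric])
qed

lemma AE_off_grid: "AE x in lborel. \<forall>i. (x :: vec3) $ i \<notin> \<int>"
proof -
  have "AE x in lborel. (x :: vec3) $ i \<noteq> c" for i c
  proof -
    have "{x :: vec3. x $ i = c} \<in> null_sets lebesgue"
      using negligible_standard_hyperplane[of "axis i 1 :: vec3" c]
      by (simp add: inner_axis negligible_iff_null_sets)
    moreover have "{x :: vec3. x $ i = c} \<in> sets lborel"
      unfolding sets_lborel by (intro borel_closed closed_Collect_eq continuous_intros)
    ultimately have "{x :: vec3. x $ i = c} \<in> null_sets lborel"
      by (simp add: null_sets_completion_iff)
    then show ?thesis by (auto dest: AE_not_in)
  qed
  then have "AE x in lborel. \<forall>i. \<forall>m::int. (x :: vec3) $ i \<noteq> of_int m"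
    by (simp add: AE_all_countable)
  then show ?thesis by eventually_elim (auto elim: Ints_cases)
qed

definition in_cell :: "int ^ 3 \<Rightarrow> vec3 \<Rightarrow> bool" where
  "in_cell k x \<longleftrightarrow> x - shift_vec k \<in> unit_cube"

lemma in_cell_iff: "in_cell k x \<longleftrightarrow> (\<forall>i. real_of_int (k $ i) < x $ i \<and> x $ i < real_of_int (k $ i) + 1)"
  by (auto simp: in_cell_def unit_cube_def algebra_simps)

lemma cell_unique: "(\<forall>i. x $ i \<notin> \<int>) \<Longrightarrow> in_cell k x \<longleftrightarrow> k = (\<chi> i. \<lfloor>x $ i\<rfloor>)"
proof
  assume "in_cell k x"
  then have "\<lfloor>x $ i\<rfloor> = k $ i" for i unfolding in_cell_iff by (intro floor_unique) (auto simp: less_imp_le)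
  then show "k = (\<chi> i. \<lfloor>x $ i\<rfloor>)" by (simp add: vec_eq_iff)
next
  assume x: "\<forall>i. x $ i \<notin> \<int>" and k: "k = (\<chi> i. \<lfloor>x $ i\<rfloor>)"
  have "real_of_int \<lfloor>x $ i\<rfloor> \<noteq> x $ i" for i using x by (metis Ints_of_int)
  then have "real_of_int \<lfloor>x $ i\<rfloor> < x $ i" for i using of_int_floor_le[of "x $ i"] by (metis less_le)
  then show "in_cell k x" unfolding in_cell_iff k by auto
qed

text \<open>Almost every point lies in exactly one open integer cell, so the integral over the space
  is a sum over translated cubes. The support condition makes that sum finite.\<close>

lemma tiling:
  fixes f :: "vec3 \<Rightarrow> real"
  assumes f: "f \<in> borel_measurable borel"
    and supp: "\<And>x k. x \<in> unit_cube \<Longrightarrow> k \<notin> shifts M \<Longrightarrow> f (x + shift_vec k) = 0"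
    and int: "\<And>k. k \<in> shifts M \<Longrightarrow> integrable cube_measure (\<lambda>x. f (x + shift_vec k))"
  shows "integrable lborel f"
    "(\<integral>x. f x \<partial>lborel) = (\<integral>x. (\<Sum>k\<in>shifts M. f (x + shift_vec k)) \<partial>cube_measure)"
proof -
  let ?g = "\<lambda>k x. indicator unit_cube (x - shift_vec k) * f x"
  have shift: "integrable lborel (?g k) \<and> (\<integral>x. ?g k x \<partial>lborel) = (\<integral>x. f (x + shift_vec k) \<partial>cube_measure)"
    if "k \<in> shifts M" for k
  proof -
    have i: "integrable lborel (\<lambda>x. indicator unit_cube x * f (x + shift_vec k))"
      using int[OF that] by (simp add: integrable_restrict_space)
    have d: "distr lborel borel (\<lambda>x. - shift_vec k + x) = lborel" by (rule lborel_distr_plus)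
    have "integrable (distr lborel borel (\<lambda>x. - shift_vec k + x)) (\<lambda>x. indicator unit_cube x * f (x + shift_vec k))"
      unfolding d by (rule i)
    then have "integrable lborel (\<lambda>x. indicator unit_cube (- shift_vec k + x) * f (- shift_vec k + x + shift_vec k))"
      by (subst (asm) integrable_distr_eq) (use f in measurable)
    then have 1: "integrable lborel (?g k)" by simp
    have "(\<integral>x. indicator unit_cube x * f (x + shift_vec k) \<partial>lborel)
       = (\<integral>x. indicator unit_cube x * f (x + shift_vec k) \<partial>distr lborel borel (\<lambda>x. - shift_vec k + x))"
      unfolding d ..
    also have "\<dots> = (\<integral>x. indicator unit_cube (- shift_vec k + x) * f (- shift_vec k + x + shift_vec k) \<partial>lborel)"
      by (rule integral_distr) (use f in measurable)
    finally have "(\<integral>x. indicator unit_cube x * f (x + shift_vec k) \<partial>lborel) = (\<integral>x. ?g k x \<partial>lborel)"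
      by simp
    then show ?thesis using 1 by (simp add: integral_restrict_space)
  qed
  have ae: "AE x in lborel. f x = (\<Sum>k\<in>shifts M. ?g k x)"
    using AE_off_grid
  proof eventually_elim
    case (elim x)
    define m :: "int ^ 3" where "m = (\<chi> i. \<lfloor>x $ i\<rfloor>)"
    have "?g k x = (if k = m then f x else 0)" for k
      using cell_unique[OF elim, of k] by (auto simp: in_cell_def m_def indicator_def)
    then have "(\<Sum>k\<in>shifts M. ?g k x) = (if m \<in> shifts M then f x else 0)" by (simp add: sum.delta)
    moreover have "f x = 0" if "m \<notin> shifts M"
      using supp[of "x - shift_vec m" m] cell_unique[OF elim, of m] that by (simp add: in_cell_def m_def)
    ultimately show ?case by simp
  qed
  have sum: "integrable lborel (\<lambda>x. \<Sum>k\<in>shifts M. ?g k x)"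
    using shift by (intro Bochner_Integration.integrable_sum) auto
  show "integrable lborel f"
    by (rule integrable_cong_AE_imp[OF sum]) (use f ae in auto)
  have "(\<integral>x. f x \<partial>lborel) = (\<integral>x. (\<Sum>k\<in>shifts M. ?g k x) \<partial>lborel)"
    by (rule integral_cong_AE) (use f ae sum in auto)
  also have "\<dots> = (\<Sum>k\<in>shifts M. \<integral>x. ?g k x \<partial>lborel)"
    using shift by (intro Bochner_Integration.integral_sum) auto
  also have "\<dots> = (\<Sum>k\<in>shifts M. \<integral>x. f (x + shift_vec k) \<partial>cube_measure)" using shift by simp
  also have "\<dots> = (\<integral>x. (\<Sum>k\<in>shifts M. f (x + shift_vec k)) \<partial>cube_measure)"
    using int by (intro Bochner_Integration.integral_sum[symmetric]) auto
  finally show "(\<integral>x. f x \<partial>lborel) = (\<integral>x. (\<Sum>k\<in>shifts M. f (x + shift_vec k)) \<partial>cube_measure)" .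
qed

definition periodized :: "nat \<Rightarrow> (vec3 \<Rightarrow> real) \<Rightarrow> vec3 \<Rightarrow> real" where
  "periodized M \<phi> x = (\<Sum>k\<in>shifts M. \<phi> (x + shift_vec k))"

text \<open>\<open>covers M \<phi>\<close>: on the cube, \<open>periodized M \<phi>\<close> is the full lattice sum.\<close>

definition covers :: "nat \<Rightarrow> (vec3 \<Rightarrow> real) \<Rightarrow> bool" where
  "covers M \<phi> \<longleftrightarrow> (\<forall>x\<in>unit_cube. \<forall>k. k \<notin> shifts M \<longrightarrow> \<phi> (x + shift_vec k) = 0)"

lemma covers_if_bounded:
  assumes "\<And>x. \<phi> x \<noteq> 0 \<Longrightarrow> \<forall>i. \<bar>x $ i\<bar> < real M" shows "covers M \<phi>"
  unfolding covers_def
proof (intro ballI allI impI)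
  fix x k assume x: "x \<in> unit_cube" and k: "k \<notin> shifts M"
  then obtain i where "\<bar>k $ i\<bar> > int M" by (auto simp: shifts_def not_le)
  \<comment> \<open>A shift of at most -(M + 1) moves a coordinate below 1 strictly below -M;
    positive shifts have room to spare.\<close>
  then have "real_of_int (k $ i) \<ge> real M + 1 \<or> real_of_int (k $ i) \<le> - real M - 1" by linarith
  moreover have "0 < x $ i" "x $ i < 1" using x by (auto simp: unit_cube_def)
  ultimately have "\<not> \<bar>(x + shift_vec k) $ i\<bar> < real M" by (simp, linarith)
  then show "\<phi> (x + shift_vec k) = 0" using assms[of "x + shift_vec k"] by blast
qed

lemma Ck_periodized: "Ck n \<phi> \<Longrightarrow> Ck n (periodized M \<phi>)"
  unfolding periodized_def[abs_def] by (intro Ck_sum Ck_translate)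

lemma pd_periodized: "Ck (Suc 0) \<phi> \<Longrightarrow> pd (periodized M \<phi>) i x = periodized M (pd \<phi> i) x"
  unfolding periodized_def[abs_def]
  by (subst pd_sum) (auto intro: Ck_translate simp: pd_translate simp del: Ck.simps)

lemma continuous_bounded_on_cube:
  assumes "continuous_on UNIV \<phi>" obtains B where "\<And>x. x \<in> unit_cube \<Longrightarrow> \<bar>\<phi> x\<bar> \<le> (B :: real)"
proof -
  have "compact (\<phi> ` cbox (0 :: vec3) 1)"
    using assms by (intro compact_continuous_image) (auto intro: continuous_on_subset)
  then obtain B where "\<And>x. x \<in> cbox 0 1 \<Longrightarrow> \<bar>\<phi> x\<bar> \<le> B"
    using compact_imp_bounded bounded_iff by (metis imageI real_norm_def)
  then show ?thesis using that unit_cube_eq_box box_subset_cbox by blast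
qed

lemma integrable_cube_mult_continuous:
  assumes F: "integrable cube_measure F" and \<phi>: "continuous_on UNIV \<phi>"
  shows "integrable cube_measure (\<lambda>x. F x * \<phi> x :: real)"
proof -
  obtain B where B: "\<And>x. x \<in> unit_cube \<Longrightarrow> \<bar>\<phi> x\<bar> \<le> B" using continuous_bounded_on_cube[OF \<phi>] by blast
  have [measurable]: "\<phi> \<in> borel_measurable cube_measure"
    by (intro borel_measurable_cube borel_measurable_continuous_onI \<phi>)
  have "integrable cube_measure (\<lambda>x. B * F x)" using F by simp
  then show ?thesis
  proof (rule Bochner_Integration.integrable_bound)
    show "AE x in cube_measure. norm (F x * \<phi> x) \<le> norm (B * F x)"
    proof (rule AE_I2)
      fix x assume "x \<in> space cube_measure"
      then have "\<bar>\<phi> x\<bar> \<le> \<bar>B\<bar>" using B[of x] by fastforce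
      then show "norm (F x * \<phi> x) \<le> norm (B * F x)" unfolding real_norm_def abs_mult by (metis abs_ge_zero mult.commute mult_right_mono)
    qed
  qed (use F in measurable)
qed

text \<open>The bridge between the two settings: weak derivatives are stated on the whole space with
  compactly supported test functions, while norms and energies live on the cube.\<close>

theorem periodic_integral:
  assumes F: "F \<in> borel_measurable borel" "\<And>x i. F (x + axis i 1) = F x" "integrable cube_measure F"
    and \<phi>: "continuous_on UNIV \<phi>" "covers M \<phi>"
  shows "integrable lborel (\<lambda>x. F x * \<phi> x)"
    "(\<integral>x. F x * \<phi> x \<partial>lborel) = (\<integral>x. F x * periodized M \<phi> x \<partial>cube_measure)"
proof -
  have per: "F (x + shift_vec k) = F x" for x k by (rule periodic_shift[OF F(2)])
  have tr: "continuous_on UNIV (\<lambda>x. \<phi> (x + shift_vec k))" for k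
    using Ck_translate[of 0 \<phi>] \<phi>(1) by simp
  have [measurable]: "\<phi> \<in> borel_measurable borel" by (intro borel_measurable_continuous_onI \<phi>)
  note [measurable] = F(1)
  have 1: "(\<lambda>x. F x * \<phi> x) \<in> borel_measurable borel" by measurable
  have 2: "F (x + shift_vec k) * \<phi> (x + shift_vec k) = 0" if "x \<in> unit_cube" "k \<notin> shifts M" for x k
    using \<phi>(2) that by (simp add: covers_def)
  have 3: "integrable cube_measure (\<lambda>x. F (x + shift_vec k) * \<phi> (x + shift_vec k))" for k
    unfolding per by (intro integrable_cube_mult_continuous F tr)
  note t = tiling[where f="\<lambda>x. F x * \<phi> x", OF 1 2 3]
  show "integrable lborel (\<lambda>x. F x * \<phi> x)" by (rule t(1))
  show "(\<integral>x. F x * \<phi> x \<partial>lborel) = (\<integral>x. F x * periodized M \<phi> x \<partial>cube_measure)"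
    using t(2) by (simp add: per periodized_def sum_distrib_left)
qed

section \<open>The energy identity on the torus\<close>

text \<open>\<open>torus_div V g\<close> says that \<open>g\<close> is the divergence of \<open>V\<close> on the torus; smooth functions on the torus
  are obtained by periodizing test functions.\<close>

definition torus_div :: "(3 \<Rightarrow> vec3 \<Rightarrow> real) \<Rightarrow> (vec3 \<Rightarrow> real) \<Rightarrow> bool" where
  "torus_div V g \<longleftrightarrow> (\<forall>\<phi> M. test_function UNIV \<phi> \<longrightarrow> covers M \<phi> \<longrightarrow> (\<forall>i. covers M (pd \<phi> i)) \<longrightarrow>
     (\<integral>x. (\<Sum>i\<in>UNIV. V i x * pd (periodized M \<phi>) i x) \<partial>cube_measure) =
       - (\<integral>x. g x * periodized M \<phi> x \<partial>cube_measure))"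

interpretation cube: finite_measure cube_measure by (rule finite_measure_cube)

interpretation cube_pair: pair_sigma_finite cube_measure cube_measure ..

section \<open>An even periodic mollifier\<close>

definition ball_bump :: "real \<Rightarrow> vec3 \<Rightarrow> real" where
  "ball_bump d z = flat 0 (d\<^sup>2 - z \<bullet> z)"

text \<open>This is the derivative of \<open>ball_bump d (y - x)\<close> in \<open>x\<close>,
  evaluated at \<open>z = y - x\<close>. It has no minus sign because those of \<open>y - x\<close>
  and of \<open>d\<^sup>2 - z \<bullet> z\<close> cancel. It is odd in \<open>z\<close>.\<close>

definition ball_bump_deriv :: "real \<Rightarrow> 3 \<Rightarrow> vec3 \<Rightarrow> real" where
  "ball_bump_deriv d i z = 2 * z $ i * flat 2 (d\<^sup>2 - z \<bullet> z)"

text \<open>The shift range 2 is enough: for \<open>y\<close> in the cube and \<open>d < 1\<close>,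
  the bump centred at \<open>y\<close> is supported where all |x_i| < 2.\<close>

definition bump_kernel :: "real \<Rightarrow> vec3 \<Rightarrow> vec3 \<Rightarrow> real" where
  "bump_kernel d y = periodized 2 (\<lambda>x. ball_bump d (y - x))"

definition kernel_deriv :: "real \<Rightarrow> 3 \<Rightarrow> vec3 \<Rightarrow> vec3 \<Rightarrow> real" where
  "kernel_deriv d i y = periodized 2 (\<lambda>x. ball_bump_deriv d i (y - x))"

lemma ball_bump_nonzero: "d > 0 \<Longrightarrow> ball_bump d z \<noteq> 0 \<longleftrightarrow> norm z < d"
proof -
  assume d: "d > 0"
  have "ball_bump d z \<noteq> 0 \<longleftrightarrow> z \<bullet> z < d\<^sup>2"
    unfolding ball_bump_def using flat_pos[of "d\<^sup>2 - z \<bullet> z" 0] flat_zero[of "d\<^sup>2 - z \<bullet> z" 0] by force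
  also have "\<dots> \<longleftrightarrow> norm z < d"
    unfolding power2_norm_eq_inner[symmetric]
    using d power_less_imp_less_base[of "norm z" 2 d] power_strict_mono[of "norm z" d 2] by auto
  finally show ?thesis .
qed

lemma ball_bump_nonneg: "0 \<le> ball_bump d z"
  by (simp add: ball_bump_def flat_nonneg)

lemma inner_vec3: "x \<bullet> y = (\<Sum>i\<in>UNIV. x $ i * (y :: vec3) $ i)"
  by (simp add: inner_vec_def)

lemma Ck_inner_diff: "Ck n (\<lambda>x. d\<^sup>2 - (y - x) \<bullet> (y - x))"
  unfolding inner_vec3 vector_minus_component
  by (intro Ck_diff Ck_const Ck_sum Ck_mult Ck_nth)

lemma Ck_ball_bump: "Ck n (\<lambda>x. ball_bump d (y - x))"
  unfolding ball_bump_def by (intro Ck_flat Ck_inner_diff)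

lemma pd_ball_bump: "pd (\<lambda>x. ball_bump d (y - x)) i = (\<lambda>x. ball_bump_deriv d i (y - x))"
proof
  fix x
  have "((\<lambda>x. d\<^sup>2 - (y - x) \<bullet> (y - x)) has_derivative (\<lambda>h. 2 * ((y - x) \<bullet> h))) (at x)"
    by (auto intro!: derivative_eq_intros simp: inner_commute)
  then have "pd (\<lambda>x. d\<^sup>2 - (y - x) \<bullet> (y - x)) i x = 2 * (y - x) $ i"
    by (simp add: pd_eq inner_axis)
  then show "pd (\<lambda>x. ball_bump d (y - x)) i x = ball_bump_deriv d i (y - x)"
    unfolding ball_bump_def ball_bump_deriv_def by (subst pd_flat[OF Ck_inner_diff]) simp
qed

lemma ball_bump_deriv_zero:
  assumes "d > 0" "norm z \<ge> d" shows "ball_bump_deriv d i z = 0"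
proof -
  have "d\<^sup>2 \<le> z \<bullet> z" using assms by (simp add: power2_norm_eq_inner[symmetric] power_mono)
  then show ?thesis by (simp add: ball_bump_deriv_def flat_zero)
qed

text \<open>The constant is 2 * 1 * 24, from |z_i| at most 1 and \<open>flat 2\<close> at most
  \<open>fact 4\<close> by \<open>flat_le_square\<close>. The bound serves integrability on the
  product of the cube with itself.\<close>

lemma ball_bump_deriv_bound:
  assumes "0 < d" "d < 1" shows "\<bar>ball_bump_deriv d i z\<bar> \<le> 48"
proof (cases "norm z < d")
  case True
  have "z \<bullet> z \<le> d\<^sup>2" unfolding power2_norm_eq_inner[symmetric] using True assms by (intro power_mono) auto
  moreover have "d\<^sup>2 \<le> 1" using assms by (simp add: power_le_one)
  ultimately have "(d\<^sup>2 - z \<bullet> z)\<^sup>2 \<le> 1" using inner_ge_zero[of z] by (intro power_le_one) linarith+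
  then have "flat 2 (d\<^sup>2 - z \<bullet> z) \<le> 24" using flat_le_square[of 2 "d\<^sup>2 - z \<bullet> z"] by (simp add: fact_numeral)
  moreover have "\<bar>z $ i\<bar> \<le> 1" using component_le_norm_cart[of z i] True assms by linarith
  ultimately have "\<bar>z $ i\<bar> * flat 2 (d\<^sup>2 - z \<bullet> z) \<le> 1 * 24" by (intro mult_mono) (auto simp: flat_nonneg)
  then show ?thesis by (simp add: ball_bump_deriv_def abs_mult flat_nonneg)
next
  case False
  then show ?thesis using ball_bump_deriv_zero[OF assms(1)] by simp
qed

lemma continuous_flat: "continuous_on UNIV (flat m)"
  using flat_deriv by (auto intro: DERIV_continuous simp: continuous_on_eq_continuous_at)

lemma ball_bump_borel [measurable]: "ball_bump d \<in> borel_measurable borel"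
  unfolding ball_bump_def[abs_def]
  by (intro borel_measurable_continuous_onI continuous_on_compose2[OF continuous_flat] continuous_intros) auto

lemma ball_bump_deriv_borel [measurable]: "ball_bump_deriv d i \<in> borel_measurable borel"
  unfolding ball_bump_deriv_def[abs_def]
  by (intro borel_measurable_continuous_onI continuous_intros continuous_on_compose2[OF continuous_flat]) auto

lemma sum_shifts_uminus: "(\<Sum>k\<in>shifts M. f (- k)) = (\<Sum>k\<in>shifts M. f k)"
  using sum.reindex_bij_betw[OF uminus_shifts, of f M] by simp

text \<open>The shift range is symmetric, so replacing \<open>k\<close> by \<open>- k\<close> moves
  the lattice shift from one argument to the other; evenness of the bump does the rest.\<close>

lemma kernel_sym: "bump_kernel d x y = bump_kernel d y x"
proof -
  have "bump_kernel d x y = (\<Sum>k\<in>shifts 2. ball_bump d (x - (y + shift_vec (- k))))"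
    unfolding bump_kernel_def periodized_def by (rule sum_shifts_uminus[symmetric])
  also have "\<dots> = bump_kernel d y x"
    unfolding bump_kernel_def periodized_def
  proof (intro sum.cong refl)
    fix k
    have "x - (y + shift_vec (- k)) = - (y - (x + shift_vec k))" by (simp add: shift_vec_uminus)
    then show "ball_bump d (x - (y + shift_vec (- k))) = ball_bump d (y - (x + shift_vec k))"
      by (simp only: ball_bump_def inner_minus_left inner_minus_right minus_minus)
  qed
  finally show ?thesis .
qed

lemma kernel_deriv_antisym: "kernel_deriv d i x y = - kernel_deriv d i y x"
proof -
  have "kernel_deriv d i x y = (\<Sum>k\<in>shifts 2. ball_bump_deriv d i (x - (y + shift_vec (- k))))"
    unfolding kernel_deriv_def periodized_def by (rule sum_shifts_uminus[symmetric])
  also have "\<dots> = (\<Sum>k\<in>shifts 2. - ball_bump_deriv d i (y - (x + shift_vec k)))"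
  proof (intro sum.cong refl)
    fix k
    have "x - (y + shift_vec (- k)) = - (y - (x + shift_vec k))" by (simp add: shift_vec_uminus)
    then show "ball_bump_deriv d i (x - (y + shift_vec (- k))) = - ball_bump_deriv d i (y - (x + shift_vec k))"
      by (simp only: ball_bump_deriv_def inner_minus_left inner_minus_right minus_minus vector_uminus_component, simp?)
  qed
  also have "\<dots> = - kernel_deriv d i y x" by (simp add: kernel_deriv_def periodized_def sum_negf)
  finally show ?thesis .
qed

lemma kernel_nonneg: "0 \<le> bump_kernel d y x"
  by (simp add: bump_kernel_def periodized_def sum_nonneg ball_bump_nonneg)

lemma kernel_bound: "\<bar>bump_kernel d y x\<bar> \<le> real (card (shifts 2))"
proof -
  have "bump_kernel d y x \<le> (\<Sum>k\<in>shifts 2. 1)"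
    unfolding bump_kernel_def periodized_def by (intro sum_mono) (simp add: ball_bump_def flat_0_le_1)
  then show ?thesis by (simp add: kernel_nonneg)
qed

lemma kernel_deriv_bound: "0 < d \<Longrightarrow> d < 1 \<Longrightarrow> \<bar>kernel_deriv d i y x\<bar> \<le> 48 * real (card (shifts 2))"
proof -
  assume d: "0 < d" "d < 1"
  have "\<bar>kernel_deriv d i y x\<bar> \<le> (\<Sum>k\<in>shifts 2. \<bar>ball_bump_deriv d i (y - (x + shift_vec k))\<bar>)"
    unfolding kernel_deriv_def periodized_def by (rule sum_abs)
  also have "\<dots> \<le> (\<Sum>k\<in>shifts 2. 48)" by (intro sum_mono ball_bump_deriv_bound d)
  finally show ?thesis by simp
qed

lemma cube_id_borel: "(\<lambda>x. x) \<in> measurable cube_measure borel"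
  by (intro borel_measurable_cube) simp

lemma cube_pair_borel [measurable]:
  "fst \<in> measurable (cube_measure \<Otimes>\<^sub>M cube_measure) borel" "snd \<in> measurable (cube_measure \<Otimes>\<^sub>M cube_measure) borel"
  using measurable_compose[OF measurable_fst cube_id_borel] measurable_compose[OF measurable_snd cube_id_borel]
  by (auto simp: comp_def)

lemma kernel_measurable: "(\<lambda>p. bump_kernel d (fst p) (snd p)) \<in> borel_measurable (cube_measure \<Otimes>\<^sub>M cube_measure)"
  unfolding bump_kernel_def periodized_def by measurable

lemma kernel_deriv_measurable:
  "(\<lambda>p. kernel_deriv d i (fst p) (snd p)) \<in> borel_measurable (cube_measure \<Otimes>\<^sub>M cube_measure)"
  unfolding kernel_deriv_def periodized_def by measurable

lemma integrable_kernel_product: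
  fixes a b :: "vec3 \<Rightarrow> real"
  assumes a: "integrable cube_measure a" and b: "integrable cube_measure b"
    and K: "(\<lambda>p. K (fst p) (snd p)) \<in> borel_measurable (cube_measure \<Otimes>\<^sub>M cube_measure)" "\<And>y x. \<bar>K y x\<bar> \<le> C"
  shows "integrable (cube_measure \<Otimes>\<^sub>M cube_measure) (\<lambda>p. a (fst p) * b (snd p) * K (fst p) (snd p))"
proof -
  note [measurable] = borel_measurable_integrable[OF a] borel_measurable_integrable[OF b]
  have "integrable (cube_measure \<Otimes>\<^sub>M cube_measure) (\<lambda>p. C * (a (fst p) * b (snd p)))"
  proof (rule cube_pair.Fubini_integrable)
    show "integrable cube_measure (\<lambda>x. \<integral>y. norm (C * (a (fst (x, y)) * b (snd (x, y)))) \<partial>cube_measure)"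
      using a by (simp add: abs_mult)
  qed (use b in auto)
  then show ?thesis
  proof (rule Bochner_Integration.integrable_bound)
    show "AE p in cube_measure \<Otimes>\<^sub>M cube_measure. norm (a (fst p) * b (snd p) * K (fst p) (snd p)) \<le> norm (C * (a (fst p) * b (snd p)))"
    proof (rule AE_I2)
      fix p
      have "\<bar>K (fst p) (snd p)\<bar> \<le> \<bar>C\<bar>" using K(2)[of "fst p" "snd p"] by linarith
      then show "norm (a (fst p) * b (snd p) * K (fst p) (snd p)) \<le> norm (C * (a (fst p) * b (snd p)))"
        unfolding real_norm_def abs_mult by (metis abs_ge_zero abs_mult mult.commute mult_right_mono)
    qed
  qed (use K in measurable)
qed

lemma kernel_test_function:
  assumes y: "y \<in> unit_cube" and d: "0 < d" "d < 1"
  shows "test_function UNIV (\<lambda>x. ball_bump d (y - x))" "covers 2 (\<lambda>x. ball_bump d (y - x))"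
    "covers 2 (pd (\<lambda>x. ball_bump d (y - x)) i)"
proof -
  have near: "\<forall>i. \<bar>x $ i\<bar> < real 2" if "norm (y - x) < d" for x
  proof
    fix i
    have "\<bar>(y - x) $ i\<bar> < 1" using component_le_norm_cart[of "y - x" i] that d by linarith
    moreover have "0 < y $ i" "y $ i < 1" using y by (auto simp: unit_cube_def)
    ultimately show "\<bar>x $ i\<bar> < real 2" by simp
  qed
  show "test_function UNIV (\<lambda>x. ball_bump d (y - x))"
    unfolding test_function_def
  proof (intro conjI allI Ck_ball_bump exI[of _ "cball y d"] impI)
    fix x assume "x \<notin> cball y d"
    then show "ball_bump d (y - x) = 0" using ball_bump_nonzero[OF d(1), of "y - x"] by (simp add: dist_norm)
  qed auto
  show "covers 2 (\<lambda>x. ball_bump d (y - x))"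
    using near ball_bump_nonzero[OF d(1)] by (intro covers_if_bounded) blast
  show "covers 2 (pd (\<lambda>x. ball_bump d (y - x)) i)"
    unfolding pd_ball_bump using near ball_bump_deriv_zero[OF d(1)] by (intro covers_if_bounded) (meson not_le)
qed

text \<open>The kernel is even, so its derivative is odd; with \<open>B\<close> symmetric the double integral changes sign when
  \<open>x\<close> and \<open>y\<close> are exchanged.\<close>

lemma kernel_energy_zero:
  assumes J: "finite J" and e: "\<And>j. j \<in> J \<Longrightarrow> in_L2 cube_measure (e j)" and H: "\<And>j. j \<in> J \<Longrightarrow> in_L2 cube_measure (H j)"
    and B: "\<And>i j k. B i j k = B i k j"
    and weak: "\<And>j. j \<in> J \<Longrightarrow> torus_div (\<lambda>i x. \<Sum>k\<in>J. B i j k * e k x) (H j)"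
    and d: "0 < d" "d < 1"
  shows "(\<Sum>j\<in>J. \<integral>y. \<integral>x. e j y * H j x * bump_kernel d y x \<partial>cube_measure \<partial>cube_measure) = 0"
proof -
  \<comment> \<open>The double integrand with the derivative on the kernel, so that no derivative of
    \<open>e\<close> occurs. Symmetry of \<open>B\<close> and oddness of the kernel derivative make
    it antisymmetric in \<open>x\<close> and \<open>y\<close>, and by Fubini its double integral
    equals its own negative.\<close>
  define W where "W y x = (\<Sum>j\<in>J. \<Sum>i\<in>UNIV. \<Sum>k\<in>J. B i j k * (e j y * e k x * kernel_deriv d i y x))" for y x
  have ei: "integrable cube_measure (e j)" if "j \<in> J" for j by (intro cube.integrable_L2 e that)
  have int: "integrable (cube_measure \<Otimes>\<^sub>M cube_measure) (\<lambda>p. e j (fst p) * e k (snd p) * kernel_deriv d i (fst p) (snd p))"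
    if "j \<in> J" "k \<in> J" for i j k
    by (intro integrable_kernel_product[where C="48 * real (card (shifts 2))"] ei that kernel_deriv_measurable)
       (rule kernel_deriv_bound[OF d])
  have Wint: "integrable (cube_measure \<Otimes>\<^sub>M cube_measure) (\<lambda>(y, x). W y x)"
    unfolding W_def case_prod_beta' using int
    by (intro Bochner_Integration.integrable_sum Bochner_Integration.integrable_mult_right) auto
  have anti: "W x y = - W y x" for x y
  proof -
    have "W x y = (\<Sum>i\<in>UNIV. \<Sum>j\<in>J. \<Sum>k\<in>J. B i j k * (e j x * e k y * kernel_deriv d i x y))"
      unfolding W_def by (rule sum.swap)
    also have "\<dots> = (\<Sum>i\<in>UNIV. \<Sum>k\<in>J. \<Sum>j\<in>J. B i j k * (e j x * e k y * kernel_deriv d i x y))"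
      by (intro sum.cong refl sum.swap)
    also have "\<dots> = (\<Sum>i\<in>UNIV. \<Sum>k\<in>J. \<Sum>j\<in>J. - (B i k j * (e k y * e j x * kernel_deriv d i y x)))"
    proof (intro sum.cong refl)
      fix i k j
      show "B i j k * (e j x * e k y * kernel_deriv d i x y) = - (B i k j * (e k y * e j x * kernel_deriv d i y x))"
        unfolding B[of i j k] kernel_deriv_antisym[of d i x y] by simp
    qed
    also have "\<dots> = - (\<Sum>i\<in>UNIV. \<Sum>k\<in>J. \<Sum>j\<in>J. B i k j * (e k y * e j x * kernel_deriv d i y x))"
      by (simp add: sum_negf)
    also have "(\<Sum>i\<in>UNIV. \<Sum>k\<in>J. \<Sum>j\<in>J. B i k j * (e k y * e j x * kernel_deriv d i y x)) = W y x"
      unfolding W_def by (rule sum.swap)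
    finally show ?thesis .
  qed
  have "(\<integral>y. \<integral>x. W y x \<partial>cube_measure \<partial>cube_measure) = (\<integral>x. \<integral>y. W y x \<partial>cube_measure \<partial>cube_measure)"
    using cube_pair.Fubini_integral[OF Wint] by simp
  also have "\<dots> = (\<integral>x. \<integral>y. - W x y \<partial>cube_measure \<partial>cube_measure)" by (simp only: anti[symmetric])
  finally have W0: "(\<integral>y. \<integral>x. W y x \<partial>cube_measure \<partial>cube_measure) = 0" by simp
  \<comment> \<open>For fixed \<open>y\<close> the weak divergence is tested with the kernel as a
    function of \<open>x\<close>, which is the periodization of a test function.\<close>
  have inner: "(\<integral>x. W y x \<partial>cube_measure) = - (\<Sum>j\<in>J. \<integral>x. e j y * H j x * bump_kernel d y x \<partial>cube_measure)"
    if y: "y \<in> unit_cube" for y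
  proof -
    have kc: "continuous_on UNIV (kernel_deriv d i y)" for i
      unfolding kernel_deriv_def pd_ball_bump[symmetric]
      using Ck_ball_bump[of 1 d y] by (intro Ck_continuous[of 0] Ck_periodized) simp
    have pdk: "pd (bump_kernel d y) i x = kernel_deriv d i y x" for i x
      unfolding bump_kernel_def kernel_deriv_def by (subst pd_periodized[OF Ck_ball_bump]) (simp only: pd_ball_bump)
    have i1: "integrable cube_measure (\<lambda>x. e k x * kernel_deriv d i y x)" if "k \<in> J" for i k
      by (intro integrable_cube_mult_continuous ei that kc)
    have "(\<integral>x. W y x \<partial>cube_measure) = (\<integral>x. (\<Sum>j\<in>J. e j y * (\<Sum>i\<in>UNIV. (\<Sum>k\<in>J. B i j k * e k x) * kernel_deriv d i y x)) \<partial>cube_measure)"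
      unfolding W_def
      by (intro Bochner_Integration.integral_cong refl sum.cong) (simp add: sum_distrib_left sum_distrib_right mult_ac)
    also have "\<dots> = (\<Sum>j\<in>J. \<integral>x. e j y * (\<Sum>i\<in>UNIV. (\<Sum>k\<in>J. B i j k * e k x) * kernel_deriv d i y x) \<partial>cube_measure)"
    proof (rule Bochner_Integration.integral_sum)
      fix j assume "j \<in> J"
      have "integrable cube_measure (\<lambda>x. e j y * (\<Sum>i\<in>UNIV. \<Sum>k\<in>J. B i j k * (e k x * kernel_deriv d i y x)))"
        using i1 by (intro Bochner_Integration.integrable_mult_right Bochner_Integration.integrable_sum) auto
      then show "integrable cube_measure (\<lambda>x. e j y * (\<Sum>i\<in>UNIV. (\<Sum>k\<in>J. B i j k * e k x) * kernel_deriv d i y x))"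
        by (simp add: sum_distrib_right mult.assoc)
    qed
    also have "\<dots> = (\<Sum>j\<in>J. e j y * - (\<integral>x. H j x * bump_kernel d y x \<partial>cube_measure))"
    proof (intro sum.cong refl)
      fix j assume j: "j \<in> J"
      have "(\<integral>x. (\<Sum>i\<in>UNIV. (\<Sum>k\<in>J. B i j k * e k x) * pd (bump_kernel d y) i x) \<partial>cube_measure)
          = - (\<integral>x. H j x * bump_kernel d y x \<partial>cube_measure)"
        using weak[OF j] kernel_test_function[OF y d] unfolding torus_div_def bump_kernel_def by blast
      then show "(\<integral>x. e j y * (\<Sum>i\<in>UNIV. (\<Sum>k\<in>J. B i j k * e k x) * kernel_deriv d i y x) \<partial>cube_measure)
          = e j y * - (\<integral>x. H j x * bump_kernel d y x \<partial>cube_measure)"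
        by (simp add: pdk)
    qed
    finally show ?thesis by (simp add: sum_negf mult.assoc)
  qed
  have hint: "integrable (cube_measure \<Otimes>\<^sub>M cube_measure) (\<lambda>p. e j (fst p) * H j (snd p) * bump_kernel d (fst p) (snd p))" if "j \<in> J" for j
    by (intro integrable_kernel_product[where C="real (card (shifts 2))"] ei cube.integrable_L2 H that kernel_measurable)
       (rule kernel_bound)
  have "(\<Sum>j\<in>J. \<integral>y. \<integral>x. e j y * H j x * bump_kernel d y x \<partial>cube_measure \<partial>cube_measure)
      = (\<integral>y. (\<Sum>j\<in>J. \<integral>x. e j y * H j x * bump_kernel d y x \<partial>cube_measure) \<partial>cube_measure)"
    using cube_pair.integrable_fst'[OF hint] by (intro Bochner_Integration.integral_sum[symmetric]) auto
  also have "\<dots> = (\<integral>y. - (\<integral>x. W y x \<partial>cube_measure) \<partial>cube_measure)"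
    using inner by (intro Bochner_Integration.integral_cong) auto
  also have "\<dots> = 0" using W0 by simp
  finally show ?thesis .
qed

section \<open>The kernel as an approximate identity\<close>

definition bump_mass :: "real \<Rightarrow> real" where
  "bump_mass d = (\<integral>z. ball_bump d z \<partial>lborel)"

lemma distr_uminus_vec3: "distr lborel borel uminus = (lborel :: vec3 measure)"
  using lborel_affine[of "-1" "0 :: vec3"] by (simp add: density_1 uminus_add_conv_diff)

lemma integral_ball_bump_shift: "(\<integral>x. ball_bump d (y - x) \<partial>lborel) = bump_mass d"
proof -
  have "bump_mass d = (\<integral>z. ball_bump d z \<partial>distr lborel borel (\<lambda>x. y + x))"
    by (simp add: bump_mass_def lborel_distr_plus)
  also have "\<dots> = (\<integral>x. ball_bump d (y + x) \<partial>lborel)" by (rule integral_distr) measurable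
  also have "\<dots> = (\<integral>x. ball_bump d (y + x) \<partial>distr lborel borel uminus)" by (simp only: distr_uminus_vec3)
  also have "\<dots> = (\<integral>x. ball_bump d (y + - x) \<partial>lborel)" by (rule integral_distr) measurable
  finally show ?thesis by simp
qed

lemma integrable_one_cube: "integrable cube_measure (\<lambda>_. 1 :: real)"
  by simp

text \<open>Unfolding the periodization turns both marginals into the integral of one ball bump over
  the space, so they do not depend on \<open>y\<close>. The kernel is not normalised; the mass is
  carried as a factor and divided out at the end.\<close>

lemma kernel_mass:
  assumes "y \<in> unit_cube" "0 < d" "d < 1"
  shows "(\<integral>x. bump_kernel d y x \<partial>cube_measure) = bump_mass d" "(\<integral>x. bump_kernel d x y \<partial>cube_measure) = bump_mass d"
proof -
  have "(\<integral>x. 1 * ball_bump d (y - x) \<partial>lborel) = (\<integral>x. 1 * periodized 2 (\<lambda>x. ball_bump d (y - x)) x \<partial>cube_measure)"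
    by (intro periodic_integral(2) kernel_test_function(2) assms Ck_continuous[OF Ck_ball_bump[of 0]] integrable_one_cube) auto
  then show 1: "(\<integral>x. bump_kernel d y x \<partial>cube_measure) = bump_mass d"
    by (simp only: mult_1_left integral_ball_bump_shift bump_kernel_def)
  show "(\<integral>x. bump_kernel d x y \<partial>cube_measure) = bump_mass d"
    by (subst kernel_sym) (rule 1)
qed

text \<open>If the mass were zero, the open ball on which the bump is positive would be a null
  set.\<close>

lemma bump_mass_pos:
  assumes d: "0 < d" "d < 1" shows "0 < bump_mass d"
proof -
  define c :: vec3 where "c = (\<chi> i. 1/2)"
  have y: "c \<in> unit_cube" by (simp add: unit_cube_def c_def)
  have "integrable lborel (\<lambda>x. 1 * ball_bump d (c - x))"
    by (intro periodic_integral(1)[where M=2] kernel_test_function(2)[OF y d] Ck_continuous[OF Ck_ball_bump[of 0]] integrable_one_cube) auto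
  then have int: "integrable lborel (\<lambda>x. ball_bump d (c - x))" by simp
  have "bump_mass d \<noteq> 0"
  proof
    assume "bump_mass d = 0"
    then have "(\<integral>x. ball_bump d (c - x) \<partial>lborel) = 0" by (simp only: integral_ball_bump_shift)
    then have "AE x in lborel. ball_bump d (c - x) = 0"
      by (subst (asm) integral_nonneg_eq_0_iff_AE[OF int]) (auto simp: ball_bump_nonneg)
    then have "AE x in lborel. x \<notin> ball c d"
      by eventually_elim (use ball_bump_nonzero[OF d(1)] in \<open>auto simp: dist_norm\<close>)
    then have "ball c d \<in> null_sets lborel"
      by (subst (asm) AE_iff_null_sets[symmetric]) auto
    then have "negligible (ball c d :: vec3 set)"
      by (simp add: negligible_iff_null_sets null_sets_completionI)
    then show False using open_not_negligible[of "ball c d :: vec3 set"] d by auto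
  qed
  moreover have "bump_mass d \<ge> 0"
    unfolding bump_mass_def by (intro Bochner_Integration.integral_nonneg) (simp add: ball_bump_nonneg)
  ultimately show ?thesis by simp
qed

text \<open>Young's inequality with a free weight. The weight is the lower bound of the damping in
  \<open>damping_estimate\<close> and is fitted to the tolerance in
  \<open>kernel_limit\<close>.\<close>

lemma weighted_product_le:
  fixes x y s :: real assumes "s > 0" shows "\<bar>x * y\<bar> \<le> (s * x\<^sup>2 + y\<^sup>2 / s) / 2"
proof -
  have "0 \<le> (s * \<bar>x\<bar> - \<bar>y\<bar>)\<^sup>2 / s" using assms by simp
  also have "\<dots> = s * x\<^sup>2 + y\<^sup>2 / s - 2 * (\<bar>x\<bar> * \<bar>y\<bar>)"
    using assms by (simp add: power2_diff power_mult_distrib field_simps power2_eq_square)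
  finally show ?thesis by (simp add: abs_mult)
qed

lemma integral_product_le:
  assumes "in_L2 M f" "in_L2 M g" "s > 0"
  shows "\<bar>\<integral>x. f x * g x \<partial>M\<bar> \<le> (s * (\<integral>x. (f x)\<^sup>2 \<partial>M) + (\<integral>x. (g x)\<^sup>2 \<partial>M) / s) / 2"
proof -
  have "\<bar>\<integral>x. f x * g x \<partial>M\<bar> \<le> (\<integral>x. \<bar>f x * g x\<bar> \<partial>M)" by (rule integral_abs_bound)
  also have "\<dots> \<le> (\<integral>x. (s * (f x)\<^sup>2 + (g x)\<^sup>2 / s) / 2 \<partial>M)"
    using integrable_L2_mult[OF assms(1,2)] assms weighted_product_le[OF assms(3)]
    by (intro integral_mono) (auto simp: L2_integrable_square)
  also have "\<dots> = (s * (\<integral>x. (f x)\<^sup>2 \<partial>M) + (\<integral>x. (g x)\<^sup>2 \<partial>M) / s) / 2"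
    using assms by (simp add: L2_integrable_square)
  finally show ?thesis .
qed

lemma integrable_kernel_pair:
  assumes "integrable cube_measure a" "integrable cube_measure b"
  shows "integrable (cube_measure \<Otimes>\<^sub>M cube_measure) (\<lambda>p. a (fst p) * b (snd p) * bump_kernel d (fst p) (snd p))"
  using assms by (rule integrable_kernel_product[OF _ _ kernel_measurable kernel_bound])

lemma integral_kernel_fst:
  assumes a: "integrable cube_measure a" and d: "0 < d" "d < 1"
  shows "(\<integral>p. a (fst p) * bump_kernel d (fst p) (snd p) \<partial>(cube_measure \<Otimes>\<^sub>M cube_measure)) = bump_mass d * (\<integral>y. a y \<partial>cube_measure)"
proof -
  have int: "integrable (cube_measure \<Otimes>\<^sub>M cube_measure) (\<lambda>p. a (fst p) * bump_kernel d (fst p) (snd p))"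
    using integrable_kernel_pair[OF a integrable_one_cube, of d] by simp
  have "(\<integral>p. a (fst p) * bump_kernel d (fst p) (snd p) \<partial>(cube_measure \<Otimes>\<^sub>M cube_measure))
      = (\<integral>y. \<integral>x. a y * bump_kernel d y x \<partial>cube_measure \<partial>cube_measure)"
    using cube_pair.integral_fst'[OF int] by simp
  also have "\<dots> = (\<integral>y. bump_mass d * a y \<partial>cube_measure)"
    by (intro Bochner_Integration.integral_cong refl) (simp add: kernel_mass d)
  finally show ?thesis by simp
qed

lemma integral_kernel_snd:
  assumes b: "integrable cube_measure b" and d: "0 < d" "d < 1"
  shows "(\<integral>p. b (snd p) * bump_kernel d (fst p) (snd p) \<partial>(cube_measure \<Otimes>\<^sub>M cube_measure)) = bump_mass d * (\<integral>y. b y \<partial>cube_measure)"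
proof -
  have int: "integrable (cube_measure \<Otimes>\<^sub>M cube_measure) (\<lambda>(y, x). b x * bump_kernel d y x)"
    using integrable_kernel_pair[OF integrable_one_cube b, of d] by (simp add: case_prod_beta')
  have "(\<integral>p. b (snd p) * bump_kernel d (fst p) (snd p) \<partial>(cube_measure \<Otimes>\<^sub>M cube_measure))
      = (\<integral>x. \<integral>y. b x * bump_kernel d y x \<partial>cube_measure \<partial>cube_measure)"
    using cube_pair.integral_snd[OF int] by (simp add: case_prod_beta')
  also have "\<dots> = (\<integral>y. bump_mass d * b y \<partial>cube_measure)"
    by (intro Bochner_Integration.integral_cong refl) (simp add: kernel_mass d)
  finally show ?thesis by simp
qed

text \<open>Schur's test: after Young's inequality each square depends on one variable only, and
  integrating the kernel over the other gives \<open>bump_mass d\<close>.\<close>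

lemma kernel_schur:
  assumes a: "in_L2 cube_measure a" and b: "in_L2 cube_measure b" and s: "s > 0" and d: "0 < d" "d < 1"
  shows "\<bar>\<integral>p. a (fst p) * b (snd p) * bump_kernel d (fst p) (snd p) \<partial>(cube_measure \<Otimes>\<^sub>M cube_measure)\<bar>
    \<le> bump_mass d * ((s * (\<integral>x. (a x)\<^sup>2 \<partial>cube_measure) + (\<integral>x. (b x)\<^sup>2 \<partial>cube_measure) / s) / 2)"
proof -
  let ?P = "cube_measure \<Otimes>\<^sub>M cube_measure"
  let ?K = "\<lambda>p. bump_kernel d (fst p) (snd p)"
  have ia: "integrable cube_measure a" and ib: "integrable cube_measure b"
    using a b by (auto intro: cube.integrable_L2)
  have ia2: "integrable cube_measure (\<lambda>x. (a x)\<^sup>2)" and ib2: "integrable cube_measure (\<lambda>x. (b x)\<^sup>2)"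
    using a b by (auto intro: L2_integrable_square)
  have i1: "integrable ?P (\<lambda>p. (a (fst p))\<^sup>2 * ?K p)" "integrable ?P (\<lambda>p. (b (snd p))\<^sup>2 * ?K p)"
    using integrable_kernel_pair[OF ia2 integrable_one_cube, of d] integrable_kernel_pair[OF integrable_one_cube ib2, of d] by auto
  have "\<bar>\<integral>p. a (fst p) * b (snd p) * ?K p \<partial>?P\<bar> \<le> (\<integral>p. \<bar>a (fst p) * b (snd p) * ?K p\<bar> \<partial>?P)"
    by (rule integral_abs_bound)
  also have "\<dots> \<le> (\<integral>p. (s / 2) * ((a (fst p))\<^sup>2 * ?K p) + (1 / (2 * s)) * ((b (snd p))\<^sup>2 * ?K p) \<partial>?P)"
  proof (rule integral_mono)
    show "integrable ?P (\<lambda>p. \<bar>a (fst p) * b (snd p) * ?K p\<bar>)"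
      using integrable_kernel_pair[OF ia ib, of d] by auto
    fix p
    have "\<bar>a (fst p) * b (snd p)\<bar> * ?K p \<le> (s * (a (fst p))\<^sup>2 + (b (snd p))\<^sup>2 / s) / 2 * ?K p"
      by (intro mult_right_mono weighted_product_le s kernel_nonneg)
    then show "\<bar>a (fst p) * b (snd p) * ?K p\<bar> \<le> (s / 2) * ((a (fst p))\<^sup>2 * ?K p) + (1 / (2 * s)) * ((b (snd p))\<^sup>2 * ?K p)"
      using s by (simp add: abs_mult kernel_nonneg field_simps)
  qed (use i1 in auto)
  also have "\<dots> = (s / 2) * (bump_mass d * (\<integral>x. (a x)\<^sup>2 \<partial>cube_measure)) + (1 / (2 * s)) * (bump_mass d * (\<integral>x. (b x)\<^sup>2 \<partial>cube_measure))"
    using i1 by (simp add: integral_kernel_fst[OF ia2 d] integral_kernel_snd[OF ib2 d])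
  also have "\<dots> = bump_mass d * ((s * (\<integral>x. (a x)\<^sup>2 \<partial>cube_measure) + (\<integral>x. (b x)\<^sup>2 \<partial>cube_measure) / s) / 2)"
    using s by (simp add: field_simps)
  finally show ?thesis .
qed

lemma test_function_margin:
  assumes g: "test_function unit_cube g"
  obtains r where "r > 0" "\<And>x y. g x \<noteq> 0 \<Longrightarrow> norm (x - y) < r \<Longrightarrow> y \<in> unit_cube"
proof -
  obtain K where K: "compact K" "K \<subseteq> unit_cube" "\<And>x. x \<notin> K \<Longrightarrow> g x = 0"
    using g unfolding test_function_def by blast
  have "open unit_cube" by (simp add: unit_cube_eq_box open_box)
  then obtain r where r: "r > 0" "(\<Union>x\<in>K. cball x r) \<subseteq> unit_cube"
    using compact_subset_open_imp_cball_epsilon_subset[OF K(1) _ K(2)] by blast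
  show ?thesis
  proof (rule that[OF r(1)])
    fix x y assume "g x \<noteq> 0" "norm (x - y) < r"
    then have "x \<in> K" "y \<in> cball x r" using K(3) by (auto simp: dist_norm)
    then show "y \<in> unit_cube" using r(2) by blast
  qed
qed

lemma unit_cube_shift_eq:
  assumes "x \<in> unit_cube" "x + shift_vec k \<in> unit_cube" shows "k = 0"
proof -
  have "k $ i = 0" for i
  proof -
    have "0 < x $ i" "x $ i < 1" "0 < x $ i + real_of_int (k $ i)" "x $ i + real_of_int (k $ i) < 1"
      using assms by (auto simp: unit_cube_def)
    then have "-1 < real_of_int (k $ i)" "real_of_int (k $ i) < 1" by linarith+
    then show ?thesis by linarith
  qed
  then show ?thesis by (simp add: vec_eq_iff)
qed

text \<open>The periodic kernel also links points near opposite faces, where continuity inside the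
  cube says nothing. For these pairs the distance of the support of \<open>g\<close> from the
  boundary forces both values to vanish. The factor \<open>bump_kernel d y x\<close> restricts the
  claim to pairs the kernel actually links.\<close>

lemma test_function_uniform:
  assumes g: "test_function unit_cube g" and w: "w > 0"
  obtains r where "0 < r" "r < 1"
    "\<And>d x y. 0 < d \<Longrightarrow> d < r \<Longrightarrow> x \<in> unit_cube \<Longrightarrow> y \<in> unit_cube \<Longrightarrow> \<bar>g y - g x\<bar> * bump_kernel d y x \<le> w * bump_kernel d y x"
proof -
  obtain r1 where r1: "r1 > 0" "\<And>x y. g x \<noteq> 0 \<Longrightarrow> norm (x - y) < r1 \<Longrightarrow> y \<in> unit_cube"
    using test_function_margin[OF g] by blast
  have "uniformly_continuous_on (cbox 0 1) g"
    using Ck_continuous[OF test_function_Ck[OF g, of 0]]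
    by (intro compact_uniformly_continuous) (auto intro: continuous_on_subset)
  then obtain r2 where r2: "r2 > 0" "\<And>x y. x \<in> cbox 0 1 \<Longrightarrow> y \<in> cbox 0 1 \<Longrightarrow> dist x y < r2 \<Longrightarrow> dist (g x) (g y) < w"
    unfolding uniformly_continuous_on_def using w by blast
  define r where "r = min (min r1 r2) (1/2)"
  show ?thesis
  proof (rule that[of r])
    show "0 < r" "r < 1" using r1 r2 by (auto simp: r_def)
    fix d x y assume d: "0 < d" "d < r" and x: "x \<in> unit_cube" and y: "y \<in> unit_cube"
    have "\<bar>g y - g x\<bar> * ball_bump d (y - (x + shift_vec k)) \<le> w * ball_bump d (y - (x + shift_vec k))" for k
    proof (cases "ball_bump d (y - (x + shift_vec k)) = 0")
      case False
      then have n: "norm (y - (x + shift_vec k)) < d" using ball_bump_nonzero[OF d(1)] by blast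
      have "\<bar>g y - g x\<bar> \<le> w"
      proof (cases "k = 0")
        case True
        have "shift_vec 0 = 0" by (simp add: vec_eq_iff)
        then have "dist y x < r2" using n d True by (simp add: dist_norm r_def)
        moreover have "x \<in> cbox 0 1" "y \<in> cbox 0 1" using x y box_subset_cbox[of "0::vec3" 1] by (auto simp: unit_cube_eq_box)
        ultimately show ?thesis using r2(2)[of y x] by (simp add: dist_real_def)
      next
        case False
        have "g y = 0"
        proof (rule ccontr)
          assume "g y \<noteq> 0"
          then have "x + shift_vec k \<in> unit_cube" using r1(2) n d by (auto simp: r_def)
          then show False using unit_cube_shift_eq[OF x] False by blast
        qed
        moreover have "g x = 0"
        proof (rule ccontr)
          assume "g x \<noteq> 0"
          moreover have "norm (x - (y + shift_vec (- k))) < r1"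
          proof -
            have "norm (x - (y + shift_vec (- k))) = norm (y - (x + shift_vec k))"
              by (subst norm_minus_commute) (simp add: shift_vec_uminus algebra_simps)
            then show ?thesis using n d by (simp add: r_def)
          qed
          ultimately have "y + shift_vec (- k) \<in> unit_cube" using r1(2) by blast
          then show False using unit_cube_shift_eq[OF y] False by (metis neg_equal_0_iff_equal)
        qed
        ultimately show ?thesis using w by simp
      qed
      then show ?thesis by (intro mult_right_mono ball_bump_nonneg)
    qed simp
    then show "\<bar>g y - g x\<bar> * bump_kernel d y x \<le> w * bump_kernel d y x"
      unfolding bump_kernel_def periodized_def sum_distrib_left by (intro sum_mono)
  qed
qed

text \<open>The error is split as \<open>(a - g)(y) b(x) + (g(y) - g(x)) b(x) + (g b)(x)\<close> with a test function \<open>g\<close> close to \<open>a\<close>.\<close>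

lemma kernel_limit:
  assumes a: "in_L2 cube_measure a" and b: "in_L2 cube_measure b" and \<eta>: "\<eta> > 0"
  obtains r where "0 < r" "r < 1" "\<And>d. 0 < d \<Longrightarrow> d < r \<Longrightarrow>
    \<bar>(\<integral>y. \<integral>x. a y * b x * bump_kernel d y x \<partial>cube_measure \<partial>cube_measure) - bump_mass d * (\<integral>x. a x * b x \<partial>cube_measure)\<bar>
      \<le> \<eta> * bump_mass d"
proof -
  let ?P = "cube_measure \<Otimes>\<^sub>M cube_measure"
  define \<beta> where "\<beta> = (\<integral>x. (b x)\<^sup>2 \<partial>cube_measure)"
  define \<gamma> where "\<gamma> = (\<integral>x. \<bar>b x\<bar> \<partial>cube_measure)"
  \<comment> \<open>The choices give \<open>\<beta> / s \<le> \<eta> / 4\<close> and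
    \<open>w * \<gamma> \<le> \<eta> / 2\<close>. The three errors below then amount to \<eta>/4,
    \<eta>/2 and \<eta>/4, each times the mass; adding 1 to \<beta> and \<gamma> keeps the quotients
    meaningful when these are zero.\<close>
  define s where "s = 4 * (\<beta> + 1) / \<eta>"
  define w where "w = \<eta> / (2 * (\<gamma> + 1))"
  have \<beta>: "\<beta> \<ge> 0" and \<gamma>: "\<gamma> \<ge> 0" by (auto simp: \<beta>_def \<gamma>_def)
  have s: "s > 0" and w: "w > 0" using \<beta> \<gamma> \<eta> by (auto simp: s_def w_def)
  have "\<beta> / s = \<beta> / (\<beta> + 1) * (\<eta> / 4)" using \<beta> \<eta> by (simp add: s_def field_simps)
  also have "\<dots> \<le> 1 * (\<eta> / 4)" using \<beta> \<eta> by (intro mult_right_mono) (auto simp: field_simps)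
  finally have bs: "\<beta> / s \<le> \<eta> / 4" by simp
  have wg: "w * \<gamma> \<le> \<eta> / 2"
  proof -
    have "w * \<gamma> = \<gamma> / (\<gamma> + 1) * (\<eta> / 2)" using \<gamma> by (simp add: w_def field_simps)
    also have "\<dots> \<le> 1 * (\<eta> / 2)" using \<gamma> \<eta> by (intro mult_right_mono) (auto simp: field_simps)
    finally show ?thesis by simp
  qed
  obtain g where g: "test_function unit_cube g" and ag: "(\<integral>x. (a x - g x)\<^sup>2 \<partial>cube_measure) < \<eta> / (4 * s)"
    using L2_closure_test_functions[OF a] s \<eta> unfolding L2_closure_def
    by (metis divide_pos_pos mem_Collect_eq mult_pos_pos zero_less_numeral)
  have gL: "in_L2 cube_measure g" by (rule test_function_in_L2[OF g])
  have agL: "in_L2 cube_measure (\<lambda>x. a x - g x)" by (intro in_L2_diff a gL)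
  have sa: "(s * (\<integral>x. (a x - g x)\<^sup>2 \<partial>cube_measure) + \<beta> / s) / 2 \<le> \<eta> / 4"
  proof -
    have "s * (\<integral>x. (a x - g x)\<^sup>2 \<partial>cube_measure) \<le> s * (\<eta> / (4 * s))" using ag s by (intro mult_left_mono) auto
    also have "\<dots> = \<eta> / 4" using s by simp
    finally show ?thesis using bs by simp
  qed
  obtain r where r: "0 < r" "r < 1"
    "\<And>d x y. 0 < d \<Longrightarrow> d < r \<Longrightarrow> x \<in> unit_cube \<Longrightarrow> y \<in> unit_cube \<Longrightarrow> \<bar>g y - g x\<bar> * bump_kernel d y x \<le> w * bump_kernel d y x"
    using test_function_uniform[OF g w] by blast
  show ?thesis
  proof (rule that[OF r(1,2)])
    fix d assume d0: "0 < d" "d < r"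
    then have d: "0 < d" "d < 1" using r by auto
    let ?K = "\<lambda>p. bump_kernel d (fst p) (snd p)"
    have ia: "integrable cube_measure a" and ib: "integrable cube_measure b" and ig: "integrable cube_measure g"
      using a b gL by (auto intro: cube.integrable_L2)
    have igb: "integrable cube_measure (\<lambda>x. g x * b x)" by (intro integrable_L2_mult gL b)
    have I1: "integrable ?P (\<lambda>p. (a (fst p) - g (fst p)) * b (snd p) * ?K p)"
      using integrable_kernel_pair[of "\<lambda>x. a x - g x" b d] ia ib ig by simp
    have I2: "integrable ?P (\<lambda>p. g (fst p) * b (snd p) * ?K p)" by (intro integrable_kernel_pair ig ib)
    have I3: "integrable ?P (\<lambda>p. g (snd p) * b (snd p) * ?K p)"
      using integrable_kernel_pair[OF integrable_one_cube igb, of d] by simp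
    have I0: "integrable ?P (\<lambda>p. a (fst p) * b (snd p) * ?K p)" by (intro integrable_kernel_pair ia ib)
    have abs_b: "integrable ?P (\<lambda>p. \<bar>b (snd p)\<bar> * ?K p)"
      using integrable_kernel_pair[OF integrable_one_cube integrable_abs[OF ib], of d] by simp
    have E1: "\<bar>\<integral>p. (a (fst p) - g (fst p)) * b (snd p) * ?K p \<partial>?P\<bar> \<le> bump_mass d * (\<eta> / 4)"
    proof -
      have "\<bar>\<integral>p. (a (fst p) - g (fst p)) * b (snd p) * ?K p \<partial>?P\<bar>
          \<le> bump_mass d * ((s * (\<integral>x. (a x - g x)\<^sup>2 \<partial>cube_measure) + \<beta> / s) / 2)"
        unfolding \<beta>_def by (rule kernel_schur[OF agL b s d])
      also have "\<dots> \<le> bump_mass d * (\<eta> / 4)" using bump_mass_pos[OF d] by (intro mult_left_mono sa) auto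
      finally show ?thesis .
    qed
    have E2: "\<bar>\<integral>p. (g (fst p) - g (snd p)) * b (snd p) * ?K p \<partial>?P\<bar> \<le> bump_mass d * (\<eta> / 2)"
    proof -
      have "\<bar>\<integral>p. (g (fst p) - g (snd p)) * b (snd p) * ?K p \<partial>?P\<bar> \<le> (\<integral>p. \<bar>(g (fst p) - g (snd p)) * b (snd p) * ?K p\<bar> \<partial>?P)"
        by (rule integral_abs_bound)
      also have "\<dots> \<le> (\<integral>p. w * (\<bar>b (snd p)\<bar> * ?K p) \<partial>?P)"
      proof (rule integral_mono)
        show "integrable ?P (\<lambda>p. \<bar>(g (fst p) - g (snd p)) * b (snd p) * ?K p\<bar>)"
          using Bochner_Integration.integrable_diff[OF I2 I3] by (intro integrable_abs) (simp add: left_diff_distrib)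
        fix p assume "p \<in> space ?P"
        then have "fst p \<in> unit_cube" "snd p \<in> unit_cube" by (auto simp: space_pair_measure)
        then have "\<bar>b (snd p)\<bar> * (\<bar>g (fst p) - g (snd p)\<bar> * ?K p) \<le> \<bar>b (snd p)\<bar> * (w * ?K p)"
          by (intro mult_left_mono r(3) d0) auto
        then show "\<bar>(g (fst p) - g (snd p)) * b (snd p) * ?K p\<bar> \<le> w * (\<bar>b (snd p)\<bar> * ?K p)"
          by (simp add: abs_mult kernel_nonneg mult_ac)
      qed (use abs_b in auto)
      also have "\<dots> = bump_mass d * (w * \<gamma>)"
        using integral_kernel_snd[OF integrable_abs[OF ib] d] by (simp add: \<gamma>_def)
      also have "\<dots> \<le> bump_mass d * (\<eta> / 2)" using bump_mass_pos[OF d] by (intro mult_left_mono wg) auto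
      finally show ?thesis .
    qed
    have E3: "(\<integral>p. g (snd p) * b (snd p) * ?K p \<partial>?P) = bump_mass d * (\<integral>x. g x * b x \<partial>cube_measure)"
      using integral_kernel_snd[OF igb d] by simp
    have E4: "\<bar>bump_mass d * (\<integral>x. (a x - g x) * b x \<partial>cube_measure)\<bar> \<le> bump_mass d * (\<eta> / 4)"
    proof -
      have "\<bar>\<integral>x. (a x - g x) * b x \<partial>cube_measure\<bar> \<le> \<eta> / 4"
        using integral_product_le[OF agL b s] sa unfolding \<beta>_def by linarith
      then show ?thesis using bump_mass_pos[OF d] by (simp add: abs_mult)
    qed
    have "(\<integral>y. \<integral>x. a y * b x * bump_kernel d y x \<partial>cube_measure \<partial>cube_measure) = (\<integral>p. a (fst p) * b (snd p) * ?K p \<partial>?P)"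
      using cube_pair.integral_fst'[OF I0] by simp
    also have "\<dots> = (\<integral>p. (a (fst p) - g (fst p)) * b (snd p) * ?K p + ((g (fst p) - g (snd p)) * b (snd p) * ?K p
        + g (snd p) * b (snd p) * ?K p) \<partial>?P)"
      by (intro Bochner_Integration.integral_cong refl) (simp add: algebra_simps)
    also have "\<dots> = (\<integral>p. (a (fst p) - g (fst p)) * b (snd p) * ?K p \<partial>?P) + ((\<integral>p. (g (fst p) - g (snd p)) * b (snd p) * ?K p \<partial>?P)
        + (\<integral>p. g (snd p) * b (snd p) * ?K p \<partial>?P))"
    proof -
      have "integrable ?P (\<lambda>p. (g (fst p) - g (snd p)) * b (snd p) * ?K p)"
        using Bochner_Integration.integrable_diff[OF I2 I3] by (simp add: left_diff_distrib)
      then show ?thesis using I1 I3 by simp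
    qed
    finally have "(\<integral>y. \<integral>x. a y * b x * bump_kernel d y x \<partial>cube_measure \<partial>cube_measure) - bump_mass d * (\<integral>x. a x * b x \<partial>cube_measure)
      = (\<integral>p. (a (fst p) - g (fst p)) * b (snd p) * ?K p \<partial>?P) + (\<integral>p. (g (fst p) - g (snd p)) * b (snd p) * ?K p \<partial>?P)
        - bump_mass d * (\<integral>x. (a x - g x) * b x \<partial>cube_measure)"
      using E3 integrable_L2_mult[OF a b] igb by (simp add: left_diff_distrib right_diff_distrib)
    then show "\<bar>(\<integral>y. \<integral>x. a y * b x * bump_kernel d y x \<partial>cube_measure \<partial>cube_measure) - bump_mass d * (\<integral>x. a x * b x \<partial>cube_measure)\<bar>
      \<le> \<eta> * bump_mass d"
    proof -
      assume eq: "(\<integral>y. \<integral>x. a y * b x * bump_kernel d y x \<partial>cube_measure \<partial>cube_measure) - bump_mass d * (\<integral>x. a x * b x \<partial>cube_measure)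
      = (\<integral>p. (a (fst p) - g (fst p)) * b (snd p) * ?K p \<partial>?P) + (\<integral>p. (g (fst p) - g (snd p)) * b (snd p) * ?K p \<partial>?P)
        - bump_mass d * (\<integral>x. (a x - g x) * b x \<partial>cube_measure)"
      have "\<eta> * bump_mass d = bump_mass d * (\<eta> / 4) + bump_mass d * (\<eta> / 2) + bump_mass d * (\<eta> / 4)"
        by (simp add: field_simps)
      then show ?thesis unfolding eq using E1 E2 E4 by linarith
    qed
  qed
qed

text \<open>The mollified pairing is zero for every radius, and for small radii it differs from the
  mass times the true pairing by a small multiple of the mass. Dividing by the positive mass gives
  the claim.\<close>

theorem torus_energy_zero:
  assumes J: "finite J" and e: "\<And>j. j \<in> J \<Longrightarrow> in_L2 cube_measure (e j)" and H: "\<And>j. j \<in> J \<Longrightarrow> in_L2 cube_measure (H j)"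
    and B: "\<And>i j k. B i j k = B i k j"
    and weak: "\<And>j. j \<in> J \<Longrightarrow> torus_div (\<lambda>i x. \<Sum>k\<in>J. B i j k * e k x) (H j)"
  shows "(\<Sum>j\<in>J. \<integral>x. e j x * H j x \<partial>cube_measure) = 0"
proof -
  have "\<bar>\<Sum>j\<in>J. \<integral>x. e j x * H j x \<partial>cube_measure\<bar> \<le> 0 + \<eta>" if \<eta>: "\<eta> > 0" for \<eta>
  proof -
    define \<epsilon> where "\<epsilon> = \<eta> / (real (card J) + 1)"
    have \<epsilon>: "\<epsilon> > 0" using \<eta> by (simp add: \<epsilon>_def)
    define good where "good j r \<longleftrightarrow> 0 < r \<and> r < 1 \<and> (\<forall>d. 0 < d \<and> d < r \<longrightarrow>
      \<bar>(\<integral>y. \<integral>x. e j y * H j x * bump_kernel d y x \<partial>cube_measure \<partial>cube_measure) - bump_mass d * (\<integral>x. e j x * H j x \<partial>cube_measure)\<bar>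
        \<le> \<epsilon> * bump_mass d)" for j r
    have "\<forall>j\<in>J. \<exists>r. good j r"
    proof
      fix j assume j: "j \<in> J"
      show "\<exists>r. good j r"
        by (rule kernel_limit[OF e[OF j] H[OF j] \<epsilon>]) (auto simp: good_def)
    qed
    then obtain r where r: "\<And>j. j \<in> J \<Longrightarrow> good j (r j)" using bchoice[of J good] by blast
    \<comment> \<open>Half of the minimum stays strictly below every \<open>r j\<close>; inserting 1
      keeps the set nonempty when \<open>J\<close> is empty and the radius below 1.\<close>
    define d where "d = Min (insert 1 (r ` J)) / 2"
    have Min: "Min (insert 1 (r ` J)) > 0" "Min (insert 1 (r ` J)) \<le> 1" "\<And>j. j \<in> J \<Longrightarrow> Min (insert 1 (r ` J)) \<le> r j"
      using J r by (auto simp: good_def)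
    then have d: "0 < d" "d < 1" "\<And>j. j \<in> J \<Longrightarrow> d < r j" unfolding d_def by force+
    have m: "bump_mass d > 0" by (rule bump_mass_pos[OF d(1,2)])
    let ?D = "\<lambda>j. (\<integral>y. \<integral>x. e j y * H j x * bump_kernel d y x \<partial>cube_measure \<partial>cube_measure)"
    have "bump_mass d * \<bar>\<Sum>j\<in>J. \<integral>x. e j x * H j x \<partial>cube_measure\<bar>
        = \<bar>\<Sum>j\<in>J. ?D j - bump_mass d * (\<integral>x. e j x * H j x \<partial>cube_measure)\<bar>"
      using kernel_energy_zero[OF J e H B weak d(1,2)] m by (simp add: sum_subtractf abs_mult flip: sum_distrib_left)
    also have "\<dots> \<le> (\<Sum>j\<in>J. \<epsilon> * bump_mass d)"
      using r d by (intro order_trans[OF sum_abs] sum_mono) (auto simp: good_def)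
    also have "\<dots> \<le> bump_mass d * \<eta>"
    proof -
      have "real (card J) * \<epsilon> \<le> \<eta>" using \<eta> by (simp add: \<epsilon>_def field_simps)
      then have "bump_mass d * (real (card J) * \<epsilon>) \<le> bump_mass d * \<eta>" using m by (intro mult_left_mono) auto
      then show ?thesis by (simp add: mult_ac)
    qed
    finally show ?thesis using m by simp
  qed
  then have "\<bar>\<Sum>j\<in>J. \<integral>x. e j x * H j x \<partial>cube_measure\<bar> \<le> 0" by (rule field_le_epsilon)
  then show ?thesis by simp
qed

section \<open>Gluing weak derivatives across the faces of the cube\<close>

interpretation phase: pair_sigma_finite cube_measure sphere_measure ..

lemma finite_measure_phase: "finite_measure phase_measure"
  by (intro finite_measure_pair_measure finite_measure_cube finite_measure_sphere)

interpretation phase: finite_measure phase_measure by (rule finite_measure_phase)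

text \<open>The squared sine vanishes exactly on the planes where x_j is an integer and is periodic.
  The cut-off is therefore a function on the torus that vanishes near these planes, and it may
  multiply periodized test functions.\<close>

definition cut :: "nat \<Rightarrow> 3 \<Rightarrow> vec3 \<Rightarrow> real" where
  "cut n j x = flat 0 (real n * (sin (pi * x $ j))\<^sup>2 - 1)"

definition cuts :: "3 \<Rightarrow> nat \<Rightarrow> vec3 \<Rightarrow> real" where
  "cuts i n x = (\<Prod>j\<in>UNIV - {i}. cut n j x)"

lemma Ck_cut: "Ck k (cut n j)"
proof -
  have "Ck k (\<lambda>x::vec3. sin (0 + pi * x $ j))" by (intro Ck_sin Ck_mult Ck_const Ck_nth)
  then show ?thesis
    unfolding cut_def[abs_def] power2_eq_square by (intro Ck_flat Ck_diff Ck_mult Ck_const) simp_all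
qed

lemma Ck_cuts: "Ck k (cuts i n)"
  unfolding cuts_def[abs_def] by (intro Ck_prod Ck_cut)

lemma cut_bounds: "0 \<le> cut n j x" "cut n j x \<le> 1"
  by (auto simp: cut_def flat_nonneg flat_0_le_1)

lemma cuts_bounds: "0 \<le> cuts i n x" "cuts i n x \<le> 1"
  unfolding cuts_def by (auto intro!: prod_nonneg prod_le_1 cut_bounds)

lemma sin_pi_pos: "0 < t \<Longrightarrow> t < 1 \<Longrightarrow> 0 < sin (pi * t)"
  by (rule sin_gt_zero) auto

lemma cut_tendsto: "x \<in> unit_cube \<Longrightarrow> (\<lambda>n. cut n j x) \<longlonglongrightarrow> 1"
  unfolding cut_def by (intro flat_0_tendsto_1) (use sin_pi_pos[of "x $ j"] in \<open>auto simp: unit_cube_def\<close>)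

lemma cuts_tendsto: "x \<in> unit_cube \<Longrightarrow> (\<lambda>n. cuts i n x) \<longlonglongrightarrow> 1"
  unfolding cuts_def using tendsto_prod[of "UNIV - {i}" "\<lambda>j n. cut n j x" "\<lambda>_. 1" sequentially] cut_tendsto by simp

lemma pd_indep:
  assumes f: "Ck (Suc 0) f" and const: "\<And>t x. f (x + t *\<^sub>R axis l 1) = f x"
  shows "pd f l x = 0"
proof -
  have "((\<lambda>t::real. x + t *\<^sub>R axis l 1) has_derivative (\<lambda>h. h *\<^sub>R axis l 1)) (at 0)"
    by (auto intro!: derivative_eq_intros)
  from has_derivative_compose[OF this has_frechet_derivative[OF f]]
  have "((\<lambda>t::real. f x) has_derivative (\<lambda>h. frechet_derivative f (at x) (h *\<^sub>R axis l 1))) (at 0)"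
    by (simp add: const)
  then have "(\<lambda>h::real. frechet_derivative f (at x) (h *\<^sub>R axis l 1)) = (\<lambda>_. 0)"
    using has_derivative_unique[OF _ has_derivative_const] by blast
  from fun_cong[OF this, of 1] show ?thesis by simp
qed

lemma pd_cut: "l \<noteq> i \<Longrightarrow> pd (cut n i) l x = 0"
  by (intro pd_indep Ck_cut) (simp add: cut_def axis_def)

lemma pd_cuts: "pd (cuts i n) i x = 0"
  by (intro pd_indep Ck_cuts) (simp add: cuts_def cut_def axis_def)

lemma cut_shift: "cut n j (x + shift_vec k) = cut n j x"
proof -
  have sz: "sin (pi * real_of_int (k $ j)) = 0" by (metis mult.commute sin_npi_int)
  have "sin (pi * x $ j + pi * real_of_int (k $ j)) = sin (pi * x $ j) * cos (pi * real_of_int (k $ j))"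
    by (simp add: sin_add sz)
  moreover have "(cos (pi * real_of_int (k $ j)))\<^sup>2 = 1"
    using sin_cos_squared_add[of "pi * real_of_int (k $ j)"] sz by simp
  ultimately show ?thesis by (simp add: cut_def distrib_left power_mult_distrib)
qed

lemma cuts_shift: "cuts i n (x + shift_vec k) = cuts i n x"
  by (simp add: cuts_def cut_shift)

lemma cut_nonzeroD: "cut n j x \<noteq> 0 \<Longrightarrow> 1 \<le> real n * (sin (pi * x $ j))\<^sup>2"
  unfolding cut_def using flat_zero[of "real n * (sin (pi * x $ j))\<^sup>2 - 1" 0] by force

text \<open>With the cut-offs in all three directions the product vanishes near every face. Its
  extension by zero is then a test function of the open cube, to which the derivatives given there
  apply.\<close>

lemma test_function_cutout:
  assumes \<psi>: "\<And>k. Ck k \<psi>"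
  shows "test_function unit_cube (\<lambda>x. if x \<in> unit_cube then \<psi> x * cuts i n x * cut m i x else 0)"
    and "x \<in> unit_cube \<Longrightarrow> pd (\<lambda>x. if x \<in> unit_cube then \<psi> x * cuts i n x * cut m i x else 0) l x
      = pd (\<lambda>x. \<psi> x * cuts i n x * cut m i x) l x"
proof -
  let ?f = "\<lambda>x. \<psi> x * cuts i n x * cut m i x"
  let ?K = "cbox 0 1 \<inter> (\<Inter>j. {x :: vec3. 1 \<le> real (if j = i then m else n) * (sin (pi * x $ j))\<^sup>2})"
  have Ck_f: "Ck k ?f" for k by (intro Ck_mult \<psi> Ck_cuts Ck_cut)
  have K: "compact ?K"
    by (intro compact_Int_closed closed_INT ballI closed_Collect_le continuous_intros compact_cbox)
  have KQ: "?K \<subseteq> unit_cube"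
  proof
    fix x assume x: "x \<in> ?K"
    have "0 < x $ j \<and> x $ j < 1" for j
    proof -
      have "sin (pi * x $ j) \<noteq> 0" using x by (auto dest!: spec[of _ j] simp: INT_iff)
      then have "x $ j \<noteq> 0" "x $ j \<noteq> 1" by auto
      moreover have "0 \<le> x $ j" "x $ j \<le> 1" using x by (auto simp: mem_box_cart)
      ultimately show ?thesis by linarith
    qed
    then show "x \<in> unit_cube" by (simp add: unit_cube_def)
  qed
  have open_Q: "open unit_cube" by (simp add: unit_cube_eq_box open_box)
  have zero: "?f x = 0" if x: "x \<in> unit_cube - ?K" for x
  proof (rule ccontr)
    assume "?f x \<noteq> 0"
    then have "cuts i n x \<noteq> 0" "cut m i x \<noteq> 0" by auto
    then have "\<And>j. j \<noteq> i \<Longrightarrow> cut n j x \<noteq> 0" by (auto simp: cuts_def)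
    then have "1 \<le> real (if j = i then m else n) * (sin (pi * x $ j))\<^sup>2" for j
      using cut_nonzeroD[OF \<open>cut m i x \<noteq> 0\<close>] cut_nonzeroD[of n j x] by auto
    moreover have "x \<in> cbox 0 1" using x box_subset_cbox[of "0::vec3" 1] by (auto simp: unit_cube_eq_box)
    ultimately show False using x by auto
  qed
  show "test_function unit_cube (\<lambda>x. if x \<in> unit_cube then ?f x else 0)"
    unfolding test_function_def
  proof (intro conjI allI exI[of _ ?K] K KQ impI)
    show "Ck k (\<lambda>x. if x \<in> unit_cube then ?f x else 0)" for k
      by (rule Ck_cutout[OF Ck_f open_Q compact_imp_closed[OF K] KQ zero])
    show "(if x \<in> unit_cube then ?f x else 0) = 0" if "x \<notin> ?K" for x using zero[of x] that by auto
  qed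
  show "pd (\<lambda>x. if x \<in> unit_cube then ?f x else 0) l x = pd ?f l x" if "x \<in> unit_cube"
  proof (rule pd_eq)
    show "((\<lambda>x. if x \<in> unit_cube then ?f x else 0) has_derivative frechet_derivative ?f (at x)) (at x)"
    proof (rule has_derivative_transform_within_open[where f="?f" and s=unit_cube])
      show "(?f has_derivative frechet_derivative ?f (at x)) (at x)"
        by (rule has_frechet_derivative[OF Ck_f])
    qed (use that open_Q in auto)
  qed
qed

lemma pd_outside:
  assumes "test_function A \<phi>" "x \<notin> A" shows "pd \<phi> i x = 0"
proof -
  obtain K where K: "compact K" "K \<subseteq> A" "\<And>x. x \<notin> K \<Longrightarrow> \<phi> x = 0"
    using assms(1) unfolding test_function_def by blast
  have "(\<phi> has_derivative (\<lambda>_. 0)) (at x)"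
  proof (rule has_derivative_transform_within_open[where f="\<lambda>_. 0" and s="- K"])
    show "((\<lambda>_. 0::real) has_derivative (\<lambda>_. 0)) (at x)" by (rule has_derivative_const)
    show "open (- K)" using compact_imp_closed[OF K(1)] by auto
  qed (use K assms(2) in auto)
  then show ?thesis by (simp add: pd_eq)
qed

lemma Ck_pd_continuous: "(\<And>n. Ck n \<phi>) \<Longrightarrow> continuous_on UNIV (pd \<phi> i)"
proof -
  assume "\<And>n. Ck n \<phi>"
  from this[of "Suc 0"] show ?thesis by simp
qed

lemma frechet_sum:
  assumes "Ck (Suc 0) \<phi>"
  shows "frechet_derivative \<phi> (at x) \<omega> = (\<Sum>i\<in>UNIV. \<omega> $ i * pd \<phi> i x)"
proof -
  have lin: "linear (frechet_derivative \<phi> (at x))"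
    using has_frechet_derivative[OF assms, of x] by (rule has_derivative_linear)
  have "\<omega> = (\<Sum>i\<in>UNIV. \<omega> $ i *\<^sub>R axis i 1)" by (simp add: vec_eq_iff axis_def if_distrib cong: if_cong)
  then have "frechet_derivative \<phi> (at x) \<omega> = frechet_derivative \<phi> (at x) (\<Sum>i\<in>UNIV. \<omega> $ i *\<^sub>R axis i 1)" by simp
  also have "\<dots> = (\<Sum>i\<in>UNIV. \<omega> $ i * pd \<phi> i x)"
    by (simp add: linear_sum[OF lin] linear_cmul[OF lin])
  finally show ?thesis .
qed

lemma integral_mult_cut_limit:
  assumes F: "integrable cube_measure F" and c: "\<And>n. continuous_on UNIV (c n)"
    and bounds: "\<And>n x. \<bar>c n x\<bar> \<le> 1" and lim: "\<And>x. x \<in> unit_cube \<Longrightarrow> (\<lambda>n. c n x) \<longlonglongrightarrow> 1"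
  shows "(\<lambda>n. \<integral>x. F x * c n x \<partial>cube_measure) \<longlonglongrightarrow> (\<integral>x. F x \<partial>cube_measure :: real)"
proof -
  have [measurable]: "c n \<in> borel_measurable cube_measure" for n
    by (intro borel_measurable_cube borel_measurable_continuous_onI c)
  note [measurable] = borel_measurable_integrable[OF F]
  show ?thesis
  proof (rule integral_dominated_convergence[where w="\<lambda>x. \<bar>F x\<bar>"])
    show "AE x in cube_measure. (\<lambda>n. F x * c n x) \<longlonglongrightarrow> F x"
      using lim by (intro AE_I2) (auto intro!: tendsto_eq_intros)
    show "AE x in cube_measure. norm (F x * c n x) \<le> \<bar>F x\<bar>" for n
      using bounds by (intro AE_I2) (auto simp: abs_mult mult_left_le)
  qed (use F in auto)
qed

text \<open>For a fixed direction \<open>\<omega>\<close>: cutting off near all faces except those orthogonal to the \<open>i\<close>-th axis leaves only the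
  jump of \<open>v\<close> across the latter, and the transport equation multiplies it by \<open>\<omega>\<^sub>i \<noteq> 0\<close>. The cut-offs in the
  directions other than \<open>i\<close> commute with \<open>\<partial>\<^sub>i\<close>, so they can be removed in the limit.\<close>

lemma glue_pointwise:
  fixes v g :: "vec3 \<Rightarrow> real" and D :: "3 \<Rightarrow> vec3 \<Rightarrow> real" and \<omega> :: vec3
  assumes v: "integrable cube_measure v" and g: "integrable cube_measure g" and D: "\<And>l. integrable cube_measure (D l)"
    and \<Phi>: "\<And>k. Ck k \<Phi>" and \<omega>: "\<omega> $ i \<noteq> 0"
    and int: "\<And>n m l. (\<integral>x. v x * pd (\<lambda>x. \<Phi> x * cuts i n x * cut m i x) l x \<partial>cube_measure)
        = - (\<integral>x. D l x * (\<Phi> x * cuts i n x * cut m i x) \<partial>cube_measure)"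
    and int2: "\<And>n m. (\<Sum>l\<in>UNIV. \<omega> $ l * (\<integral>x. v x * pd (\<lambda>x. \<Phi> x * cuts i n x * cut m i x) l x \<partial>cube_measure))
        = - (\<integral>x. g x * (\<Phi> x * cuts i n x * cut m i x) \<partial>cube_measure)"
    and glob: "\<And>n. (\<Sum>l\<in>UNIV. \<omega> $ l * (\<integral>x. v x * pd (\<lambda>x. \<Phi> x * cuts i n x) l x \<partial>cube_measure))
        = - (\<integral>x. g x * (\<Phi> x * cuts i n x) \<partial>cube_measure)"
  shows "(\<integral>x. v x * pd \<Phi> i x \<partial>cube_measure) = - (\<integral>x. D i x * \<Phi> x \<partial>cube_measure)"
    "(\<integral>x. g x * \<Phi> x \<partial>cube_measure) = (\<Sum>l\<in>UNIV. \<omega> $ l * (\<integral>x. D l x * \<Phi> x \<partial>cube_measure))"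
proof -
  have ck: "Ck k (\<lambda>x. \<Phi> x * cuts i n x)" for k n by (intro Ck_mult \<Phi> Ck_cuts)
  have cont: "continuous_on UNIV (\<lambda>x. \<Phi> x * cuts i n x)" for n using Ck_continuous[OF ck[of 0]] .
  have contp: "continuous_on UNIV (pd (\<lambda>x. \<Phi> x * cuts i n x) l)" for n l by (rule Ck_pd_continuous[OF ck])
  have contPhi: "continuous_on UNIV \<Phi>" "continuous_on UNIV (pd \<Phi> l)" for l
    using Ck_continuous[OF \<Phi>[of 0]] Ck_pd_continuous[OF \<Phi>] by auto
  have lim_m: "(\<lambda>m. \<integral>x. F x * cut m i x \<partial>cube_measure) \<longlonglongrightarrow> (\<integral>x. F x \<partial>cube_measure)"
    if "integrable cube_measure F" for F
    using that cut_bounds cut_tendsto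
    by (intro integral_mult_cut_limit Ck_continuous[OF Ck_cut[of 0]]) (auto simp: abs_le_iff intro: order_trans[of _ 0])
  have lim_n: "(\<lambda>n. \<integral>x. F x * cuts i n x \<partial>cube_measure) \<longlonglongrightarrow> (\<integral>x. F x \<partial>cube_measure)"
    if "integrable cube_measure F" for F
    using that cuts_bounds cuts_tendsto
    by (intro integral_mult_cut_limit Ck_continuous[OF Ck_cuts[of 0]]) (auto simp: abs_le_iff intro: order_trans[of _ 0])
  have D_n: "(\<lambda>m. \<integral>x. F x * (\<Phi> x * cuts i n x * cut m i x) \<partial>cube_measure) \<longlonglongrightarrow> (\<integral>x. F x * (\<Phi> x * cuts i n x) \<partial>cube_measure)"
    if F: "integrable cube_measure F" for F n
    using lim_m[OF integrable_cube_mult_continuous[OF F cont[of n]]] by (simp add: mult.assoc)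
  have F_n: "(\<lambda>n. \<integral>x. F x * (\<Phi> x * cuts i n x) \<partial>cube_measure) \<longlonglongrightarrow> (\<integral>x. F x * \<Phi> x \<partial>cube_measure)"
    if F: "integrable cube_measure F" for F
    using lim_n[OF integrable_cube_mult_continuous[OF F contPhi(1)]] by (simp add: mult.assoc)
  \<comment> \<open>For \<open>l \<noteq> i\<close> the cut-off in direction i commutes with the
    l-th derivative. It can be removed in the limit, although the resulting function no longer
    vanishes at the faces orthogonal to the i-th axis.\<close>
  have other: "(\<integral>x. v x * pd (\<lambda>x. \<Phi> x * cuts i n x) l x \<partial>cube_measure) = - (\<integral>x. D l x * (\<Phi> x * cuts i n x) \<partial>cube_measure)"
    if l: "l \<noteq> i" for l n
  proof (rule LIMSEQ_unique)
    have "pd (\<lambda>x. \<Phi> x * cuts i n x * cut m i x) l x = pd (\<lambda>x. \<Phi> x * cuts i n x) l x * cut m i x" for m x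
      by (subst pd_mult[OF ck Ck_cut]) (simp add: pd_cut[OF l])
    then show "(\<lambda>m. \<integral>x. v x * pd (\<lambda>x. \<Phi> x * cuts i n x * cut m i x) l x \<partial>cube_measure)
        \<longlonglongrightarrow> (\<integral>x. v x * pd (\<lambda>x. \<Phi> x * cuts i n x) l x \<partial>cube_measure)"
      using lim_m[OF integrable_cube_mult_continuous[OF v contp[of n l]]] by (simp add: mult.assoc)
    show "(\<lambda>m. \<integral>x. v x * pd (\<lambda>x. \<Phi> x * cuts i n x * cut m i x) l x \<partial>cube_measure)
        \<longlonglongrightarrow> - (\<integral>x. D l x * (\<Phi> x * cuts i n x) \<partial>cube_measure)"
      unfolding int by (intro tendsto_minus D_n D)
  qed
  \<comment> \<open>The same limit identifies \<open>g\<close> with the combination of the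
    \<open>D l\<close>. This side contains no derivative of the test function, so the cut-off in
    direction i disappears without harm.\<close>
  have gD: "(\<integral>x. g x * (\<Phi> x * cuts i n x) \<partial>cube_measure) = (\<Sum>l\<in>UNIV. \<omega> $ l * (\<integral>x. D l x * (\<Phi> x * cuts i n x) \<partial>cube_measure))" for n
  proof (rule LIMSEQ_unique)
    show "(\<lambda>m. \<integral>x. g x * (\<Phi> x * cuts i n x * cut m i x) \<partial>cube_measure) \<longlonglongrightarrow> (\<integral>x. g x * (\<Phi> x * cuts i n x) \<partial>cube_measure)"
      by (rule D_n[OF g])
    have "(\<integral>x. g x * (\<Phi> x * cuts i n x * cut m i x) \<partial>cube_measure)
        = (\<Sum>l\<in>UNIV. \<omega> $ l * (\<integral>x. D l x * (\<Phi> x * cuts i n x * cut m i x) \<partial>cube_measure))" for m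
      using int2[of n m] unfolding int by (simp add: sum_negf)
    then show "(\<lambda>m. \<integral>x. g x * (\<Phi> x * cuts i n x * cut m i x) \<partial>cube_measure)
        \<longlonglongrightarrow> (\<Sum>l\<in>UNIV. \<omega> $ l * (\<integral>x. D l x * (\<Phi> x * cuts i n x) \<partial>cube_measure))"
      using D_n[OF D] by (simp only:) (intro tendsto_sum tendsto_mult tendsto_const)
  qed
  \<comment> \<open>Subtracting \<open>gD\<close> from the global transport identity, the terms with
    \<open>l \<noteq> i\<close> vanish by \<open>other\<close>. What remains is \<omega>_i times the
    wanted identity, and \<omega>_i is nonzero.\<close>
  have same: "(\<integral>x. v x * pd (\<lambda>x. \<Phi> x * cuts i n x) i x \<partial>cube_measure) = - (\<integral>x. D i x * (\<Phi> x * cuts i n x) \<partial>cube_measure)" for n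
  proof -
    let ?a = "\<lambda>l. \<integral>x. v x * pd (\<lambda>x. \<Phi> x * cuts i n x) l x \<partial>cube_measure"
    let ?b = "\<lambda>l. \<integral>x. D l x * (\<Phi> x * cuts i n x) \<partial>cube_measure"
    have "(\<Sum>l\<in>UNIV. \<omega> $ l * (?a l + ?b l)) = 0"
      using glob[of n] gD[of n] by (simp add: distrib_left sum.distrib)
    moreover have "(\<Sum>l\<in>UNIV. \<omega> $ l * (?a l + ?b l)) = \<omega> $ i * (?a i + ?b i) + (\<Sum>l\<in>UNIV - {i}. \<omega> $ l * (?a l + ?b l))"
      by (rule sum.remove) auto
    moreover have "(\<Sum>l\<in>UNIV - {i}. \<omega> $ l * (?a l + ?b l)) = 0"
      using other by (intro sum.neutral) auto
    ultimately show ?thesis using \<omega> by auto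
  qed
  show "(\<integral>x. v x * pd \<Phi> i x \<partial>cube_measure) = - (\<integral>x. D i x * \<Phi> x \<partial>cube_measure)"
  proof (rule LIMSEQ_unique)
    have "pd (\<lambda>x. \<Phi> x * cuts i n x) i x = pd \<Phi> i x * cuts i n x" for n x
      by (subst pd_mult[OF \<Phi> Ck_cuts]) (simp add: pd_cuts)
    then show "(\<lambda>n. \<integral>x. v x * pd (\<lambda>x. \<Phi> x * cuts i n x) i x \<partial>cube_measure) \<longlonglongrightarrow> (\<integral>x. v x * pd \<Phi> i x \<partial>cube_measure)"
      using lim_n[OF integrable_cube_mult_continuous[OF v contPhi(2)[of i]]] by (simp add: mult.assoc)
    show "(\<lambda>n. \<integral>x. v x * pd (\<lambda>x. \<Phi> x * cuts i n x) i x \<partial>cube_measure) \<longlonglongrightarrow> - (\<integral>x. D i x * \<Phi> x \<partial>cube_measure)"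
      unfolding same by (intro tendsto_minus F_n D)
  qed
  show "(\<integral>x. g x * \<Phi> x \<partial>cube_measure) = (\<Sum>l\<in>UNIV. \<omega> $ l * (\<integral>x. D l x * \<Phi> x \<partial>cube_measure))"
  proof (rule LIMSEQ_unique[OF F_n[OF g]])
    show "(\<lambda>n. \<integral>x. g x * (\<Phi> x * cuts i n x) \<partial>cube_measure) \<longlonglongrightarrow> (\<Sum>l\<in>UNIV. \<omega> $ l * (\<integral>x. D l x * \<Phi> x \<partial>cube_measure))"
      unfolding gD by (intro tendsto_sum tendsto_mult tendsto_const F_n D)
  qed
qed

section \<open>Gluing for almost every direction\<close>

text \<open>Lets functions supported in the cube enter the torus statements with the single shift 0,
  so that periodization leaves them unchanged.\<close>

lemma covers_0: "(\<And>x. x \<notin> unit_cube \<Longrightarrow> \<phi> x = 0) \<Longrightarrow> covers 0 \<phi>"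
  unfolding covers_def
proof (intro ballI allI impI)
  fix x k assume z: "\<And>x. x \<notin> unit_cube \<Longrightarrow> \<phi> x = 0" and x: "x \<in> unit_cube" and "k \<notin> shifts 0"
  then have "k \<noteq> 0" by (auto simp: shifts_def)
  then show "\<phi> (x + shift_vec k) = 0" using unit_cube_shift_eq[OF x] z by blast
qed

lemma periodized_0: "periodized 0 \<phi> = \<phi>"
proof -
  have "shifts 0 = {0}" by (auto simp: shifts_def vec_eq_iff)
  moreover have "shift_vec 0 = 0" by (simp add: vec_eq_iff)
  ultimately show ?thesis by (simp add: periodized_def[abs_def])
qed

lemma test_function_zero_outside: "test_function A \<phi> \<Longrightarrow> x \<notin> A \<Longrightarrow> \<phi> x = 0"
  unfolding test_function_def by blast

lemma periodized_test_covers: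
  assumes "test_function unit_cube \<phi>"
  shows "covers 0 \<phi>" "covers 0 (pd \<phi> i)"
  using test_function_zero_outside[OF assms] pd_outside[OF assms] by (auto intro!: covers_0)

lemma phase_section_borel:
  assumes "v \<in> borel_measurable (lborel \<Otimes>\<^sub>M sphere_measure)" "\<omega> \<in> sphere 0 1"
  shows "(\<lambda>x. v (x, \<omega>)) \<in> borel_measurable borel"
proof -
  have "(\<lambda>x. (x, \<omega>)) \<in> measurable lborel (lborel \<Otimes>\<^sub>M sphere_measure)"
    using assms(2) by (intro measurable_Pair2') simp
  from measurable_compose[OF this assms(1)] show ?thesis by simp
qed

lemma periodic_section:
  assumes v: "periodic_L2_phase v" and \<omega>: "\<omega> \<in> sphere 0 1"
  shows "(\<lambda>x. v (x, \<omega>)) \<in> borel_measurable borel" "v (x + axis i 1, \<omega>) = v (x, \<omega>)"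
proof -
  have "v \<in> borel_measurable (lborel \<Otimes>\<^sub>M sphere_measure)" using v unfolding periodic_L2_phase_def by blast
  then show "(\<lambda>x. v (x, \<omega>)) \<in> borel_measurable borel" using \<omega> by (rule phase_section_borel)
  show "v (x + axis i 1, \<omega>) = v (x, \<omega>)" using v \<omega> unfolding periodic_L2_phase_def by blast
qed

lemma AE_sphere_integrable:
  assumes "integrable phase_measure v" shows "AE \<omega> in sphere_measure. integrable cube_measure (\<lambda>x. v (x, \<omega>) :: real)"
  using phase.AE_integrable_snd[of "\<lambda>x \<omega>. v (x, \<omega>)"] assms by simp

lemma AE_cube_integrable:
  assumes "integrable phase_measure v" shows "AE x in cube_measure. integrable sphere_measure (\<lambda>\<omega>. v (x, \<omega>) :: real)"
  using phase.AE_integrable_fst'[OF assms] by simp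

text \<open>The transport identity is unfolded to the cube for each good direction separately. The
  exceptional null set still depends on \<phi>.\<close>

lemma weak_dir_deriv_torus:
  assumes u: "periodic_L2_phase u" and g: "periodic_L2_phase g" and weak: "weak_dir_deriv UNIV (\<lambda>\<omega>. \<omega>) u g"
    and \<phi>: "test_function UNIV \<phi>" and cov: "covers M \<phi>" "\<And>i. covers M (pd \<phi> i)"
  shows "AE \<omega> in sphere_measure.
    (\<Sum>l\<in>UNIV. \<omega> $ l * (\<integral>x. u (x, \<omega>) * pd (periodized M \<phi>) l x \<partial>cube_measure))
      = - (\<integral>x. g (x, \<omega>) * periodized M \<phi> x \<partial>cube_measure)"
proof -
  have ui: "integrable phase_measure u" and gi: "integrable phase_measure g"
    using u g by (auto simp: periodic_L2_phase_def intro: phase.integrable_L2)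
  have Ck: "Ck n \<phi>" for n by (rule test_function_Ck[OF \<phi>])
  have AE_w: "AE \<omega> in sphere_measure. (LINT x:UNIV|lborel. u (x, \<omega>) * frechet_derivative \<phi> (at x) \<omega>)
      = - (LINT x:UNIV|lborel. g (x, \<omega>) * \<phi> x)"
    using weak \<phi> unfolding weak_dir_deriv_def by blast
  have AE_s: "AE \<omega> in sphere_measure. \<omega> \<in> sphere 0 1" by (rule AE_I2) (simp only: space_sphere_measure)
  show ?thesis
    using AE_w AE_s AE_sphere_integrable[OF ui] AE_sphere_integrable[OF gi]
  proof eventually_elim
    case (elim \<omega>)
    note pu = periodic_integral[where F="\<lambda>x. u (x, \<omega>)", OF periodic_section(1)[OF u elim(2)] periodic_section(2)[OF u elim(2)] elim(3)]
      and pg = periodic_integral[where F="\<lambda>x. g (x, \<omega>)", OF periodic_section(1)[OF g elim(2)] periodic_section(2)[OF g elim(2)] elim(4)]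
    have "(\<integral>x. u (x, \<omega>) * frechet_derivative \<phi> (at x) \<omega> \<partial>lborel)
        = (\<integral>x. (\<Sum>l\<in>UNIV. \<omega> $ l * (u (x, \<omega>) * pd \<phi> l x)) \<partial>lborel)"
      by (simp add: frechet_sum[OF Ck, where \<omega>=\<omega>] sum_distrib_left mult_ac)
    also have "\<dots> = (\<Sum>l\<in>UNIV. \<omega> $ l * (\<integral>x. u (x, \<omega>) * pd \<phi> l x \<partial>lborel))"
      using pu(1)[OF Ck_pd_continuous[OF Ck] cov(2)] by simp
    also have "\<dots> = (\<Sum>l\<in>UNIV. \<omega> $ l * (\<integral>x. u (x, \<omega>) * pd (periodized M \<phi>) l x \<partial>cube_measure))"
      using pu(2)[OF Ck_pd_continuous[OF Ck] cov(2)] by (simp add: pd_periodized[OF Ck])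
    finally have 1: "(\<integral>x. u (x, \<omega>) * frechet_derivative \<phi> (at x) \<omega> \<partial>lborel) = \<dots>" .
    have 2: "(\<integral>x. g (x, \<omega>) * \<phi> x \<partial>lborel) = (\<integral>x. g (x, \<omega>) * periodized M \<phi> x \<partial>cube_measure)"
      by (rule pg(2)[OF Ck_continuous[OF Ck[of 0]] cov(1)])
    show ?case using elim(1) 1 2 by (simp add: set_lebesgue_integral_def)
  qed
qed

lemma integral_cube_eq: "(LINT x:unit_cube|lborel. f x) = (\<integral>x. f x \<partial>cube_measure :: real)"
  by (simp add: set_lebesgue_integral_def integral_restrict_space)

text \<open>The cut-offs are indexed by natural numbers, so the exceptional sets for all
  \<open>n\<close>, \<open>m\<close> and \<open>l\<close> form one null set; outside it
  \<open>glue_pointwise\<close> applies to a fixed direction.\<close>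

theorem glue_AE:
  assumes u: "periodic_L2_phase u" and g: "periodic_L2_phase g" and weak: "weak_dir_deriv UNIV (\<lambda>\<omega>. \<omega>) u g"
    and D: "\<And>i. weak_dir_deriv unit_cube (\<lambda>\<omega>. axis i 1) u (D i)" "\<And>i. integrable phase_measure (D i)"
    and \<phi>: "test_function UNIV \<phi>" and cov: "covers M \<phi>" "\<And>i. covers M (pd \<phi> i)"
  shows "AE \<omega> in sphere_measure.
      (\<integral>x. u (x, \<omega>) * pd (periodized M \<phi>) i x \<partial>cube_measure) = - (\<integral>x. D i (x, \<omega>) * periodized M \<phi> x \<partial>cube_measure)"
    "AE \<omega> in sphere_measure.
      (\<integral>x. g (x, \<omega>) * periodized M \<phi> x \<partial>cube_measure) = (\<Sum>l\<in>UNIV. \<omega> $ l * (\<integral>x. D l (x, \<omega>) * periodized M \<phi> x \<partial>cube_measure))"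
proof -
  let ?\<Phi> = "periodized M \<phi>"
  have ui: "integrable phase_measure u" and gi: "integrable phase_measure g"
    using u g by (auto simp: periodic_L2_phase_def intro: phase.integrable_L2)
  have Ck: "Ck k \<phi>" for k by (rule test_function_Ck[OF \<phi>])
  have Ck\<Phi>: "Ck k ?\<Phi>" for k by (intro Ck_periodized Ck)
  have main: "AE \<omega> in sphere_measure.
      (\<integral>x. u (x, \<omega>) * pd ?\<Phi> i x \<partial>cube_measure) = - (\<integral>x. D i (x, \<omega>) * ?\<Phi> x \<partial>cube_measure) \<and>
      (\<integral>x. g (x, \<omega>) * ?\<Phi> x \<partial>cube_measure) = (\<Sum>l\<in>UNIV. \<omega> $ l * (\<integral>x. D l (x, \<omega>) * ?\<Phi> x \<partial>cube_measure))" for i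
  proof -
    define tf where "tf n m = (\<lambda>x. if x \<in> unit_cube then ?\<Phi> x * cuts i n x * cut m i x else 0)" for n m
    have tf: "test_function unit_cube (tf n m)" for n m unfolding tf_def by (rule test_function_cutout(1)[OF Ck\<Phi>])
    have pdtf: "x \<in> unit_cube \<Longrightarrow> pd (tf n m) l x = pd (\<lambda>x. ?\<Phi> x * cuts i n x * cut m i x) l x" for n m l x
      unfolding tf_def by (rule test_function_cutout(2)[OF Ck\<Phi>])
    have ae_int: "AE \<omega> in sphere_measure. \<forall>n m l. (\<integral>x. u (x, \<omega>) * pd (\<lambda>x. ?\<Phi> x * cuts i n x * cut m i x) l x \<partial>cube_measure)
        = - (\<integral>x. D l (x, \<omega>) * (?\<Phi> x * cuts i n x * cut m i x) \<partial>cube_measure)"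
      unfolding AE_all_countable
    proof (intro allI)
      fix n m l
      have "AE \<omega> in sphere_measure. (\<integral>x. u (x, \<omega>) * pd (tf n m) l x \<partial>cube_measure) = - (\<integral>x. D l (x, \<omega>) * tf n m x \<partial>cube_measure)"
        using D(1)[of l] tf unfolding weak_dir_deriv_def integral_cube_eq by blast
      moreover have "(\<integral>x. u (x, \<omega>) * pd (tf n m) l x \<partial>cube_measure)
          = (\<integral>x. u (x, \<omega>) * pd (\<lambda>x. ?\<Phi> x * cuts i n x * cut m i x) l x \<partial>cube_measure)"
        "(\<integral>x. D l (x, \<omega>) * tf n m x \<partial>cube_measure) = (\<integral>x. D l (x, \<omega>) * (?\<Phi> x * cuts i n x * cut m i x) \<partial>cube_measure)" for \<omega>
        by (intro Bochner_Integration.integral_cong refl, simp add: pdtf)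
           (intro Bochner_Integration.integral_cong refl, simp add: tf_def)
      ultimately show "AE \<omega> in sphere_measure. (\<integral>x. u (x, \<omega>) * pd (\<lambda>x. ?\<Phi> x * cuts i n x * cut m i x) l x \<partial>cube_measure)
        = - (\<integral>x. D l (x, \<omega>) * (?\<Phi> x * cuts i n x * cut m i x) \<partial>cube_measure)" by simp
    qed
    have ae_int2: "AE \<omega> in sphere_measure. \<forall>n m. (\<Sum>l\<in>UNIV. \<omega> $ l * (\<integral>x. u (x, \<omega>) * pd (\<lambda>x. ?\<Phi> x * cuts i n x * cut m i x) l x \<partial>cube_measure))
        = - (\<integral>x. g (x, \<omega>) * (?\<Phi> x * cuts i n x * cut m i x) \<partial>cube_measure)"
      unfolding AE_all_countable
    proof (intro allI)
      fix n m
      have "AE \<omega> in sphere_measure. (\<Sum>l\<in>UNIV. \<omega> $ l * (\<integral>x. u (x, \<omega>) * pd (tf n m) l x \<partial>cube_measure)) = - (\<integral>x. g (x, \<omega>) * tf n m x \<partial>cube_measure)"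
        using weak_dir_deriv_torus[OF u g weak test_function_mono[OF tf[of n m]] periodized_test_covers(1)[OF tf[of n m]]
          periodized_test_covers(2)[OF tf[of n m]]] by (simp add: periodized_0)
      moreover have "(\<integral>x. u (x, \<omega>) * pd (tf n m) l x \<partial>cube_measure)
          = (\<integral>x. u (x, \<omega>) * pd (\<lambda>x. ?\<Phi> x * cuts i n x * cut m i x) l x \<partial>cube_measure)"
        "(\<integral>x. g (x, \<omega>) * tf n m x \<partial>cube_measure) = (\<integral>x. g (x, \<omega>) * (?\<Phi> x * cuts i n x * cut m i x) \<partial>cube_measure)" for \<omega> l
        by (intro Bochner_Integration.integral_cong refl, simp add: pdtf)
           (intro Bochner_Integration.integral_cong refl, simp add: tf_def)
      ultimately show "AE \<omega> in sphere_measure. (\<Sum>l\<in>UNIV. \<omega> $ l * (\<integral>x. u (x, \<omega>) * pd (\<lambda>x. ?\<Phi> x * cuts i n x * cut m i x) l x \<partial>cube_measure))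
        = - (\<integral>x. g (x, \<omega>) * (?\<Phi> x * cuts i n x * cut m i x) \<partial>cube_measure)" by simp
    qed
    have ae_glob: "AE \<omega> in sphere_measure. \<forall>n. (\<Sum>l\<in>UNIV. \<omega> $ l * (\<integral>x. u (x, \<omega>) * pd (\<lambda>x. ?\<Phi> x * cuts i n x) l x \<partial>cube_measure))
        = - (\<integral>x. g (x, \<omega>) * (?\<Phi> x * cuts i n x) \<partial>cube_measure)"
      unfolding AE_all_countable
    proof (intro allI)
      fix n
      have test: "test_function UNIV (\<lambda>x. cuts i n x * \<phi> x)" by (intro test_function_mult \<phi> Ck_cuts)
      have c1: "covers M (\<lambda>x. cuts i n x * \<phi> x)" using cov(1) by (simp add: covers_def)
      have c2: "covers M (pd (\<lambda>x. cuts i n x * \<phi> x) l)" for l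
        using cov unfolding covers_def by (simp add: pd_mult[OF Ck_cuts Ck])
      \<comment> \<open>The cut-offs are invariant under integer shifts and can be pulled out of the
        periodization. Hence the cut-off function is the periodization of a test function on the
        whole space.\<close>
      have eq: "periodized M (\<lambda>x. cuts i n x * \<phi> x) = (\<lambda>x. ?\<Phi> x * cuts i n x)"
        by (simp add: periodized_def[abs_def] cuts_shift sum_distrib_left mult.commute)
      show "AE \<omega> in sphere_measure. (\<Sum>l\<in>UNIV. \<omega> $ l * (\<integral>x. u (x, \<omega>) * pd (\<lambda>x. ?\<Phi> x * cuts i n x) l x \<partial>cube_measure))
        = - (\<integral>x. g (x, \<omega>) * (?\<Phi> x * cuts i n x) \<partial>cube_measure)"
        using weak_dir_deriv_torus[OF u g weak test c1 c2] unfolding eq .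
    qed
    have ae_D: "AE \<omega> in sphere_measure. \<forall>l. integrable cube_measure (\<lambda>x. D l (x, \<omega>))"
      unfolding AE_all_countable using AE_sphere_integrable[OF D(2)] by blast
    show ?thesis
      using ae_int ae_int2 ae_glob ae_D AE_sphere_integrable[OF ui] AE_sphere_integrable[OF gi] AE_sphere_nth_neq_0[of i]
    proof eventually_elim
      case (elim \<omega>)
      show ?case
        using glue_pointwise[where v="\<lambda>x. u (x, \<omega>)" and g="\<lambda>x. g (x, \<omega>)" and D="\<lambda>l x. D l (x, \<omega>)" and \<Phi>="?\<Phi>" and i=i and \<omega>=\<omega>]
          elim Ck\<Phi> by blast
    qed
  qed
  show "AE \<omega> in sphere_measure.
      (\<integral>x. u (x, \<omega>) * pd ?\<Phi> i x \<partial>cube_measure) = - (\<integral>x. D i (x, \<omega>) * ?\<Phi> x \<partial>cube_measure)"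
    using main[of i] by eventually_elim blast
  show "AE \<omega> in sphere_measure.
      (\<integral>x. g (x, \<omega>) * ?\<Phi> x \<partial>cube_measure) = (\<Sum>l\<in>UNIV. \<omega> $ l * (\<integral>x. D l (x, \<omega>) * ?\<Phi> x \<partial>cube_measure))"
    using main[of 1] by eventually_elim blast
qed

section \<open>Fubini and angular moments on the phase space\<close>

lemma integrable_phase_mult:
  assumes v: "integrable phase_measure v" and b: "continuous_on UNIV b" and \<psi>: "continuous_on UNIV \<psi>"
  shows "integrable phase_measure (\<lambda>p. b (snd p) * v p * \<psi> (fst p) :: real)"
proof -
  obtain B where B: "\<And>x. x \<in> unit_cube \<Longrightarrow> \<bar>\<psi> x\<bar> \<le> B" using continuous_bounded_on_cube[OF \<psi>] by blast
  have "compact (b ` sphere 0 1)"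
    using b by (intro compact_continuous_image) (auto intro: continuous_on_subset)
  then obtain C where C: "\<And>x. x \<in> sphere 0 1 \<Longrightarrow> \<bar>b x\<bar> \<le> C"
    using compact_imp_bounded bounded_iff by (metis imageI real_norm_def)
  have [measurable]: "b \<in> borel_measurable sphere_measure" "\<psi> \<in> borel_measurable cube_measure"
    by (intro borel_measurable_sphere borel_measurable_cube borel_measurable_continuous_onI b \<psi>)+
  note [measurable] = borel_measurable_integrable[OF v]
  have "integrable phase_measure (\<lambda>p. C * B * v p)" by (intro Bochner_Integration.integrable_mult_right v)
  then show ?thesis
  proof (rule Bochner_Integration.integrable_bound)
    show "AE p in phase_measure. norm (b (snd p) * v p * \<psi> (fst p)) \<le> norm (C * B * v p)"
    proof (rule AE_I2)
      fix p assume "p \<in> space phase_measure"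
      then have "\<bar>b (snd p)\<bar> \<le> \<bar>C\<bar>" "\<bar>\<psi> (fst p)\<bar> \<le> \<bar>B\<bar>"
        using B[of "fst p"] C[of "snd p"] by (force simp: space_pair_measure)+
      then have "\<bar>b (snd p)\<bar> * \<bar>\<psi> (fst p)\<bar> * \<bar>v p\<bar> \<le> \<bar>C\<bar> * \<bar>B\<bar> * \<bar>v p\<bar>" by (intro mult_right_mono mult_mono) auto
      then show "norm (b (snd p) * v p * \<psi> (fst p)) \<le> norm (C * B * v p)" by (simp add: abs_mult mult_ac)
    qed
  qed measurable
qed

lemma phase_fubini:
  fixes v :: "vec3 \<times> vec3 \<Rightarrow> real" and b \<psi> :: "vec3 \<Rightarrow> real"
  assumes v: "integrable phase_measure v" and b: "continuous_on UNIV b" and \<psi>: "continuous_on UNIV \<psi>"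
  shows "(\<integral>\<omega>. b \<omega> * (\<integral>x. v (x, \<omega>) * \<psi> x \<partial>cube_measure) \<partial>sphere_measure)
      = (\<integral>x. (\<integral>\<omega>. b \<omega> * v (x, \<omega>) \<partial>sphere_measure) * \<psi> x \<partial>cube_measure)"
    "integrable sphere_measure (\<lambda>\<omega>. b \<omega> * (\<integral>x. v (x, \<omega>) * \<psi> x \<partial>cube_measure))"
proof -
  have int: "integrable phase_measure (\<lambda>(x, \<omega>). b \<omega> * v (x, \<omega>) * \<psi> x)"
    using integrable_phase_mult[OF v b \<psi>] by (simp add: case_prod_beta')
  show "(\<integral>\<omega>. b \<omega> * (\<integral>x. v (x, \<omega>) * \<psi> x \<partial>cube_measure) \<partial>sphere_measure)
      = (\<integral>x. (\<integral>\<omega>. b \<omega> * v (x, \<omega>) \<partial>sphere_measure) * \<psi> x \<partial>cube_measure)"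
    using phase.Fubini_integral[OF int] by (simp flip: integral_mult_left_zero integral_mult_right_zero add: mult.assoc)
  show "integrable sphere_measure (\<lambda>\<omega>. b \<omega> * (\<integral>x. v (x, \<omega>) * \<psi> x \<partial>cube_measure))"
    using phase.integrable_snd[OF int] by (simp add: mult.assoc)
qed

text \<open>Cauchy-Schwarz against the constant 1, from the nonnegative integral of the square of
  \<open>m * f x - t\<close>. The null measure is treated apart because a factor \<open>m\<close> is
  cancelled.\<close>

lemma (in finite_measure) square_integral_le:
  assumes f: "in_L2 M f"
  shows "(\<integral>x. f x \<partial>M)\<^sup>2 \<le> measure M (space M) * (\<integral>x. (f x)\<^sup>2 \<partial>M)"
proof (cases "measure M (space M) = 0")
  case True
  then have "emeasure M (space M) = 0" by (simp add: emeasure_eq_measure)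
  then have "AE x in M. f x = 0" by (intro AE_I[of _ _ "space M"]) auto
  then have "(\<integral>x. f x \<partial>M) = 0" by (rule integral_eq_zero_AE)
  then show ?thesis by (simp add: True)
next
  case False
  define m t where "m = measure M (space M)" and "t = (\<integral>x. f x \<partial>M)"
  have m: "m > 0" using False by (simp add: m_def zero_less_measure_iff)
  have "0 \<le> (\<integral>x. (m * f x - t)\<^sup>2 \<partial>M)" by (intro Bochner_Integration.integral_nonneg) auto
  also have "\<dots> = (\<integral>x. m\<^sup>2 * (f x)\<^sup>2 - 2 * m * t * f x + t\<^sup>2 \<partial>M)"
    by (intro Bochner_Integration.integral_cong refl) (simp add: power2_diff power_mult_distrib)
  also have "\<dots> = m\<^sup>2 * (\<integral>x. (f x)\<^sup>2 \<partial>M) - 2 * m * t * t + t\<^sup>2 * m"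
    using integrable_L2[OF f] L2_integrable_square[OF f] by (simp add: t_def m_def)
  also have "\<dots> = m * (m * (\<integral>x. (f x)\<^sup>2 \<partial>M) - t\<^sup>2)" by (simp add: algebra_simps power2_eq_square)
  finally have "0 \<le> m * (\<integral>x. (f x)\<^sup>2 \<partial>M) - t\<^sup>2" using m by (simp add: zero_le_mult_iff)
  then show ?thesis by (simp add: m_def t_def)
qed

lemma AE_section_L2:
  assumes v: "in_L2 phase_measure v" shows "AE x in cube_measure. in_L2 sphere_measure (\<lambda>\<omega>. v (x, \<omega>))"
proof -
  have vm [measurable]: "v \<in> borel_measurable phase_measure" using v by (simp add: in_L2_def)
  have "AE x in cube_measure. x \<in> unit_cube" by (rule AE_I2) simp
  then show ?thesis
    using AE_cube_integrable[OF L2_integrable_square[OF v]]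
  proof eventually_elim
    case (elim x)
    have "(\<lambda>\<omega>. v (x, \<omega>)) \<in> borel_measurable sphere_measure"
      by (rule measurable_compose[OF measurable_Pair1' vm]) (use elim in simp)
    then show ?case using elim by (simp add: in_L2_def)
  qed
qed

lemma moment_in_L2:
  assumes v: "in_L2 phase_measure v" and b: "continuous_on UNIV b"
  shows "in_L2 cube_measure (\<lambda>x. \<integral>\<omega>. b \<omega> * v (x, \<omega>) \<partial>sphere_measure)"
  unfolding in_L2_def
proof
  have vm [measurable]: "v \<in> borel_measurable phase_measure" using v by (simp add: in_L2_def)
  have bm [measurable]: "b \<in> borel_measurable sphere_measure"
    by (intro borel_measurable_sphere borel_measurable_continuous_onI b)
  show meas: "(\<lambda>x. \<integral>\<omega>. b \<omega> * v (x, \<omega>) \<partial>sphere_measure) \<in> borel_measurable cube_measure"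
    by measurable
  have "compact (b ` sphere 0 1)"
    using b by (intro compact_continuous_image) (auto intro: continuous_on_subset)
  then obtain C where C: "\<And>x. x \<in> sphere 0 1 \<Longrightarrow> \<bar>b x\<bar> \<le> C"
    using compact_imp_bounded bounded_iff by (metis imageI real_norm_def)
  define m where "m = measure sphere_measure (space sphere_measure)"
  have int: "integrable cube_measure (\<lambda>x. m * (C\<^sup>2 * (\<integral>\<omega>. (v (x, \<omega>))\<^sup>2 \<partial>sphere_measure)))"
    using phase.integrable_fst'[OF L2_integrable_square[OF v]] by simp
  show "integrable cube_measure (\<lambda>x. (\<integral>\<omega>. b \<omega> * v (x, \<omega>) \<partial>sphere_measure)\<^sup>2)"
  proof (rule Bochner_Integration.integrable_bound[OF int])
    show "AE x in cube_measure. norm ((\<integral>\<omega>. b \<omega> * v (x, \<omega>) \<partial>sphere_measure)\<^sup>2)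
        \<le> norm (m * (C\<^sup>2 * (\<integral>\<omega>. (v (x, \<omega>))\<^sup>2 \<partial>sphere_measure)))"
      using AE_section_L2[OF v]
    proof eventually_elim
      case (elim x)
      have le: "\<bar>b \<omega> * v (x, \<omega>)\<bar> \<le> \<bar>C * v (x, \<omega>)\<bar>" if "\<omega> \<in> sphere 0 1" for \<omega>
        using C[OF that] by (auto simp: abs_mult intro!: mult_right_mono)
      have bv: "in_L2 sphere_measure (\<lambda>\<omega>. b \<omega> * v (x, \<omega>))"
        using le elim by (intro in_L2_dominated[OF in_L2_scale[OF elim, of C]]) (auto simp: in_L2_def intro!: AE_I2)
      have "(\<integral>\<omega>. b \<omega> * v (x, \<omega>) \<partial>sphere_measure)\<^sup>2 \<le> m * (\<integral>\<omega>. (b \<omega> * v (x, \<omega>))\<^sup>2 \<partial>sphere_measure)"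
        unfolding m_def by (rule sphere.square_integral_le[OF bv])
      also have "\<dots> \<le> m * (\<integral>\<omega>. C\<^sup>2 * (v (x, \<omega>))\<^sup>2 \<partial>sphere_measure)"
      proof (intro mult_left_mono integral_mono)
        show "(b \<omega> * v (x, \<omega>))\<^sup>2 \<le> C\<^sup>2 * (v (x, \<omega>))\<^sup>2" if "\<omega> \<in> space sphere_measure" for \<omega>
          using le[of \<omega>] that by (simp only: power_mult_distrib[symmetric] abs_le_square_iff[symmetric] space_sphere_measure)
      qed (use bv elim in \<open>auto simp: L2_integrable_square m_def\<close>)
      finally show ?case by (simp add: m_def)
    qed
  qed (use meas in measurable)
qed

text \<open>By orthogonality the integral of F^2 equals that of F (F - \<phi>). Young's inequality
  with weight 1 absorbs half of it, leaving the squared distance from F to \<phi>, which density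
  makes arbitrarily small.\<close>

lemma L2_zero_if_orthogonal:
  assumes F: "in_L2 cube_measure F" and orth: "\<And>\<phi>. test_function unit_cube \<phi> \<Longrightarrow> (\<integral>x. F x * \<phi> x \<partial>cube_measure) = 0"
  shows "AE x in cube_measure. F x = 0"
proof -
  have "(\<integral>x. (F x)\<^sup>2 \<partial>cube_measure) \<le> 0 + e" if e: "e > 0" for e
  proof -
    obtain \<phi> where \<phi>: "test_function unit_cube \<phi>" "(\<integral>x. (F x - \<phi> x)\<^sup>2 \<partial>cube_measure) < e"
      using L2_closure_test_functions[OF F] e unfolding L2_closure_def by blast
    have \<phi>L: "in_L2 cube_measure \<phi>" by (rule test_function_in_L2[OF \<phi>(1)])
    have "(\<integral>x. (F x)\<^sup>2 \<partial>cube_measure) = (\<integral>x. F x * (F x - \<phi> x) \<partial>cube_measure)"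
      using orth[OF \<phi>(1)] integrable_L2_mult[OF F \<phi>L] L2_integrable_square[OF F]
      by (simp add: right_diff_distrib power2_eq_square)
    also have "\<dots> \<le> (1 * (\<integral>x. (F x)\<^sup>2 \<partial>cube_measure) + (\<integral>x. (F x - \<phi> x)\<^sup>2 \<partial>cube_measure) / 1) / 2"
      using integral_product_le[OF F in_L2_diff[OF F \<phi>L], of 1] by linarith
    finally show ?thesis using \<phi>(2) by simp
  qed
  then have "(\<integral>x. (F x)\<^sup>2 \<partial>cube_measure) \<le> 0" by (rule field_le_epsilon)
  then have "(\<integral>x. (F x)\<^sup>2 \<partial>cube_measure) = 0"
    by (intro antisym Bochner_Integration.integral_nonneg) auto
  then have "AE x in cube_measure. (F x)\<^sup>2 = 0"
    by (subst (asm) integral_nonneg_eq_0_iff_AE[OF L2_integrable_square[OF F]]) auto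
  then show ?thesis by simp
qed

text \<open>The weights in the Sobolev norm are at least 1, so it dominates the L2 norm in the
  angle, and integrability in x follows from that of its square.\<close>

lemma in_L2_Hq_phase:
  assumes v: "in_L2_Hq q v" and q: "q > 0" shows "in_L2 phase_measure v"
  unfolding in_L2_def
proof
  show vm [measurable]: "v \<in> borel_measurable phase_measure" using v by (simp add: in_L2_Hq_def)
  have h: "integrable cube_measure (\<lambda>x. (Hq_norm q (\<lambda>\<omega>. v (x, \<omega>)))\<^sup>2)"
    and ae: "AE x in cube_measure. in_Hq q (\<lambda>\<omega>. v (x, \<omega>))"
    using v by (auto simp: in_L2_Hq_def in_L2_def)
  show "integrable phase_measure (\<lambda>p. (v p)\<^sup>2)"
  proof (rule phase.Fubini_integrable)
    show "integrable cube_measure (\<lambda>x. \<integral>\<omega>. norm ((v (x, \<omega>))\<^sup>2) \<partial>sphere_measure)"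
    proof (rule Bochner_Integration.integrable_bound[OF h])
      show "AE x in cube_measure. norm (\<integral>\<omega>. norm ((v (x, \<omega>))\<^sup>2) \<partial>sphere_measure) \<le> norm ((Hq_norm q (\<lambda>\<omega>. v (x, \<omega>)))\<^sup>2)"
        using ae by eventually_elim (use integral_square_le_Hq_norm[OF _ q] in auto)
    qed measurable
    show "AE x in cube_measure. integrable sphere_measure (\<lambda>\<omega>. (v (x, \<omega>))\<^sup>2)"
      using ae by eventually_elim (simp add: in_Hq_def in_L2_def)
  qed measurable
qed

lemma L2_Hq_norm_square:
  "(L2_Hq_norm q v)\<^sup>2 = (\<integral>x. (Hq_norm q (\<lambda>\<omega>. v (x, \<omega>)))\<^sup>2 \<partial>cube_measure)"
  by (simp add: L2_Hq_norm_def L2norm_def)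

section \<open>The error of the \<open>P\<^sub>N\<close> coefficients\<close>

lemma legendre_poly_0: "legendre_poly 0 = 1"
  by (simp add: legendre_poly_def)

lemma legendre_poly_1: "legendre_poly 1 = [:0, 1:]"
  by (simp add: legendre_poly_def pderiv_pCons)

lemma PN_m_00: "PN_m (0, 0) \<omega> = sqrt (1 / (4 * pi))"
  by (simp add: PN_m_def sph_harm_def legendre_poly_0)

text \<open>The order \<kappa> for which the harmonic of degree one is a multiple of \<omega>_i:
  \<omega>_1 and \<omega>_2 are the real and imaginary parts of z, selected by the orders 1 and
  -1.\<close>

definition coord_index :: "3 \<Rightarrow> int" where
  "coord_index i = (if i = 1 then 1 else if i = 2 then -1 else 0)"

lemma PN_m_coord: "PN_m (1, coord_index i) \<omega> = sqrt (3 / (4 * pi)) * \<omega> $ i"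
proof -
  have "i = 1 \<or> i = 2 \<or> i = 3" by (rule exhaust_3)
  then show ?thesis
    by (elim disjE)
       (simp_all add: PN_m_def sph_harm_def coord_index_def legendre_poly_1[unfolded One_nat_def] pderiv_pCons)
qed

lemma PN_indices_00 [simp]: "(0, 0) \<in> PN_indices N"
  by (simp add: PN_indices_def)

lemma coord_index_in: "N \<ge> 1 \<Longrightarrow> (1, coord_index i) \<in> PN_indices N"
  by (auto simp: PN_indices_def coord_index_def)

lemma PN_A_sym: "PN_A i j k = PN_A i k j"
  unfolding PN_A_def by (intro Bochner_Integration.integral_cong refl) simp

lemma continuous_coord_PN_m: "continuous_on UNIV (\<lambda>\<omega>. \<omega> $ i * PN_m j \<omega>)"
  by (intro continuous_intros continuous_PN_m)

lemma PN_proj_continuous: "continuous_on UNIV (PN_proj N w)"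
  unfolding PN_proj_def[abs_def] by (intro continuous_intros continuous_PN_m)

lemma PN_proj_in_L2: "in_L2 sphere_measure (PN_proj N w)"
  by (intro sphere_in_L2_continuous PN_proj_continuous)

lemma PN_coeff_proj_error:
  assumes w: "in_L2 sphere_measure w" and j: "j \<in> PN_indices N"
  shows "PN_coeff j (\<lambda>\<omega>. w \<omega> - PN_proj N w \<omega>) = 0"
proof -
  have i1: "integrable sphere_measure (\<lambda>\<omega>. PN_m j \<omega> * w \<omega>)" by (intro integrable_L2_mult PN_m_in_L2 w)
  have i2: "integrable sphere_measure (\<lambda>\<omega>. PN_m j \<omega> * PN_proj N w \<omega>)" by (intro integrable_L2_mult PN_m_in_L2 PN_proj_in_L2)
  have i3: "integrable sphere_measure (\<lambda>\<omega>. PN_m j \<omega> * PN_m k \<omega>)" for k by (intro integrable_L2_mult PN_m_in_L2)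
  have "(\<integral>\<omega>. PN_m j \<omega> * PN_proj N w \<omega> \<partial>sphere_measure)
      = (\<integral>\<omega>. (\<Sum>k\<in>PN_indices N. PN_coeff k w * (PN_m j \<omega> * PN_m k \<omega>)) \<partial>sphere_measure)"
    by (simp add: PN_proj_def sum_distrib_left mult_ac)
  also have "\<dots> = (\<Sum>k\<in>PN_indices N. PN_coeff k w * (if j = k then 1 else 0))"
    using i3 j by (simp add: PN_m_orthonormal)
  also have "\<dots> = PN_coeff j w" using j by (simp add: if_distrib cong: if_cong)
  finally show ?thesis using i1 i2 by (simp add: PN_coeff_def right_diff_distrib)
qed

lemma coord_sum_square_le:
  fixes \<eta> :: "3 \<Rightarrow> real"
  assumes "\<omega> \<in> sphere (0 :: vec3) 1"
  shows "(\<Sum>i\<in>UNIV. \<omega> $ i * \<eta> i)\<^sup>2 \<le> (\<Sum>i\<in>UNIV. (\<eta> i)\<^sup>2)"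
proof -
  have "(\<Sum>i\<in>UNIV. (\<omega> $ i)\<^sup>2) = 1" using norm_vec3[of \<omega>] assms by (simp add: sum_3)
  then show ?thesis using Cauchy_Schwarz_ineq_sum[of "\<lambda>i. \<omega> $ i" \<eta> UNIV] by simp
qed

text \<open>\<open>transport_defect\<close> is the part of \<open>\<integral> m\<^sub>j \<omega>\<cdot>\<nabla>u d\<omega>\<close> due to the degrees above \<open>N\<close>, where \<open>w i\<close> stands for \<open>\<partial>\<^sub>i u\<close>.\<close>

definition transport_defect :: "nat \<Rightarrow> (3 \<Rightarrow> vec3 \<Rightarrow> real) \<Rightarrow> pn_index \<Rightarrow> real" where
  "transport_defect N w j = (\<Sum>i\<in>UNIV. \<integral>\<omega>. \<omega> $ i * PN_m j \<omega> * w i \<omega> \<partial>sphere_measure)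
     - (\<Sum>i\<in>UNIV. \<Sum>k\<in>PN_indices N. PN_A i j k * PN_coeff k (w i))"

lemma transport_defect_eq:
  assumes w: "\<And>i. in_L2 sphere_measure (w i)"
  shows "transport_defect N w j = (\<Sum>i\<in>UNIV. \<integral>\<omega>. \<omega> $ i * PN_m j \<omega> * (w i \<omega> - PN_proj N (w i) \<omega>) \<partial>sphere_measure)"
proof -
  have b: "in_L2 sphere_measure (\<lambda>\<omega>. \<omega> $ i * PN_m j \<omega>)" for i
    by (intro sphere_in_L2_continuous continuous_coord_PN_m)
  have "(\<integral>\<omega>. \<omega> $ i * PN_m j \<omega> * PN_proj N (w i) \<omega> \<partial>sphere_measure) = (\<Sum>k\<in>PN_indices N. PN_A i j k * PN_coeff k (w i))" for i
  proof -
    have "(\<integral>\<omega>. \<omega> $ i * PN_m j \<omega> * PN_proj N (w i) \<omega> \<partial>sphere_measure)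
        = (\<integral>\<omega>. (\<Sum>k\<in>PN_indices N. (\<omega> $ i * PN_m j \<omega> * PN_m k \<omega>) * PN_coeff k (w i)) \<partial>sphere_measure)"
      by (simp add: PN_proj_def sum_distrib_left mult_ac)
    also have "\<dots> = (\<Sum>k\<in>PN_indices N. (\<integral>\<omega>. \<omega> $ i * PN_m j \<omega> * PN_m k \<omega> \<partial>sphere_measure) * PN_coeff k (w i))"
      using integrable_L2_mult[OF b PN_m_in_L2] by simp
    finally show ?thesis by (simp only: PN_A_def)
  qed
  then show ?thesis
    unfolding transport_defect_def
    using integrable_L2_mult[OF b w] integrable_L2_mult[OF b PN_proj_in_L2]
    by (simp add: right_diff_distrib sum_subtractf)
qed

lemma transport_defect_00:
  assumes w: "\<And>i. in_L2 sphere_measure (w i)" and N: "N \<ge> 1"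
  shows "transport_defect N w (0, 0) = 0"
proof -
  have "(\<integral>\<omega>. \<omega> $ i * PN_m (0, 0) \<omega> * (w i \<omega> - PN_proj N (w i) \<omega>) \<partial>sphere_measure) = 0" for i
  proof -
    have m: "\<omega> $ i * PN_m (0, 0) \<omega> = sqrt (1 / (4 * pi)) / sqrt (3 / (4 * pi)) * PN_m (1, coord_index i) \<omega>" for \<omega>
      unfolding PN_m_coord PN_m_00 by simp
    have "(\<integral>\<omega>. \<omega> $ i * PN_m (0, 0) \<omega> * (w i \<omega> - PN_proj N (w i) \<omega>) \<partial>sphere_measure)
        = sqrt (1 / (4 * pi)) / sqrt (3 / (4 * pi)) * PN_coeff (1, coord_index i) (\<lambda>\<omega>. w i \<omega> - PN_proj N (w i) \<omega>)"
      unfolding m PN_coeff_def by (simp only: mult.assoc integral_mult_right_zero)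
    then show ?thesis using PN_coeff_proj_error[OF w coord_index_in[OF N]] by simp
  qed
  then show ?thesis by (simp add: transport_defect_eq[OF w])
qed

text \<open>All components of the defect are coefficients of the single function \<open>z\<close>,
  the sum of \<omega>_i times the projection errors. Bessel is applied once to \<open>z\<close>, and
  |\<omega>| = 1 bounds its square by the sum of the squared errors, so no factor growing with
  \<open>N\<close> arises.\<close>

lemma transport_defect_bound:
  assumes w: "\<And>i. in_Hq q (w i)" and q: "q > 0" and N: "N \<ge> 1"
  shows "(\<Sum>j\<in>PN_indices N. (transport_defect N w j)\<^sup>2) \<le> real N powr (- 2 * q) * (\<Sum>i\<in>UNIV. (Hq_norm q (w i))\<^sup>2)"
proof -
  have wL: "in_L2 sphere_measure (w i)" for i using w by (simp add: in_Hq_def)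
  let ?\<eta> = "\<lambda>i \<omega>. w i \<omega> - PN_proj N (w i) \<omega>"
  have \<eta>L: "in_L2 sphere_measure (?\<eta> i)" for i by (intro in_L2_diff wL PN_proj_in_L2)
  define z where "z \<omega> = (\<Sum>i\<in>UNIV. \<omega> $ i * ?\<eta> i \<omega>)" for \<omega>
  have coord: "in_L2 sphere_measure (\<lambda>\<omega>. \<omega> $ i * ?\<eta> i \<omega>)" for i
  proof (rule in_L2_dominated[OF \<eta>L[of i]])
    have [measurable]: "(\<lambda>\<omega>. \<omega> $ i) \<in> borel_measurable sphere_measure"
      by (intro borel_measurable_sphere borel_measurable_continuous_onI continuous_intros)
    have [measurable]: "(\<lambda>\<omega>. ?\<eta> i \<omega>) \<in> borel_measurable sphere_measure" using \<eta>L[of i] by (simp only: in_L2_def)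
    show "(\<lambda>\<omega>. \<omega> $ i * ?\<eta> i \<omega>) \<in> borel_measurable sphere_measure" by measurable
    show "AE \<omega> in sphere_measure. \<bar>\<omega> $ i * ?\<eta> i \<omega>\<bar> \<le> \<bar>?\<eta> i \<omega>\<bar>"
    proof (rule AE_I2)
      fix \<omega> assume "\<omega> \<in> space sphere_measure"
      then have "\<bar>\<omega> $ i\<bar> \<le> 1" using component_le_norm_cart[of \<omega> i] by simp
      then show "\<bar>\<omega> $ i * ?\<eta> i \<omega>\<bar> \<le> \<bar>?\<eta> i \<omega>\<bar>" unfolding abs_mult by (simp add: mult_left_le_one_le)
    qed
  qed
  have zL: "in_L2 sphere_measure z" unfolding z_def[abs_def] by (intro in_L2_sum coord)
  have "transport_defect N w j = PN_coeff j z" for j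
  proof -
    have "PN_coeff j z = (\<integral>\<omega>. (\<Sum>i\<in>UNIV. PN_m j \<omega> * (\<omega> $ i * ?\<eta> i \<omega>)) \<partial>sphere_measure)"
      by (simp add: PN_coeff_def z_def sum_distrib_left)
    also have "\<dots> = (\<Sum>i\<in>UNIV. \<integral>\<omega>. PN_m j \<omega> * (\<omega> $ i * ?\<eta> i \<omega>) \<partial>sphere_measure)"
      by (intro Bochner_Integration.integral_sum integrable_L2_mult PN_m_in_L2 coord)
    finally show ?thesis unfolding transport_defect_eq[OF wL] by (simp add: mult_ac)
  qed
  then have "(\<Sum>j\<in>PN_indices N. (transport_defect N w j)\<^sup>2) \<le> (\<integral>\<omega>. (z \<omega>)\<^sup>2 \<partial>sphere_measure)"
    using PN_bessel[OF zL] by simp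
  also have "\<dots> \<le> (\<integral>\<omega>. (\<Sum>i\<in>UNIV. (?\<eta> i \<omega>)\<^sup>2) \<partial>sphere_measure)"
  proof (rule integral_mono)
    show "(z \<omega>)\<^sup>2 \<le> (\<Sum>i\<in>UNIV. (?\<eta> i \<omega>)\<^sup>2)" if "\<omega> \<in> space sphere_measure" for \<omega>
      unfolding z_def by (rule coord_sum_square_le) (use that in simp)
  qed (use zL \<eta>L in \<open>auto intro!: L2_integrable_square Bochner_Integration.integrable_sum\<close>)
  also have "\<dots> = (\<Sum>i\<in>UNIV. \<integral>\<omega>. (?\<eta> i \<omega>)\<^sup>2 \<partial>sphere_measure)"
    using \<eta>L by (intro Bochner_Integration.integral_sum L2_integrable_square)
  also have "\<dots> \<le> (\<Sum>i\<in>UNIV. real N powr (- 2 * q) * (Hq_norm q (w i))\<^sup>2)"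
    by (intro sum_mono PN_proj_error w q N)
  finally show ?thesis by (simp add: sum_distrib_left)
qed

text \<open>The absorbed quantity: away from \<open>(0, 0)\<close> the damping \<open>\<sigma>\<^sub>t / \<epsilon>\<close> is of order \<open>1 / \<epsilon>\<close>, and at \<open>(0, 0)\<close>, where the
  damping is only \<open>\<epsilon> \<sigma>\<^sub>a\<close>, the defect vanishes. This makes the constant independent of \<open>\<epsilon>\<close>.\<close>

lemma damping_estimate:
  fixes e H h s \<epsilon> \<sigma>min :: real
  assumes eq: "H + h + s * e = 0" and pos: "0 < \<epsilon>" "\<epsilon> < 1" "0 < \<sigma>min"
    and s: "s \<ge> \<sigma>min / \<epsilon> \<or> s \<ge> \<epsilon> * \<sigma>min \<and> h = 0"
  shows "e * H \<le> - (\<epsilon> * \<sigma>min / 2) * e\<^sup>2 + \<epsilon> / (2 * \<sigma>min) * h\<^sup>2"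
proof -
  have H: "H = - h - s * e" using eq by linarith
  have eH: "e * H = - (e * h) - s * e\<^sup>2" unfolding H by (simp add: algebra_simps power2_eq_square)
  from s show ?thesis
  proof
    assume s: "s \<ge> \<sigma>min / \<epsilon>"
    \<comment> \<open>The strong damping is also brought down to the coefficient
      \<open>\<epsilon> * \<sigma>min\<close>, after half of it has absorbed the defect. All modes
      then share one factor, and the bounds can be summed.\<close>
    have "\<epsilon> * \<epsilon> \<le> 1 * 1" using pos by (intro mult_mono) auto
    then have "\<epsilon> \<le> 1 / \<epsilon>" using pos by (simp add: pos_le_divide_eq)
    then have "\<epsilon> * \<sigma>min \<le> 1 / \<epsilon> * \<sigma>min" using pos by (intro mult_right_mono) auto
    then have 1: "\<epsilon> * \<sigma>min * e\<^sup>2 \<le> \<sigma>min / \<epsilon> * e\<^sup>2" by (intro mult_right_mono) auto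
    have 2: "\<sigma>min / \<epsilon> * e\<^sup>2 \<le> s * e\<^sup>2" using s by (intro mult_right_mono) auto
    have "\<bar>e * h\<bar> \<le> (\<sigma>min / \<epsilon> * e\<^sup>2 + h\<^sup>2 / (\<sigma>min / \<epsilon>)) / 2" using pos by (intro weighted_product_le) auto
    moreover have "h\<^sup>2 / (\<sigma>min / \<epsilon>) / 2 = \<epsilon> / (2 * \<sigma>min) * h\<^sup>2" by (simp add: mult.commute)
    ultimately have "\<bar>e * h\<bar> \<le> \<sigma>min / \<epsilon> * e\<^sup>2 / 2 + \<epsilon> / (2 * \<sigma>min) * h\<^sup>2"
      by (simp only: add_divide_distrib)
    then have "- (e * h) \<le> \<sigma>min / \<epsilon> * e\<^sup>2 / 2 + \<epsilon> / (2 * \<sigma>min) * h\<^sup>2"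
      using abs_ge_minus_self[of "e * h"] by (rule order_trans[rotated])
    moreover have "- (\<epsilon> * \<sigma>min / 2) * e\<^sup>2 = - (\<epsilon> * \<sigma>min * e\<^sup>2) / 2" by simp
    moreover have "B + C \<ge> - D \<Longrightarrow> A \<le> 2 * B \<Longrightarrow> 2 * B \<le> S \<Longrightarrow> - D - S \<le> - A / 2 + C" for A B C D S :: real
      by (simp add: field_simps)
    ultimately show ?thesis using 1 2 unfolding eH by simp
  next
    assume s: "s \<ge> \<epsilon> * \<sigma>min \<and> h = 0"
    then have "\<epsilon> * \<sigma>min * e\<^sup>2 \<le> s * e\<^sup>2" by (intro mult_right_mono) auto
    moreover have "0 \<le> \<epsilon> * \<sigma>min * e\<^sup>2" using pos by simp
    ultimately show ?thesis using eH s by simp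
  qed
qed

section \<open>Error equation and energy estimate for one pair of solutions\<close>

locale PN_comparison =
  fixes \<sigma>t \<sigma>a :: "vec3 \<Rightarrow> real" and \<sigma>min q \<epsilon> :: real and N :: nat and f u g :: "vec3 \<times> vec3 \<Rightarrow> real"
    and du :: "3 \<Rightarrow> vec3 \<times> vec3 \<Rightarrow> real" and U G :: "vec3 \<Rightarrow> pn_index \<Rightarrow> real"
  assumes \<sigma>min: "\<sigma>min > 0" and \<sigma>: "AE x in cube_measure. \<sigma>t x > \<sigma>a x \<and> \<sigma>a x \<ge> \<sigma>min" and q: "q > 0"
    and N: "N \<ge> 1" and \<epsilon>: "0 < \<epsilon>" "\<epsilon> < 1" and f: "in_L2 phase_measure f"
    and u: "periodic_L2_phase u" and g: "periodic_L2_phase g" and transport: "weak_dir_deriv UNIV (\<lambda>\<omega>. \<omega>) u g"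
    and rte: "AE (x, \<omega>) in phase_measure. g (x, \<omega>) + \<sigma>t x / \<epsilon> * u (x, \<omega>)
               = (\<sigma>t x / \<epsilon> - \<epsilon> * \<sigma>a x) * angular_mean u x + \<epsilon> * f (x, \<omega>)"
    and U: "periodic_L2_vec N U" and G: "periodic_L2_vec N G" and PN_transport: "weak_PN_transport N U G"
    and PN: "AE x in cube_measure. \<forall>j\<in>PN_indices N.
             G x j + \<epsilon> * \<sigma>a x * U x j
               + (\<sigma>t x / \<epsilon> - \<epsilon> * \<sigma>a x) * (\<Sum>k\<in>PN_indices N. PN_R j k * U x k)
               = \<epsilon> * PN_rhs f j x"
    and u_Hq: "in_L2_Hq q u" and du: "\<And>i. weak_dir_deriv unit_cube (\<lambda>\<omega>. axis i 1) u (du i)"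
    and du_Hq: "\<And>i. in_L2_Hq q (du i)"
begin

abbreviation J :: "pn_index set" where "J \<equiv> PN_indices N"

definition uc :: "pn_index \<Rightarrow> vec3 \<Rightarrow> real" where "uc j x = PN_coeff j (\<lambda>\<omega>. u (x, \<omega>))"
definition gc :: "pn_index \<Rightarrow> vec3 \<Rightarrow> real" where "gc j x = PN_coeff j (\<lambda>\<omega>. g (x, \<omega>))"
definition duc :: "3 \<Rightarrow> pn_index \<Rightarrow> vec3 \<Rightarrow> real" where "duc i j x = PN_coeff j (\<lambda>\<omega>. du i (x, \<omega>))"
definition err :: "pn_index \<Rightarrow> vec3 \<Rightarrow> real" where "err j x = uc j x - U x j"
text \<open>The matrices act on coefficients up to degree \<open>N\<close> only, so this is the
  divergence of the truncated error. The contribution of higher degrees to the moments of the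
  transport term is not included here; it is \<open>defect\<close>.\<close>

definition div_err :: "pn_index \<Rightarrow> vec3 \<Rightarrow> real" where
  "div_err j x = (\<Sum>i\<in>UNIV. \<Sum>k\<in>J. PN_A i j k * duc i k x) - G x j"
definition defect :: "pn_index \<Rightarrow> vec3 \<Rightarrow> real" where
  "defect j x = transport_defect N (\<lambda>i \<omega>. du i (x, \<omega>)) j"

lemma uL: "in_L2 phase_measure u" and gL: "in_L2 phase_measure g"
  using u g by (auto simp: periodic_L2_phase_def)

lemma duL: "in_L2 phase_measure (du i)"
  by (rule in_L2_Hq_phase[OF du_Hq q])

lemma ui: "integrable phase_measure u" and gi: "integrable phase_measure g" and dui: "integrable phase_measure (du i)"
  using uL gL duL by (auto intro: phase.integrable_L2)

lemma uc_L2: "in_L2 cube_measure (uc j)" and gc_L2: "in_L2 cube_measure (gc j)" and duc_L2: "in_L2 cube_measure (duc i j)"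
  unfolding uc_def[abs_def] gc_def[abs_def] duc_def[abs_def] PN_coeff_def
  by (intro moment_in_L2 uL gL duL continuous_PN_m)+

lemma U_L2: "j \<in> J \<Longrightarrow> in_L2 cube_measure (\<lambda>x. U x j)" and G_L2: "j \<in> J \<Longrightarrow> in_L2 cube_measure (\<lambda>x. G x j)"
  using U G unfolding periodic_L2_vec_def by blast+

lemma err_L2: "j \<in> J \<Longrightarrow> in_L2 cube_measure (err j)"
  unfolding err_def[abs_def] by (intro in_L2_diff uc_L2 U_L2)

lemma div_err_L2: "j \<in> J \<Longrightarrow> in_L2 cube_measure (div_err j)"
  unfolding div_err_def[abs_def] by (intro in_L2_diff in_L2_sum in_L2_scale duc_L2 G_L2)

lemma defect_L2: "in_L2 cube_measure (defect j)"
  unfolding defect_def[abs_def] transport_defect_def PN_coeff_def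
  by (intro in_L2_diff in_L2_sum in_L2_scale moment_in_L2 duL continuous_PN_m continuous_coord_PN_m)

text \<open>The derivatives of \<open>u\<close> were given inside the cube, but here they are tested
  with periodized functions that need not vanish at the faces. Fubini puts the angular integral
  outside, so that the gluing result can be used for almost every direction.\<close>

lemma coefficient_derivative:
  assumes \<phi>: "test_function UNIV \<phi>" and cov: "covers M \<phi>" "\<And>i. covers M (pd \<phi> i)"
  shows "(\<integral>x. uc k x * pd (periodized M \<phi>) i x \<partial>cube_measure) = - (\<integral>x. duc i k x * periodized M \<phi> x \<partial>cube_measure)"
proof -
  let ?\<Phi> = "periodized M \<phi>"
  have Ck: "Ck n ?\<Phi>" for n by (intro Ck_periodized test_function_Ck[OF \<phi>])
  have c: "continuous_on UNIV ?\<Phi>" "continuous_on UNIV (pd ?\<Phi> i)"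
    using Ck_continuous[OF Ck[of 0]] Ck_pd_continuous[OF Ck] by auto
  note fub = phase_fubini[OF ui continuous_PN_m[of k] c(2)] phase_fubini[OF dui[of i] continuous_PN_m[of k] c(1)]
  have "(\<integral>x. uc k x * pd ?\<Phi> i x \<partial>cube_measure)
      = (\<integral>\<omega>. PN_m k \<omega> * (\<integral>x. u (x, \<omega>) * pd ?\<Phi> i x \<partial>cube_measure) \<partial>sphere_measure)"
    unfolding fub(1) uc_def PN_coeff_def ..
  also have "\<dots> = (\<integral>\<omega>. - (PN_m k \<omega> * (\<integral>x. du i (x, \<omega>) * ?\<Phi> x \<partial>cube_measure)) \<partial>sphere_measure)"
  proof (rule integral_cong_AE)
    show "(\<lambda>\<omega>. PN_m k \<omega> * (\<integral>x. u (x, \<omega>) * pd ?\<Phi> i x \<partial>cube_measure)) \<in> borel_measurable sphere_measure"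
      by (rule borel_measurable_integrable[OF fub(2)])
    show "(\<lambda>\<omega>. - (PN_m k \<omega> * (\<integral>x. du i (x, \<omega>) * ?\<Phi> x \<partial>cube_measure))) \<in> borel_measurable sphere_measure"
      by (intro borel_measurable_uminus borel_measurable_integrable[OF fub(4)])
    show "AE \<omega> in sphere_measure. PN_m k \<omega> * (\<integral>x. u (x, \<omega>) * pd ?\<Phi> i x \<partial>cube_measure)
        = - (PN_m k \<omega> * (\<integral>x. du i (x, \<omega>) * ?\<Phi> x \<partial>cube_measure))"
      using glue_AE(1)[OF u g transport du dui \<phi> cov, of i] by eventually_elim simp
  qed
  also have "\<dots> = - (\<integral>x. duc i k x * ?\<Phi> x \<partial>cube_measure)"
    unfolding integral_minus fub(3) duc_def PN_coeff_def ..
  finally show ?thesis .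
qed

text \<open>The gluing result identifies \<open>g\<close> with the sum of \<omega>_i times
  \<open>du i\<close> only after testing, with a null set of directions depending on the test
  function. Taking the angular moment first leaves a function of \<open>x\<close>, to which
  \<open>L2_zero_if_orthogonal\<close> applies.\<close>

lemma gc_eq: "AE x in cube_measure. gc j x = (\<Sum>i\<in>UNIV. \<integral>\<omega>. \<omega> $ i * PN_m j \<omega> * du i (x, \<omega>) \<partial>sphere_measure)"
proof -
  let ?b = "\<lambda>i x. \<integral>\<omega>. \<omega> $ i * PN_m j \<omega> * du i (x, \<omega>) \<partial>sphere_measure"
  have bL: "in_L2 cube_measure (?b i)" for i by (intro moment_in_L2 duL continuous_coord_PN_m)
  have FL: "in_L2 cube_measure (\<lambda>x. gc j x - (\<Sum>i\<in>UNIV. ?b i x))" by (intro in_L2_diff in_L2_sum gc_L2 bL)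
  have "AE x in cube_measure. gc j x - (\<Sum>i\<in>UNIV. ?b i x) = 0"
  proof (rule L2_zero_if_orthogonal[OF FL])
    fix \<phi> assume \<phi>: "test_function unit_cube \<phi>"
    have \<phi>U: "test_function UNIV \<phi>" by (rule test_function_mono[OF \<phi>]) simp
    have \<phi>L: "in_L2 cube_measure \<phi>" by (rule test_function_in_L2[OF \<phi>])
    have c: "continuous_on UNIV \<phi>" by (rule Ck_continuous[OF test_function_Ck[OF \<phi>, of 0]])
    note fg = phase_fubini[OF gi continuous_PN_m[of j] c]
    note fd = phase_fubini[OF dui continuous_coord_PN_m[of _ j] c]
    have "(\<integral>x. gc j x * \<phi> x \<partial>cube_measure) = (\<integral>\<omega>. PN_m j \<omega> * (\<integral>x. g (x, \<omega>) * \<phi> x \<partial>cube_measure) \<partial>sphere_measure)"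
      unfolding fg(1) gc_def PN_coeff_def ..
    also have "\<dots> = (\<integral>\<omega>. (\<Sum>i\<in>UNIV. \<omega> $ i * PN_m j \<omega> * (\<integral>x. du i (x, \<omega>) * \<phi> x \<partial>cube_measure)) \<partial>sphere_measure)"
    proof (rule integral_cong_AE)
      show "(\<lambda>\<omega>. PN_m j \<omega> * (\<integral>x. g (x, \<omega>) * \<phi> x \<partial>cube_measure)) \<in> borel_measurable sphere_measure"
        by (rule borel_measurable_integrable[OF fg(2)])
      show "(\<lambda>\<omega>. \<Sum>i\<in>UNIV. \<omega> $ i * PN_m j \<omega> * (\<integral>x. du i (x, \<omega>) * \<phi> x \<partial>cube_measure)) \<in> borel_measurable sphere_measure"
        by (intro borel_measurable_sum borel_measurable_integrable[OF fd(2)])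
      show "AE \<omega> in sphere_measure. PN_m j \<omega> * (\<integral>x. g (x, \<omega>) * \<phi> x \<partial>cube_measure)
          = (\<Sum>i\<in>UNIV. \<omega> $ i * PN_m j \<omega> * (\<integral>x. du i (x, \<omega>) * \<phi> x \<partial>cube_measure))"
        using glue_AE(2)[OF u g transport du dui \<phi>U periodized_test_covers[OF \<phi>]]
        unfolding periodized_0 by eventually_elim (simp add: sum_distrib_left mult_ac)
    qed
    also have "\<dots> = (\<Sum>i\<in>UNIV. \<integral>\<omega>. \<omega> $ i * PN_m j \<omega> * (\<integral>x. du i (x, \<omega>) * \<phi> x \<partial>cube_measure) \<partial>sphere_measure)"
      by (intro Bochner_Integration.integral_sum fd(2))
    also have "\<dots> = (\<Sum>i\<in>UNIV. \<integral>x. ?b i x * \<phi> x \<partial>cube_measure)" unfolding fd(1) ..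
    also have "\<dots> = (\<integral>x. (\<Sum>i\<in>UNIV. ?b i x * \<phi> x) \<partial>cube_measure)"
      by (intro Bochner_Integration.integral_sum[symmetric] integrable_L2_mult bL \<phi>L)
    finally have "(\<integral>x. gc j x * \<phi> x \<partial>cube_measure) = (\<integral>x. (\<Sum>i\<in>UNIV. ?b i x) * \<phi> x \<partial>cube_measure)"
      by (simp add: sum_distrib_right)
    moreover have "integrable cube_measure (\<lambda>x. gc j x * \<phi> x)" "integrable cube_measure (\<lambda>x. (\<Sum>i\<in>UNIV. ?b i x) * \<phi> x)"
      by (intro integrable_L2_mult gc_L2 \<phi>L in_L2_sum bL)+
    ultimately show "(\<integral>x. (gc j x - (\<Sum>i\<in>UNIV. ?b i x)) * \<phi> x \<partial>cube_measure) = 0"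
      by (simp add: left_diff_distrib)
  qed
  then show ?thesis by eventually_elim simp
qed

text \<open>The difference of two identities of unequal strength. For \<open>u\<close> every single
  derivative of a coefficient is available; for \<open>U\<close> only the combination over
  \<open>i\<close> is, so its part is never split and is unfolded from the space to the cube as a
  whole.\<close>

lemma err_torus_div:
  assumes j: "j \<in> J"
  shows "torus_div (\<lambda>i x. \<Sum>k\<in>J. PN_A i j k * err k x) (div_err j)"
  unfolding torus_div_def
proof (intro allI impI)
  fix \<phi> M assume \<phi>: "test_function UNIV \<phi>" and cov: "covers M \<phi>" "\<forall>i. covers M (pd \<phi> i)"
  let ?\<Phi> = "periodized M \<phi>"
  have Ck\<phi>: "Ck n \<phi>" for n by (rule test_function_Ck[OF \<phi>])
  have Ck: "Ck n ?\<Phi>" for n by (intro Ck_periodized Ck\<phi>)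
  have c: "continuous_on UNIV ?\<Phi>" "continuous_on UNIV (pd ?\<Phi> i)" "continuous_on UNIV \<phi>" "continuous_on UNIV (pd \<phi> i)" for i
    using Ck_continuous[OF Ck[of 0]] Ck_pd_continuous[OF Ck] Ck_continuous[OF Ck\<phi>[of 0]] Ck_pd_continuous[OF Ck\<phi>] by auto
  have iu: "integrable cube_measure (uc k)" and idu: "integrable cube_measure (duc i k)" for i k
    by (intro cube.integrable_L2 uc_L2 duc_L2)+
  have iU: "integrable cube_measure (\<lambda>x. U x k)" and iG: "integrable cube_measure (\<lambda>x. G x k)" if "k \<in> J" for k
    by (intro cube.integrable_L2 U_L2 G_L2 that)+
  have Uper: "(\<lambda>x. U x k) \<in> borel_measurable borel" "U (x + axis i 1) k = U x k"
    and Gper: "(\<lambda>x. G x k) \<in> borel_measurable borel" "G (x + axis i 1) k = G x k" if "k \<in> J" for k x i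
    using U G that unfolding periodic_L2_vec_def by auto
  have U_int: "integrable lborel (\<lambda>x. U x k * pd \<phi> i x)"
      "(\<integral>x. U x k * pd \<phi> i x \<partial>lborel) = (\<integral>x. U x k * pd ?\<Phi> i x \<partial>cube_measure)" if k: "k \<in> J" for i k
  proof -
    note p = periodic_integral[where F="\<lambda>x. U x k", OF Uper(1)[OF k] Uper(2)[OF k] iU[OF k] c(4) cov(2)[rule_format]]
    show "integrable lborel (\<lambda>x. U x k * pd \<phi> i x)" by (rule p(1))
    show "(\<integral>x. U x k * pd \<phi> i x \<partial>lborel) = (\<integral>x. U x k * pd ?\<Phi> i x \<partial>cube_measure)"
      unfolding p(2) pd_periodized[OF Ck\<phi>] ..
  qed
  have "(\<integral>x. (\<Sum>i\<in>UNIV. (\<Sum>k\<in>J. PN_A i j k * U x k) * pd \<phi> i x) \<partial>lborel) = - (\<integral>x. G x j * \<phi> x \<partial>lborel)"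
    using PN_transport \<phi> j unfolding weak_PN_transport_def by blast
  also have "(\<integral>x. G x j * \<phi> x \<partial>lborel) = (\<integral>x. G x j * ?\<Phi> x \<partial>cube_measure)"
    by (rule periodic_integral(2)[where F="\<lambda>x. G x j", OF Gper(1)[OF j] Gper(2)[OF j] iG[OF j] c(3) cov(1)])
  also have "(\<integral>x. (\<Sum>i\<in>UNIV. (\<Sum>k\<in>J. PN_A i j k * U x k) * pd \<phi> i x) \<partial>lborel)
      = (\<integral>x. (\<Sum>i\<in>UNIV. \<Sum>k\<in>J. PN_A i j k * (U x k * pd \<phi> i x)) \<partial>lborel)"
    by (simp add: sum_distrib_right mult.assoc)
  also have "\<dots> = (\<Sum>i\<in>UNIV. \<Sum>k\<in>J. PN_A i j k * (\<integral>x. U x k * pd ?\<Phi> i x \<partial>cube_measure))"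
    using U_int by (simp add: Bochner_Integration.integral_sum)
  finally have UG: "(\<Sum>i\<in>UNIV. \<Sum>k\<in>J. PN_A i j k * (\<integral>x. U x k * pd ?\<Phi> i x \<partial>cube_measure)) = - (\<integral>x. G x j * ?\<Phi> x \<partial>cube_measure)" .
  have i1: "integrable cube_measure (\<lambda>x. uc k x * pd ?\<Phi> i x)" "integrable cube_measure (\<lambda>x. duc i k x * ?\<Phi> x)" for i k
    by (intro integrable_cube_mult_continuous iu idu c)+
  have i2: "integrable cube_measure (\<lambda>x. U x k * pd ?\<Phi> i x)" "integrable cube_measure (\<lambda>x. G x k * ?\<Phi> x)" if "k \<in> J" for i k
    by (intro integrable_cube_mult_continuous iU iG that c)+
  have "(\<integral>x. (\<Sum>i\<in>UNIV. (\<Sum>k\<in>J. PN_A i j k * err k x) * pd ?\<Phi> i x) \<partial>cube_measure)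
      = (\<integral>x. (\<Sum>i\<in>UNIV. \<Sum>k\<in>J. PN_A i j k * (uc k x * pd ?\<Phi> i x - U x k * pd ?\<Phi> i x)) \<partial>cube_measure)"
    by (simp add: err_def sum_distrib_right left_diff_distrib mult.assoc)
  also have "\<dots> = (\<Sum>i\<in>UNIV. \<Sum>k\<in>J. PN_A i j k * ((\<integral>x. uc k x * pd ?\<Phi> i x \<partial>cube_measure) - (\<integral>x. U x k * pd ?\<Phi> i x \<partial>cube_measure)))"
    using i1(1) i2(1) by (simp add: Bochner_Integration.integral_sum)
  also have "\<dots> = (\<Sum>i\<in>UNIV. \<Sum>k\<in>J. PN_A i j k * - (\<integral>x. duc i k x * ?\<Phi> x \<partial>cube_measure)) + (\<integral>x. G x j * ?\<Phi> x \<partial>cube_measure)"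
    unfolding coefficient_derivative[OF \<phi> cov(1) cov(2)[rule_format]]
    using UG by (simp add: right_diff_distrib sum_subtractf)
  also have "\<dots> = - ((\<Sum>i\<in>UNIV. \<Sum>k\<in>J. PN_A i j k * (\<integral>x. duc i k x * ?\<Phi> x \<partial>cube_measure)) - (\<integral>x. G x j * ?\<Phi> x \<partial>cube_measure))"
    by (simp add: sum_negf)
  also have "(\<Sum>i\<in>UNIV. \<Sum>k\<in>J. PN_A i j k * (\<integral>x. duc i k x * ?\<Phi> x \<partial>cube_measure)) - (\<integral>x. G x j * ?\<Phi> x \<partial>cube_measure)
      = (\<integral>x. (\<Sum>i\<in>UNIV. \<Sum>k\<in>J. PN_A i j k * (duc i k x * ?\<Phi> x)) - G x j * ?\<Phi> x \<partial>cube_measure)"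
    using i1(2) i2(2)[OF j] by (simp add: Bochner_Integration.integral_sum)
  also have "\<dots> = (\<integral>x. div_err j x * ?\<Phi> x \<partial>cube_measure)"
    by (simp add: div_err_def sum_distrib_right left_diff_distrib mult.assoc)
  finally show "(\<integral>x. (\<Sum>i\<in>UNIV. (\<Sum>k\<in>J. PN_A i j k * err k x) * pd ?\<Phi> i x) \<partial>cube_measure) = - (\<integral>x. div_err j x * ?\<Phi> x \<partial>cube_measure)" .
qed

lemma energy_zero: "(\<Sum>j\<in>J. \<integral>x. err j x * div_err j x \<partial>cube_measure) = 0"
  \<comment> \<open>The energy identity rests on the symmetry of the matrices, which is evident from
    their integral formula.\<close>
  by (rule torus_energy_zero[where B=PN_A, OF finite_PN_indices err_L2 div_err_L2 PN_A_sym err_torus_div])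

end

lemma integral_PN_m:
  assumes "j \<in> PN_indices N"
  shows "sqrt (1 / (4 * pi)) * (\<integral>\<omega>. PN_m j \<omega> \<partial>sphere_measure) = (if j = (0, 0) then 1 else 0)"
proof -
  have "(\<integral>\<omega>. PN_m (0, 0) \<omega> * PN_m j \<omega> \<partial>sphere_measure) = (if (0, 0) = j then 1 else 0)"
    by (rule PN_m_orthonormal[OF PN_indices_00 assms])
  then show ?thesis by (simp only: PN_m_00 integral_mult_right_zero eq_commute[of "(0, 0)" j])
qed

context PN_comparison
begin

text \<open>The factor 1/(4 pi) of the mean is the square of the constant harmonic: one factor turns
  the integral of \<open>u\<close> into a coefficient, the other tests \<open>PN_m j\<close> against
  the constant by orthonormality.\<close>

lemma angular_mean_coeff:
  assumes "j \<in> J"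
  shows "angular_mean u x * (\<integral>\<omega>. PN_m j \<omega> \<partial>sphere_measure) = (if j = (0, 0) then uc j x else 0)"
proof -
  define c :: real where "c = sqrt (1 / (4 * pi))"
  have c2: "c * c = 1 / (4 * pi)" unfolding c_def by (rule real_sqrt_mult_self[THEN trans]) simp
  have u0: "uc (0, 0) x = c * (\<integral>\<omega>. u (x, \<omega>) \<partial>sphere_measure)"
    by (simp only: uc_def PN_coeff_def PN_m_00 integral_mult_right_zero c_def)
  have "angular_mean u x * (\<integral>\<omega>. PN_m j \<omega> \<partial>sphere_measure)
      = c * (\<integral>\<omega>. u (x, \<omega>) \<partial>sphere_measure) * (c * (\<integral>\<omega>. PN_m j \<omega> \<partial>sphere_measure))"
    unfolding angular_mean_def c2[symmetric] by (simp add: mult_ac)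
  then show ?thesis using integral_PN_m[OF assms] u0 by (auto simp flip: c_def)
qed

lemma rte_coefficients:
  "AE x in cube_measure. \<forall>j\<in>J. gc j x + \<sigma>t x / \<epsilon> * uc j x
     = (\<sigma>t x / \<epsilon> - \<epsilon> * \<sigma>a x) * (if j = (0, 0) then uc j x else 0) + \<epsilon> * PN_rhs f j x"
proof -
  have "AE x in cube_measure. AE \<omega> in sphere_measure. g (x, \<omega>) + \<sigma>t x / \<epsilon> * u (x, \<omega>)
      = (\<sigma>t x / \<epsilon> - \<epsilon> * \<sigma>a x) * angular_mean u x + \<epsilon> * f (x, \<omega>)"
    using phase.AE_pair[OF rte] by simp
  then show ?thesis
    using AE_section_L2[OF uL] AE_section_L2[OF gL] AE_section_L2[OF f]
  proof eventually_elim
    case (elim x)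
    show ?case
    proof
      fix j assume j: "j \<in> J"
      have i: "integrable sphere_measure (\<lambda>\<omega>. PN_m j \<omega> * u (x, \<omega>))" "integrable sphere_measure (\<lambda>\<omega>. PN_m j \<omega> * g (x, \<omega>))"
        "integrable sphere_measure (\<lambda>\<omega>. PN_m j \<omega> * f (x, \<omega>))"
        by (intro integrable_L2_mult PN_m_in_L2 elim)+
      have im: "integrable sphere_measure (PN_m j)" by (intro sphere.integrable_L2 PN_m_in_L2)
      have "gc j x + \<sigma>t x / \<epsilon> * uc j x = (\<integral>\<omega>. PN_m j \<omega> * g (x, \<omega>) + \<sigma>t x / \<epsilon> * (PN_m j \<omega> * u (x, \<omega>)) \<partial>sphere_measure)"
        using i by (simp add: gc_def uc_def PN_coeff_def)
      also have "\<dots> = (\<integral>\<omega>. ((\<sigma>t x / \<epsilon> - \<epsilon> * \<sigma>a x) * angular_mean u x) * PN_m j \<omega> + \<epsilon> * (PN_m j \<omega> * f (x, \<omega>)) \<partial>sphere_measure)"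
      proof (rule integral_cong_AE)
        show "(\<lambda>\<omega>. PN_m j \<omega> * g (x, \<omega>) + \<sigma>t x / \<epsilon> * (PN_m j \<omega> * u (x, \<omega>))) \<in> borel_measurable sphere_measure"
          using i by (intro borel_measurable_add borel_measurable_times borel_measurable_const borel_measurable_integrable[OF i(2)] borel_measurable_integrable[OF i(1)])
        show "(\<lambda>\<omega>. ((\<sigma>t x / \<epsilon> - \<epsilon> * \<sigma>a x) * angular_mean u x) * PN_m j \<omega> + \<epsilon> * (PN_m j \<omega> * f (x, \<omega>))) \<in> borel_measurable sphere_measure"
          by (intro borel_measurable_integrable Bochner_Integration.integrable_add Bochner_Integration.integrable_mult_right im i(3))
        show "AE \<omega> in sphere_measure. PN_m j \<omega> * g (x, \<omega>) + \<sigma>t x / \<epsilon> * (PN_m j \<omega> * u (x, \<omega>))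
            = ((\<sigma>t x / \<epsilon> - \<epsilon> * \<sigma>a x) * angular_mean u x) * PN_m j \<omega> + \<epsilon> * (PN_m j \<omega> * f (x, \<omega>))"
          using elim(1)
        proof eventually_elim
          case (elim \<omega>)
          have "PN_m j \<omega> * g (x, \<omega>) + \<sigma>t x / \<epsilon> * (PN_m j \<omega> * u (x, \<omega>)) = PN_m j \<omega> * (g (x, \<omega>) + \<sigma>t x / \<epsilon> * u (x, \<omega>))"
            by (simp add: distrib_left mult_ac)
          then show ?case unfolding elim by (simp add: distrib_left mult_ac)
        qed
      qed
      also have "\<dots> = (\<sigma>t x / \<epsilon> - \<epsilon> * \<sigma>a x) * (angular_mean u x * (\<integral>\<omega>. PN_m j \<omega> \<partial>sphere_measure)) + \<epsilon> * PN_rhs f j x"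
        using im i(3) by (simp add: PN_rhs_def mult.assoc)
      finally show "gc j x + \<sigma>t x / \<epsilon> * uc j x
          = (\<sigma>t x / \<epsilon> - \<epsilon> * \<sigma>a x) * (if j = (0, 0) then uc j x else 0) + \<epsilon> * PN_rhs f j x"
        unfolding angular_mean_coeff[OF j] .
    qed
  qed
qed

definition damping :: "pn_index \<Rightarrow> vec3 \<Rightarrow> real" where
  "damping j x = (if j = (0, 0) then \<epsilon> * \<sigma>a x else \<sigma>t x / \<epsilon>)"

lemma div_err_defect: "AE x in cube_measure. \<forall>j\<in>J. div_err j x + defect j x = gc j x - G x j"
proof (rule AE_finite_allI[OF finite_PN_indices])
  fix j
  show "AE x in cube_measure. div_err j x + defect j x = gc j x - G x j"
    using gc_eq[of j] by eventually_elim (simp add: div_err_def defect_def transport_defect_def duc_def)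
qed

lemma error_equation: "AE x in cube_measure. \<forall>j\<in>J. div_err j x + defect j x + damping j x * err j x = 0"
  using rte_coefficients PN div_err_defect
proof eventually_elim
  case (elim x)
  show ?case
  proof
    fix j assume j: "j \<in> J"
    have R: "(\<Sum>k\<in>J. PN_R j k * U x k) = (if j = (0, 0) then 0 else U x j)"
    proof -
      have "(\<Sum>k\<in>J. PN_R j k * U x k) = (\<Sum>k\<in>J. if k = j then (if j = (0, 0) then 0 else U x j) else 0)"
        by (intro sum.cong) (auto simp: PN_R_def)
      then show ?thesis using j by simp
    qed
    show "div_err j x + defect j x + damping j x * err j x = 0"
      using elim j R by (auto simp: damping_def err_def algebra_simps dest!: bspec[of _ _ j])
  qed
qed

lemma err_bound: "(\<Sum>j\<in>J. \<integral>x. (err j x)\<^sup>2 \<partial>cube_measure) \<le> 1 / \<sigma>min\<^sup>2 * (\<Sum>j\<in>J. \<integral>x. (defect j x)\<^sup>2 \<partial>cube_measure)"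
proof -
  have duS: "AE x in cube_measure. \<forall>i. in_L2 sphere_measure (\<lambda>\<omega>. du i (x, \<omega>))"
    unfolding AE_all_countable using AE_section_L2[OF duL] by blast
  have "AE x in cube_measure. \<forall>j\<in>J. err j x * div_err j x
      \<le> - (\<epsilon> * \<sigma>min / 2) * (err j x)\<^sup>2 + \<epsilon> / (2 * \<sigma>min) * (defect j x)\<^sup>2"
    using error_equation \<sigma> duS
  proof eventually_elim
    case (elim x)
    show ?case
    proof
      fix j assume j: "j \<in> J"
      have "damping j x \<ge> \<sigma>min / \<epsilon> \<or> damping j x \<ge> \<epsilon> * \<sigma>min \<and> defect j x = 0"
      proof (cases "j = (0, 0)")
        case True
        have "defect (0, 0) x = 0" unfolding defect_def by (rule transport_defect_00[OF _ N]) (use elim(3) in blast)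
        then show ?thesis using True elim(2) \<epsilon> by (simp add: damping_def)
      next
        case False
        then show ?thesis using elim(2) \<epsilon> by (auto simp: damping_def intro!: divide_right_mono)
      qed
      then show "err j x * div_err j x \<le> - (\<epsilon> * \<sigma>min / 2) * (err j x)\<^sup>2 + \<epsilon> / (2 * \<sigma>min) * (defect j x)\<^sup>2"
        using elim(1) j \<epsilon> \<sigma>min by (intro damping_estimate) auto
    qed
  qed
  then have "(\<integral>x. err j x * div_err j x \<partial>cube_measure)
      \<le> (\<integral>x. - (\<epsilon> * \<sigma>min / 2) * (err j x)\<^sup>2 + \<epsilon> / (2 * \<sigma>min) * (defect j x)\<^sup>2 \<partial>cube_measure)" if "j \<in> J" for j
    using that
    by (intro integral_mono_AE integrable_L2_mult err_L2 div_err_L2 Bochner_Integration.integrable_add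
        Bochner_Integration.integrable_mult_right L2_integrable_square defect_L2) (auto elim: AE_mp)
  moreover have "(\<integral>x. - (\<epsilon> * \<sigma>min / 2) * (err j x)\<^sup>2 + \<epsilon> / (2 * \<sigma>min) * (defect j x)\<^sup>2 \<partial>cube_measure)
      = - (\<epsilon> * \<sigma>min / 2) * (\<integral>x. (err j x)\<^sup>2 \<partial>cube_measure) + \<epsilon> / (2 * \<sigma>min) * (\<integral>x. (defect j x)\<^sup>2 \<partial>cube_measure)"
    if "j \<in> J" for j
    using L2_integrable_square[OF err_L2[OF that]] L2_integrable_square[OF defect_L2[of j]]
    by (simp only: Bochner_Integration.integral_add Bochner_Integration.integrable_mult_right integral_mult_right_zero)
  ultimately have "(\<integral>x. err j x * div_err j x \<partial>cube_measure)
      \<le> - (\<epsilon> * \<sigma>min / 2) * (\<integral>x. (err j x)\<^sup>2 \<partial>cube_measure) + \<epsilon> / (2 * \<sigma>min) * (\<integral>x. (defect j x)\<^sup>2 \<partial>cube_measure)" if "j \<in> J" for j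
    using that by (simp only:)
  then have "(\<Sum>j\<in>J. \<integral>x. err j x * div_err j x \<partial>cube_measure)
      \<le> (\<Sum>j\<in>J. - (\<epsilon> * \<sigma>min / 2) * (\<integral>x. (err j x)\<^sup>2 \<partial>cube_measure) + \<epsilon> / (2 * \<sigma>min) * (\<integral>x. (defect j x)\<^sup>2 \<partial>cube_measure))"
    by (rule sum_mono)
  then have "0 \<le> - (\<epsilon> * \<sigma>min / 2) * (\<Sum>j\<in>J. \<integral>x. (err j x)\<^sup>2 \<partial>cube_measure) + \<epsilon> / (2 * \<sigma>min) * (\<Sum>j\<in>J. \<integral>x. (defect j x)\<^sup>2 \<partial>cube_measure)"
    unfolding energy_zero sum.distrib sum_distrib_left .
  \<comment> \<open>Both terms carry a factor \<epsilon>, which cancels here; the quotient of the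
    remaining weights is \<open>1 / \<sigma>min\<^sup>2\<close>.\<close>
  moreover have "0 \<le> - (\<epsilon> * \<sigma>min / 2) * X + \<epsilon> / (2 * \<sigma>min) * Y \<Longrightarrow> X \<le> 1 / \<sigma>min\<^sup>2 * Y" for X Y
    using \<epsilon>(1) \<sigma>min by (simp add: field_simps power2_eq_square)
  ultimately show ?thesis by blast
qed

lemma defect_bound:
  "(\<Sum>j\<in>J. \<integral>x. (defect j x)\<^sup>2 \<partial>cube_measure) \<le> real N powr (- 2 * q) * (\<Sum>i\<in>UNIV. (L2_Hq_norm q (du i))\<^sup>2)"
proof -
  have hi: "integrable cube_measure (\<lambda>x. (Hq_norm q (\<lambda>\<omega>. du i (x, \<omega>)))\<^sup>2)" for i
    using du_Hq[of i] by (auto simp: in_L2_Hq_def in_L2_def)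
  have ae: "AE x in cube_measure. \<forall>i. in_Hq q (\<lambda>\<omega>. du i (x, \<omega>))"
    unfolding AE_all_countable using du_Hq by (auto simp: in_L2_Hq_def)
  have "(\<Sum>j\<in>J. \<integral>x. (defect j x)\<^sup>2 \<partial>cube_measure) = (\<integral>x. (\<Sum>j\<in>J. (defect j x)\<^sup>2) \<partial>cube_measure)"
    by (intro Bochner_Integration.integral_sum[symmetric] L2_integrable_square defect_L2)
  also have "\<dots> \<le> (\<integral>x. real N powr (- 2 * q) * (\<Sum>i\<in>UNIV. (Hq_norm q (\<lambda>\<omega>. du i (x, \<omega>)))\<^sup>2) \<partial>cube_measure)"
  proof (rule integral_mono_AE)
    show "AE x in cube_measure. (\<Sum>j\<in>J. (defect j x)\<^sup>2) \<le> real N powr (- 2 * q) * (\<Sum>i\<in>UNIV. (Hq_norm q (\<lambda>\<omega>. du i (x, \<omega>)))\<^sup>2)"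
      using ae by eventually_elim (unfold defect_def, rule transport_defect_bound[OF _ q N], blast)
  qed (intro Bochner_Integration.integrable_sum L2_integrable_square defect_L2 Bochner_Integration.integrable_mult_right hi)+
  also have "\<dots> = real N powr (- 2 * q) * (\<Sum>i\<in>UNIV. (L2_Hq_norm q (du i))\<^sup>2)"
    using hi by (simp add: L2_Hq_norm_square Bochner_Integration.integral_sum)
  finally show ?thesis .
qed

section \<open>Assembly of the error in phase space\<close>

lemma PN_approx_L2: "in_L2 phase_measure (PN_approx N U)"
proof -
  have "in_L2 phase_measure (\<lambda>p. PN_m j (snd p) * U (fst p) j)" if j: "j \<in> J" for j
    unfolding in_L2_def
  proof
    have [measurable]: "(\<lambda>x. U x j) \<in> borel_measurable cube_measure" using U_L2[OF j] by (simp add: in_L2_def)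
    have [measurable]: "PN_m j \<in> borel_measurable sphere_measure" using PN_m_in_L2[of j] by (simp add: in_L2_def)
    show m: "(\<lambda>p. PN_m j (snd p) * U (fst p) j) \<in> borel_measurable phase_measure" by measurable
    have iU: "integrable cube_measure (\<lambda>x. (U x j)\<^sup>2)" and im: "integrable sphere_measure (\<lambda>\<omega>. (PN_m j \<omega>)\<^sup>2)"
      by (intro L2_integrable_square U_L2 j PN_m_in_L2)+
    show "integrable phase_measure (\<lambda>p. (PN_m j (snd p) * U (fst p) j)\<^sup>2)"
    proof (rule phase.Fubini_integrable)
      show "integrable cube_measure (\<lambda>x. \<integral>\<omega>. norm ((PN_m j (snd (x, \<omega>)) * U (fst (x, \<omega>)) j)\<^sup>2) \<partial>sphere_measure)"
        using iU by (simp add: power_mult_distrib)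
      show "AE x in cube_measure. integrable sphere_measure (\<lambda>\<omega>. (PN_m j (snd (x, \<omega>)) * U (fst (x, \<omega>)) j)\<^sup>2)"
        using im by (simp add: power_mult_distrib)
    qed measurable
  qed
  then show ?thesis unfolding PN_approx_def case_prod_beta' by (intro in_L2_sum) auto
qed

theorem error_bound:
  "L2norm phase_measure (\<lambda>y. u y - PN_approx N U y)
    \<le> (1 + 1 / \<sigma>min) * real N powr (- q) * (L2_Hq_norm q u + (\<Sum>i\<in>UNIV. L2_Hq_norm q (du i)))"
proof -
  let ?P = "real N powr (- 2 * q)"
  have diffL: "in_L2 phase_measure (\<lambda>y. u y - PN_approx N U y)" by (intro in_L2_diff uL PN_approx_L2)
  have ui2: "integrable cube_measure (\<lambda>x. (Hq_norm q (\<lambda>\<omega>. u (x, \<omega>)))\<^sup>2)"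
    using u_Hq by (auto simp: in_L2_Hq_def in_L2_def)
  have "(\<integral>y. (u y - PN_approx N U y)\<^sup>2 \<partial>phase_measure)
      = (\<integral>x. \<integral>\<omega>. (u (x, \<omega>) - PN_approx N U (x, \<omega>))\<^sup>2 \<partial>sphere_measure \<partial>cube_measure)"
    by (rule phase.integral_fst'[symmetric, OF L2_integrable_square[OF diffL]])
  also have "\<dots> \<le> (\<integral>x. ?P * (Hq_norm q (\<lambda>\<omega>. u (x, \<omega>)))\<^sup>2 + (\<Sum>j\<in>J. (err j x)\<^sup>2) \<partial>cube_measure)"
  proof (rule integral_mono_AE)
    show "integrable cube_measure (\<lambda>x. \<integral>\<omega>. (u (x, \<omega>) - PN_approx N U (x, \<omega>))\<^sup>2 \<partial>sphere_measure)"
      by (rule phase.integrable_fst'[OF L2_integrable_square[OF diffL]])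
    show "integrable cube_measure (\<lambda>x. ?P * (Hq_norm q (\<lambda>\<omega>. u (x, \<omega>)))\<^sup>2 + (\<Sum>j\<in>J. (err j x)\<^sup>2))"
      by (intro Bochner_Integration.integrable_add Bochner_Integration.integrable_mult_right ui2
          Bochner_Integration.integrable_sum L2_integrable_square err_L2)
    have "AE x in cube_measure. in_Hq q (\<lambda>\<omega>. u (x, \<omega>))" using u_Hq by (simp add: in_L2_Hq_def)
    then show "AE x in cube_measure. (\<integral>\<omega>. (u (x, \<omega>) - PN_approx N U (x, \<omega>))\<^sup>2 \<partial>sphere_measure)
        \<le> ?P * (Hq_norm q (\<lambda>\<omega>. u (x, \<omega>)))\<^sup>2 + (\<Sum>j\<in>J. (err j x)\<^sup>2)"
    proof eventually_elim
      case (elim x)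
      have L: "in_L2 sphere_measure (\<lambda>\<omega>. u (x, \<omega>))" using elim by (simp add: in_Hq_def)
      have "(\<integral>\<omega>. (u (x, \<omega>) - PN_approx N U (x, \<omega>))\<^sup>2 \<partial>sphere_measure)
          = (\<integral>\<omega>. (u (x, \<omega>) - (\<Sum>j\<in>J. U x j * PN_m j \<omega>))\<^sup>2 \<partial>sphere_measure)"
        by (simp add: PN_approx_def mult.commute)
      \<comment> \<open>Pythagoras with the coefficients \<open>U x j\<close>: the part of degree
        above \<open>N\<close> is orthogonal to the coefficient error, so the two squares add
        without a mixed term.\<close>
      also have "\<dots> = (\<integral>\<omega>. (u (x, \<omega>) - PN_proj N (\<lambda>\<omega>. u (x, \<omega>)) \<omega>)\<^sup>2 \<partial>sphere_measure) + (\<Sum>j\<in>J. (U x j - uc j x)\<^sup>2)"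
        unfolding integral_square_PN_combination[OF L] integral_square_PN_proj[OF L] uc_def ..
      also have "(\<Sum>j\<in>J. (U x j - uc j x)\<^sup>2) = (\<Sum>j\<in>J. (err j x)\<^sup>2)"
        by (simp add: err_def power2_commute)
      finally show ?case using PN_proj_error[OF elim q N] by simp
    qed
  qed
  also have "\<dots> = ?P * (L2_Hq_norm q u)\<^sup>2 + (\<Sum>j\<in>J. \<integral>x. (err j x)\<^sup>2 \<partial>cube_measure)"
    using ui2 L2_integrable_square[OF err_L2] by (simp add: L2_Hq_norm_square Bochner_Integration.integral_sum)
  also have "(\<Sum>j\<in>J. \<integral>x. (err j x)\<^sup>2 \<partial>cube_measure) \<le> 1 / \<sigma>min\<^sup>2 * (?P * (\<Sum>i\<in>UNIV. (L2_Hq_norm q (du i))\<^sup>2))"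
    using err_bound defect_bound \<sigma>min by (intro order_trans[OF err_bound] mult_left_mono) auto
  finally have sq: "(\<integral>y. (u y - PN_approx N U y)\<^sup>2 \<partial>phase_measure)
      \<le> ?P * (L2_Hq_norm q u)\<^sup>2 + 1 / \<sigma>min\<^sup>2 * (?P * (\<Sum>i\<in>UNIV. (L2_Hq_norm q (du i))\<^sup>2))" by simp
  define a b where "a = L2_Hq_norm q u" and "b = (\<Sum>i\<in>UNIV. L2_Hq_norm q (du i))"
  have nn: "0 \<le> L2_Hq_norm q v" for v by (simp add: L2_Hq_norm_def L2norm_def)
  have a: "a \<ge> 0" and b: "b \<ge> 0" by (auto simp: a_def b_def nn sum_nonneg)
  have bs: "(\<Sum>i\<in>UNIV. (L2_Hq_norm q (du i))\<^sup>2) \<le> b\<^sup>2"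
    unfolding b_def using nn by (simp add: sum_3 power2_sum)
  have P: "?P = (real N powr (- q))\<^sup>2" by (simp add: power2_eq_square flip: powr_add)
  have "(\<integral>y. (u y - PN_approx N U y)\<^sup>2 \<partial>phase_measure) \<le> ?P * a\<^sup>2 + 1 / \<sigma>min\<^sup>2 * (?P * b\<^sup>2)"
  proof -
    have "1 / \<sigma>min\<^sup>2 * (?P * (\<Sum>i\<in>UNIV. (L2_Hq_norm q (du i))\<^sup>2)) \<le> 1 / \<sigma>min\<^sup>2 * (?P * b\<^sup>2)"
      using bs by (intro mult_left_mono) auto
    then show ?thesis using sq unfolding a_def by linarith
  qed
  also have "\<dots> = (real N powr (- q) * a)\<^sup>2 + (real N powr (- q) * (1 / \<sigma>min * b))\<^sup>2"
    unfolding P by (simp add: power_mult_distrib power_divide)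
  \<comment> \<open>The mixed term of the square is nonnegative, so the square root splits into a
    sum without any extra factor.\<close>
  also have "\<dots> \<le> (real N powr (- q) * a + real N powr (- q) * (1 / \<sigma>min * b))\<^sup>2"
    using a b \<sigma>min by (simp add: power2_sum)
  finally have "L2norm phase_measure (\<lambda>y. u y - PN_approx N U y)
      \<le> real N powr (- q) * a + real N powr (- q) * (1 / \<sigma>min * b)"
    unfolding L2norm_def using a b \<sigma>min by (intro real_le_lsqrt add_nonneg_nonneg mult_nonneg_nonneg) auto
  also have "\<dots> \<le> (1 + 1 / \<sigma>min) * real N powr (- q) * (a + b)"
  proof -
    have "a + 1 / \<sigma>min * b \<le> (1 + 1 / \<sigma>min) * (a + b)" using a b \<sigma>min by (simp add: algebra_simps add_divide_distrib add_nonneg_nonneg)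
    then have "real N powr (- q) * (a + 1 / \<sigma>min * b) \<le> real N powr (- q) * ((1 + 1 / \<sigma>min) * (a + b))"
      by (intro mult_left_mono) auto
    then show ?thesis by (simp only: distrib_left[of "real N powr (- q)" a] mult_ac)
  qed
  finally show ?thesis unfolding a_def b_def .
qed

end

theorem theorem3p4:
  fixes \<sigma>t \<sigma>a :: "vec3 \<Rightarrow> real" and \<sigma>min q :: real
  assumes "in_Linf cube_measure \<sigma>t" and "in_Linf cube_measure \<sigma>a"
    and "\<sigma>min > 0"
    and "AE x in cube_measure. \<sigma>t x > \<sigma>a x \<and> \<sigma>a x \<ge> \<sigma>min"
    and "q > 0"
  shows "\<exists>C>0. \<forall>(N::nat) (\<epsilon>::real) f u (du :: 3 \<Rightarrow> vec3 \<times> vec3 \<Rightarrow> real) U.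
      N \<ge> 1 \<and> 0 < \<epsilon> \<and> \<epsilon> < 1 \<and>
      (AE x in cube_measure. \<sigma>t x - \<epsilon>\<^sup>2 * \<sigma>a x > 0) \<and>
      in_L2 phase_measure f \<and>
      rte_solution \<sigma>t \<sigma>a f \<epsilon> u \<and>
      PN_solution \<sigma>t \<sigma>a f \<epsilon> N U \<and>
      in_L2_Hq q u \<and>
      (\<forall>i. weak_dir_deriv unit_cube (\<lambda>\<omega>. axis i 1) u (du i) \<and> in_L2_Hq q (du i))
      \<longrightarrow>
      L2norm phase_measure (\<lambda>y. u y - PN_approx N U y)
        \<le> C * real N powr (- q) * (L2_Hq_norm q u + (\<Sum>i\<in>UNIV. L2_Hq_norm q (du i)))"
proof (intro exI[of _ "1 + 1 / \<sigma>min"] conjI allI impI)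
  \<comment> \<open>The 1 stems from the projection error of \<open>u\<close> and
    \<open>1 / \<sigma>min\<close> from the energy estimate. Only \<sigma>min enters, so the
    constant can be fixed before \<open>N\<close>, \<epsilon>, the source and the solutions.\<close>
  show "0 < 1 + 1 / \<sigma>min" using assms(3) by (simp add: add_pos_pos)
  fix N \<epsilon> f u U and du :: "3 \<Rightarrow> vec3 \<times> vec3 \<Rightarrow> real"
  assume *: "N \<ge> 1 \<and> 0 < \<epsilon> \<and> \<epsilon> < 1 \<and>
      (AE x in cube_measure. \<sigma>t x - \<epsilon>\<^sup>2 * \<sigma>a x > 0) \<and>
      in_L2 phase_measure f \<and>
      rte_solution \<sigma>t \<sigma>a f \<epsilon> u \<and>
      PN_solution \<sigma>t \<sigma>a f \<epsilon> N U \<and>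
      in_L2_Hq q u \<and>
      (\<forall>i. weak_dir_deriv unit_cube (\<lambda>\<omega>. axis i 1) u (du i) \<and> in_L2_Hq q (du i))"
  then obtain g G where "periodic_L2_phase g" "weak_dir_deriv UNIV (\<lambda>\<omega>. \<omega>) u g"
      "AE (x, \<omega>) in phase_measure. g (x, \<omega>) + \<sigma>t x / \<epsilon> * u (x, \<omega>)
        = (\<sigma>t x / \<epsilon> - \<epsilon> * \<sigma>a x) * angular_mean u x + \<epsilon> * f (x, \<omega>)"
      "periodic_L2_vec N G" "weak_PN_transport N U G"
      "AE x in cube_measure. \<forall>j\<in>PN_indices N. G x j + \<epsilon> * \<sigma>a x * U x j
         + (\<sigma>t x / \<epsilon> - \<epsilon> * \<sigma>a x) * (\<Sum>k\<in>PN_indices N. PN_R j k * U x k) = \<epsilon> * PN_rhs f j x"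
    unfolding rte_solution_def PN_solution_def by blast
  then interpret PN_comparison \<sigma>t \<sigma>a \<sigma>min q \<epsilon> N f u g du U G
    using * assms by unfold_locales (auto simp: rte_solution_def PN_solution_def)
  show "L2norm phase_measure (\<lambda>y. u y - PN_approx N U y)
      \<le> (1 + 1 / \<sigma>min) * real N powr (- q) * (L2_Hq_norm q u + (\<Sum>i\<in>UNIV. L2_Hq_norm q (du i)))"
    by (rule error_bound)
qed

end
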